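(* If there is a fixed $\varepsilon>0$ such that the \textsc{kTree} problem can be solved in time $O^*((2-\varepsilon)^k)$, then there is a $\delta=\delta(\varepsilon)>0$ such that \textsc{Set Cover} on $n$ elements and $m$ sets can be solved in time $O^*((2-\delta)^n)$.
   Context: The \textsc{kTree} problem: given an $n$-vertex (undirected) graph $G$ and a tree $T$ on $k$ vertices, decide whether $G$ contains a subgraph isomorphic to $T$. The \textsc{Set Cover} problem: given a ground set $[n]=\{1,\dots,n\}$ and a collection of $m$ subsets of it, find a smallest subcollection whose union is $[n]$. The notation $O^*(\cdot)$ hides factors polynomial in the size of the instance. *)

theory Defs
  imports
    Complex_Main
    "Graph_Theory.Pair_Digraph"
    "Graph_Theory.Digraph_Isomorphism"
begin

section \<open>Model of computation\<close>

text \<open>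
  Algorithms are deterministic programs of Jones' language WHILE, which computes on immutable
  binary trees and charges one unit per elementary operation. With shared subtrees (pointers) every
  operation is a constant number of RAM instructions. Conversely, a RAM whose words have
  length logarithmic in its running time can be simulated with only a polylogarithmic
  slowdown, by storing the memory as a binary trie indexed by the bits of the addresses. A factor
  polylogarithmic in a running time of the form \<open>2\<^sup>O\<^sup>(\<^sup>k\<^sup>)\<close> times a polynomial is itself
  polynomial in \<open>k\<close> and the instance size, so the bounds \<open>O\<^sup>*\<close> below have the same meaning as on a
  RAM. (Mere polynomial equivalence of the models would not suffice for this, as it does not
  preserve the base of the exponential.)
\<close>

datatype bintree = Leaf | Node bintree bintree

fun left :: "bintree \<Rightarrow> bintree" where
  "left Leaf = Leaf"
| "left (Node l r) = l"

fun right :: "bintree \<Rightarrow> bintree" where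
  "right Leaf = Leaf"
| "right (Node l r) = r"

datatype exp = Var nat | LeafE | NodeE exp exp | LeftE exp | RightE exp

datatype com =
    Assign nat exp
  | Seq com com
  | If exp com com
  | While exp com

type_synonym store = "nat \<Rightarrow> bintree"

primrec eval_exp :: "exp \<Rightarrow> store \<Rightarrow> bintree" where
  "eval_exp (Var x) s = s x"
| "eval_exp LeafE s = Leaf"
| "eval_exp (NodeE a b) s = Node (eval_exp a s) (eval_exp b s)"
| "eval_exp (LeftE a) s = left (eval_exp a s)"
| "eval_exp (RightE a) s = right (eval_exp a s)"

primrec cost_exp :: "exp \<Rightarrow> nat" where
  "cost_exp (Var x) = 1"
| "cost_exp LeafE = 1"
| "cost_exp (NodeE a b) = cost_exp a + cost_exp b + 1"
| "cost_exp (LeftE a) = cost_exp a + 1"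
| "cost_exp (RightE a) = cost_exp a + 1"

text \<open>
  \<open>exec c s t s'\<close>: started in store \<open>s\<close>, the program \<open>c\<close> halts after exactly \<open>t\<close> steps in store \<open>s'\<close>.
  A test succeeds iff its value is not \<^const>\<open>Leaf\<close>.
\<close>

inductive exec :: "com \<Rightarrow> store \<Rightarrow> nat \<Rightarrow> store \<Rightarrow> bool" where
  Assign: "exec (Assign x e) s (cost_exp e + 1) (s(x := eval_exp e s))"
| Seq: "exec c1 s1 t1 s2 \<Longrightarrow> exec c2 s2 t2 s3 \<Longrightarrow> exec (Seq c1 c2) s1 (t1 + t2 + 1) s3"
| IfTrue: "eval_exp e s \<noteq> Leaf \<Longrightarrow> exec c1 s t s' \<Longrightarrow> exec (If e c1 c2) s (cost_exp e + t + 1) s'"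
| IfFalse: "eval_exp e s = Leaf \<Longrightarrow> exec c2 s t s' \<Longrightarrow> exec (If e c1 c2) s (cost_exp e + t + 1) s'"
| WhileFalse: "eval_exp e s = Leaf \<Longrightarrow> exec (While e c) s (cost_exp e + 1) s"
| WhileTrue: "eval_exp e s1 \<noteq> Leaf \<Longrightarrow> exec c s1 t1 s2 \<Longrightarrow> exec (While e c) s2 t2 s3 \<Longrightarrow>
    exec (While e c) s1 (cost_exp e + t1 + t2 + 1) s3"

inductive_cases exec_AssignE: "exec (Assign x e) s t s'"
inductive_cases exec_SeqE: "exec (Seq c1 c2) s t s'"
inductive_cases exec_IfE: "exec (If e c1 c2) s t s'"
inductive_cases exec_WhileE: "exec (While e c) s t s'"

lemma exec_deterministic:
  "exec c s t s' \<Longrightarrow> exec c s u s'' \<Longrightarrow> u = t \<and> s'' = s'"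
proof (induction arbitrary: u s'' rule: exec.induct)
  case (Assign x e s)
  then show ?case by (auto elim: exec_AssignE)
next
  case (Seq c1 s1 t1 s2 c2 t2 s3)
  from Seq.prems show ?case
  proof (rule exec_SeqE)
    fix u1 r u2
    assume u: "u = Suc (u1 + u2)" and r: "exec c1 s1 u1 r" "exec c2 r u2 s''"
    from Seq.IH(1)[OF r(1)] r(2) have "u1 = t1" "exec c2 s2 u2 s''" by simp_all
    with Seq.IH(2)[OF this(2)] u show ?case by simp
  qed
next
  case (IfTrue e s c1 t s' c2)
  from IfTrue.prems show ?case
    by (rule exec_IfE) (use IfTrue.hyps(1) IfTrue.IH in \<open>(metis Suc_eq_plus1)+\<close>)
next
  case (IfFalse e s c2 t s' c1)
  from IfFalse.prems show ?case
    by (rule exec_IfE) (use IfFalse.hyps(1) IfFalse.IH in \<open>(metis Suc_eq_plus1)+\<close>)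
next
  case (WhileFalse e s c)
  from WhileFalse.prems show ?case
    by (rule exec_WhileE) (use WhileFalse.hyps in \<open>(metis Suc_eq_plus1)+\<close>)
next
  case (WhileTrue e s1 c t1 s2 t2 s3)
  from WhileTrue.prems show ?case
  proof (rule exec_WhileE)
    assume "eval_exp e s1 = Leaf"
    with WhileTrue.hyps(1) show ?case by contradiction
  next
    fix u1 r u2
    assume u: "u = Suc (cost_exp e + u1 + u2)"
      and r: "exec c s1 u1 r" "exec (While e c) r u2 s''"
    from WhileTrue.IH(1)[OF r(1)] r(2) have "u1 = t1" "exec (While e c) s2 u2 s''" by simp_all
    with WhileTrue.IH(2)[OF this(2)] u show ?case by simp
  qed
qed

text \<open>The input is placed in variable 0 and the output is read off variable 0.\<close>

definition runs :: "com \<Rightarrow> bintree \<Rightarrow> nat \<Rightarrow> bintree \<Rightarrow> bool" where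
  "runs p x t y \<longleftrightarrow> (\<exists>s. exec p ((\<lambda>_. Leaf)(0 := x)) t s \<and> s 0 = y)"

text \<open>
  A problem is given by its set of instances, their encoding, and the relation between instances
  and correct outputs. It is solvable in time \<open>O\<^sup>*(f)\<close> if a single program, on every instance \<open>i\<close>,
  produces a correct output within time \<open>f i\<close> times a polynomial in the size of (the encoding
  of) \<open>i\<close>.
\<close>

definition solvable_in_Ostar ::
    "'i set \<Rightarrow> ('i \<Rightarrow> bintree) \<Rightarrow> ('i \<Rightarrow> bintree \<Rightarrow> bool) \<Rightarrow> ('i \<Rightarrow> real) \<Rightarrow> bool" where
  "solvable_in_Ostar I enc correct f \<longleftrightarrow>
     (\<exists>p. \<exists>c d :: nat. \<forall>i\<in>I. \<exists>t y. runs p (enc i) t y \<and> correct i y \<and>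
        real t \<le> real c * real (size (enc i) + 1) ^ d * f i)"


section \<open>Encodings\<close>

definition enc_bool :: "bool \<Rightarrow> bintree" where
  "enc_bool b = (if b then Node Leaf Leaf else Leaf)"

primrec enc_list :: "bintree list \<Rightarrow> bintree" where
  "enc_list [] = Leaf"
| "enc_list (x # xs) = Node x (enc_list xs)"

definition enc_bits :: "bool list \<Rightarrow> bintree" where
  "enc_bits bs = enc_list (map enc_bool bs)"

definition enc_nat :: "nat \<Rightarrow> bintree" where
  "enc_nat n = enc_list (replicate n Leaf)"


section \<open>The problem kTree\<close>

text \<open>
  As usual in the graph library, an undirected simple graph is a finite, symmetric and loop-free
  digraph (\<^locale>\<open>pair_graph\<close>). The library's constant for trees is unsuitable for these: it
  forbids all directed cycles, hence also going back and forth along a single edge. An undirected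
  cycle is a directed one of length at least 3. Note also that connected graphs are nonempty here.
\<close>

definition undirected_tree :: "'a pair_pre_digraph \<Rightarrow> bool" where
  "undirected_tree T \<longleftrightarrow> pair_graph T \<and> Digraph_Component.connected (with_proj T) \<and>
     \<not> (\<exists>p. pre_digraph.cycle (with_proj T) p \<and> 3 \<le> length p)"

definition has_subgraph_isomorphic_to :: "'a pair_pre_digraph \<Rightarrow> 'b pair_pre_digraph \<Rightarrow> bool" where
  "has_subgraph_isomorphic_to G T \<longleftrightarrow>
     (\<exists>H. pair_graph H \<and> subgraph (with_proj H) (with_proj G) \<and>
          digraph_iso (with_proj H) (with_proj T))"

text \<open>Graphs on \<open>n\<close> vertices have vertex set \<open>{0,\<dots>,n-1}\<close> and are input as adjacency matrices.\<close>

definition ktree_instances :: "(nat pair_pre_digraph \<times> nat pair_pre_digraph) set" where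
  "ktree_instances = {(G, T).
     pair_graph G \<and> pverts G = {..<card (pverts G)} \<and>
     undirected_tree T \<and> pverts T = {..<card (pverts T)}}"

definition enc_graph :: "nat pair_pre_digraph \<Rightarrow> bintree" where
  "enc_graph G = (let vs = [0..<card (pverts G)] in
     enc_list (map (\<lambda>u. enc_bits (map (\<lambda>v. (u, v) \<in> parcs G) vs)) vs))"

definition enc_ktree :: "nat pair_pre_digraph \<times> nat pair_pre_digraph \<Rightarrow> bintree" where
  "enc_ktree = (\<lambda>(G, T). Node (enc_graph G) (enc_graph T))"

definition ktree_correct :: "nat pair_pre_digraph \<times> nat pair_pre_digraph \<Rightarrow> bintree \<Rightarrow> bool" where
  "ktree_correct = (\<lambda>(G, T) y. y = enc_bool (has_subgraph_isomorphic_to G T))"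

definition ktree_solvable_in_Ostar :: "(nat \<Rightarrow> real) \<Rightarrow> bool" where
  "ktree_solvable_in_Ostar f \<longleftrightarrow>
     solvable_in_Ostar ktree_instances enc_ktree ktree_correct (\<lambda>(G, T). f (card (pverts T)))"


section \<open>The problem Set Cover\<close>

text \<open>
  An instance \<open>(n, Ss)\<close> consists of the ground set \<open>{1..n}\<close> and a list \<open>Ss\<close> of subsets of it;
  subcollections are sets of indices into \<open>Ss\<close>. The sets are input as characteristic vectors.
\<close>

definition set_cover_instances :: "(nat \<times> nat set list) set" where
  "set_cover_instances = {(n, Ss). \<forall>S\<in>set Ss. S \<subseteq> {1..n}}"

definition enc_set_cover :: "nat \<times> nat set list \<Rightarrow> bintree" where
  "enc_set_cover = (\<lambda>(n, Ss). Node (enc_nat n)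
     (enc_list (map (\<lambda>S. enc_bits (map (\<lambda>i. i \<in> S) [1..<n + 1])) Ss)))"

definition is_cover :: "nat \<Rightarrow> nat set list \<Rightarrow> nat set \<Rightarrow> bool" where
  "is_cover n Ss J \<longleftrightarrow> J \<subseteq> {..<length Ss} \<and> (\<Union>j\<in>J. Ss ! j) = {1..n}"

definition is_smallest_cover :: "nat \<Rightarrow> nat set list \<Rightarrow> nat set \<Rightarrow> bool" where
  "is_smallest_cover n Ss J \<longleftrightarrow> is_cover n Ss J \<and> (\<forall>K. is_cover n Ss K \<longrightarrow> card J \<le> card K)"

text \<open>The output \<^const>\<open>Leaf\<close> reports that there is no cover.\<close>

definition set_cover_correct :: "nat \<times> nat set list \<Rightarrow> bintree \<Rightarrow> bool" where
  "set_cover_correct = (\<lambda>(n, Ss) y.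
     if \<exists>J. is_cover n Ss J
     then \<exists>J. is_smallest_cover n Ss J \<and>
            y = Node Leaf (enc_bits (map (\<lambda>j. j \<in> J) [0..<length Ss]))
     else y = Leaf)"

definition set_cover_solvable_in_Ostar :: "(nat \<Rightarrow> real) \<Rightarrow> bool" where
  "set_cover_solvable_in_Ostar f \<longleftrightarrow>
     solvable_in_Ostar set_cover_instances enc_set_cover set_cover_correct (\<lambda>(n, Ss). f n)"

end

theory Submission
  imports Defs
begin

text \<open>
  A cover of \<open>U\<close> by sets \<open>S\<^sub>1, \<dots>, S\<^sub>a\<close> assigns to each element one of these sets. If the numbers of
  elements assigned to them are known, it is an embedding of a tree of depth 2 (a root, \<open>a\<close> hubs and
  \<open>card U\<close> leaves) into the incidence graph of the sets with an extra element 0 added to all of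
  them as an image of the root. The tree has \<open>1 + a + card U\<close> vertices, so \<open>a\<close> must be small
  compared with \<open>n\<close>: the sets of the cover are combined to groups of a constant number \<open>q\<close> of
  them. Then at most \<open>n div q\<close> groups are needed, and the number of compositions of \<open>card U\<close>
  into so few parts, all of which are tried, is at most \<open>\<gamma> ^ n\<close> up to a polynomial, with \<open>\<gamma>\<close>
  close to 1.

  As the incidence graph is bipartite, an embedding could still exchange the two sides of the
  tree. This is impossible if the degree of the root exceeds the sizes of all groups, which is
  achieved by pendant vertices at the root. To need few of them, fewer than \<open>p\<close> sets of the cover
  are guessed in advance, greedily chosen so that all other sets have at most about \<open>n / p\<close>
  elements outside of them.

  A smallest cover is found by determining its size first and then dropping sets one by one.
\<close>

section \<open>Programs with polynomial overhead\<close>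

text \<open>Each ingredient may cost only a small fraction of \<open>n\<close>, either in the size
  of the pattern or in the exponent of the number of trials. With one hub per set there could be
  \<open>n\<close> hubs; groups of \<open>q\<close> sets leave \<open>n div q\<close>, at the price
  of larger set vertices, which call for about \<open>q * n / p\<close> pendants. Taking
  \<open>p\<close> as \<open>q * q\<close> makes hubs and pendants both cost about
  \<open>n / q\<close> vertices. The groups must not be rounded up, as this would spoil the size of
  the cover; the fewer than \<open>q\<close> sets left over are guessed together with the greedy
  ones. The guessed sets form lists of length at most \<open>p + q\<close>, a constant.

  The root of an embedded pattern need not land on element 0. What counts is that root and leaves
  are as many as the elements available to them, so that all of these are hit.

  The oracle is specified only on encodings of instances, and its time depends on the size of the
  tree. Domains and time bounds are therefore carried through the closure properties, and each guard
  is evaluated before the call that it protects.\<close>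

lemma power_sum_le: "2 \<le> (a::nat) \<Longrightarrow> a ^ i + a ^ j \<le> a ^ (i + j + 1)"
proof -
  assume a: "2 \<le> a"
  have "a ^ i \<le> a ^ (i + j)" "a ^ j \<le> a ^ (i + j)" using a by (auto intro: power_increasing)
  hence "a ^ i + a ^ j \<le> 2 * a ^ (i + j)" by simp
  also have "\<dots> \<le> a * a ^ (i + j)" using a by simp
  finally show ?thesis by simp
qed

lemma const_le_power: "2 \<le> (a::nat) \<Longrightarrow> c \<le> a ^ c"
proof -
  assume a: "2 \<le> a"
  have "c \<le> 2 ^ c" by (simp add: less_imp_le)
  also have "\<dots> \<le> a ^ c" using a by (simp add: power_mono)
  finally show ?thesis .
qed

lemma power_plus_two: "2 \<le> (a::nat) \<Longrightarrow> a ^ i + 2 \<le> a ^ (i + 2)"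
proof -
  assume a: "2 \<le> a"
  have 1: "1 \<le> a ^ i" using a by simp
  have "2 * 2 \<le> a * a" using a mult_le_mono by blast
  hence "a ^ i * 4 \<le> a ^ i * (a * a)" by simp
  then have "a ^ i * 4 \<le> a ^ (i + 2)" by (simp only: power_add power2_eq_square)
  then show ?thesis using 1 by linarith
qed

text \<open>Polynomial bounds in a quantity \<open>s\<close> are written \<open>(s + 2) ^ k\<close>: with a base of at least 2,
  constants, sums, products and compositions of such bounds are again of this form.

  A program computes at \<open>a\<close> with input and output in variable \<open>a\<close> and with all variables above \<open>a\<close>
  as scratch space. The inputs in \<open>D n\<close> are those with parameter \<open>n\<close>, for which the factor \<open>B n\<close>,
  typically exponential, is allowed besides the polynomial one. Sizes of outputs are bounded as
  well, since sharing would allow exponential growth in linear time.\<close>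

definition computes_at ::
    "nat \<Rightarrow> nat \<Rightarrow> (nat \<Rightarrow> real) \<Rightarrow> (nat \<Rightarrow> bintree set) \<Rightarrow> com \<Rightarrow> (bintree \<Rightarrow> bintree) \<Rightarrow> bool" where
  "computes_at a k B D p f \<longleftrightarrow> (\<forall>n s. s a \<in> D n \<longrightarrow>
     (\<exists>t s'. exec p s t s' \<and> s' a = f (s a) \<and> (\<forall>v<a. s' v = s v) \<and>
        real t \<le> real ((size (s a) + 2) ^ k) * B n \<and> size (f (s a)) \<le> (size (s a) + 2) ^ k))"

definition computable :: "(nat \<Rightarrow> real) \<Rightarrow> (nat \<Rightarrow> bintree set) \<Rightarrow> (bintree \<Rightarrow> bintree) \<Rightarrow> bool" where
  "computable B D f \<longleftrightarrow> (\<forall>a. \<exists>p k. computes_at a k B D p f)"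

lemma computableI: "(\<And>a. \<exists>p k. computes_at a k B D p f) \<Longrightarrow> computable B D f"
  by (simp add: computable_def)

lemma computableE:
  assumes "computable B D f"
  obtains p k where "computes_at a k B D p f"
  using assms unfolding computable_def by blast

lemma computes_atE:
  assumes "computes_at a k B D p f" "s a \<in> D n"
  obtains t s' where "exec p s t s'" "s' a = f (s a)" "\<And>v. v < a \<Longrightarrow> s' v = s v"
    "real t \<le> real ((size (s a) + 2) ^ k) * B n" "size (f (s a)) \<le> (size (s a) + 2) ^ k"
  using assms unfolding computes_at_def by blast

lemma computable_size:
  assumes "computable B D f"
  shows "\<exists>k. \<forall>n. \<forall>x\<in>D n. size (f x) \<le> (size x + 2) ^ k"
proof -
  obtain p k where p: "computes_at 0 k B D p f" using assms by (rule computableE)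
  have "size (f x) \<le> (size x + 2) ^ k" if "x \<in> D n" for n x
    using computes_atE[OF p, of "\<lambda>_. x" n] that by auto
  then show ?thesis by blast
qed

lemma computable_cong: "computable B D f \<Longrightarrow> (\<And>n x. x \<in> D n \<Longrightarrow> f x = g x) \<Longrightarrow> computable B D g"
  unfolding computable_def computes_at_def by simp

lemma computable_mono:
  assumes "computable B D f" "\<And>n. B n \<le> B' n" "\<And>n. D' n \<subseteq> D n"
  shows "computable B' D' f"
proof (rule computableI)
  fix a
  obtain p k where p: "computes_at a k B D p f" using assms(1) by (rule computableE)
  have "computes_at a k B' D' p f"
    unfolding computes_at_def
  proof (intro allI impI)
    fix n s assume "s a \<in> D' n"
    then have "s a \<in> D n" using assms(3) by auto
    then obtain t s' where t: "exec p s t s'" "s' a = f (s a)" "\<forall>v<a. s' v = s v"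
      "real t \<le> real ((size (s a) + 2) ^ k) * B n" "size (f (s a)) \<le> (size (s a) + 2) ^ k"
      using p unfolding computes_at_def by blast
    have "real ((size (s a) + 2) ^ k) * B n \<le> real ((size (s a) + 2) ^ k) * B' n"
      by (intro mult_left_mono assms) auto
    with t(4) have "real t \<le> real ((size (s a) + 2) ^ k) * B' n" by linarith
    with t show "\<exists>t s'. exec p s t s' \<and> s' a = f (s a) \<and> (\<forall>v<a. s' v = s v) \<and>
        real t \<le> real ((size (s a) + 2) ^ k) * B' n \<and> size (f (s a)) \<le> (size (s a) + 2) ^ k"
      by blast
  qed
  then show "\<exists>p k. computes_at a k B' D' p f" by blast
qed

lemma computes_atI:
  assumes "\<And>n s. s a \<in> D n \<Longrightarrow> \<exists>t s'. exec p s t s' \<and> s' a = f (s a) \<and> (\<forall>v<a. s' v = s v) \<and>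
        real t \<le> real ((size (s a) + 2) ^ k) * B n \<and> size (f (s a)) \<le> (size (s a) + 2) ^ k"
  shows "computes_at a k B D p f"
  using assms by (simp add: computes_at_def)

lemma computable_basic:
  assumes e: "\<And>a. \<exists>e c. \<forall>s. eval_exp e s = f (s a) \<and> cost_exp e + 1 \<le> c \<and> size (f (s a)) \<le> size (s a) + c"
    and B: "\<And>n. 1 \<le> B n"
  shows "computable B D f"
proof (rule computableI)
  fix a
  obtain e c where e: "eval_exp e s = f (s a)" "cost_exp e + 1 \<le> c" "size (f (s a)) \<le> size (s a) + c" for s
    using e[of a] by blast
  have "computes_at a (c + 2) B D (Assign a e) f"
  proof (rule computes_atI)
    fix n s assume "s a \<in> D n"
    define b where "b = size (s a) + 2"
    have b: "2 \<le> b" by (simp add: b_def)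
    have "c + b \<le> b ^ c + b ^ 1" using const_le_power[OF b] by simp
    also have "\<dots> \<le> b ^ (c + 2)" using power_sum_le[OF b, of c 1] by simp
    finally have c: "c + b \<le> b ^ (c + 2)" .
    have "real (cost_exp e + 1) \<le> real (b ^ (c + 2)) * 1"
      unfolding mult_1_right of_nat_le_iff using c e(2) by linarith
    also have "\<dots> \<le> real (b ^ (c + 2)) * B n" by (intro mult_left_mono B) auto
    finally have "real (cost_exp e + 1) \<le> real (b ^ (c + 2)) * B n" .
    moreover have "size (f (s a)) \<le> b ^ (c + 2)" using e(3)[of s] c by (simp add: b_def)
    ultimately show "\<exists>t s'. exec (Assign a e) s t s' \<and> s' a = f (s a) \<and> (\<forall>v<a. s' v = s v) \<and>
        real t \<le> real ((size (s a) + 2) ^ (c + 2)) * B n \<and> size (f (s a)) \<le> (size (s a) + 2) ^ (c + 2)"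
      unfolding b_def[symmetric] using exec.Assign[of a e s] e(1)[of s] by fastforce
  qed
  then show "\<exists>p k. computes_at a k B D p f" by blast
qed

lemma computable_id: "(\<And>n. 1 \<le> B n) \<Longrightarrow> computable B D (\<lambda>x. x)"
  by (rule computable_basic, rule exI[of _ "Var _"], rule exI[of _ 2]) auto

lemma size_left: "size (left x) \<le> size x"
  by (cases x) auto

lemma size_right: "size (right x) \<le> size x"
  by (cases x) auto

lemma computable_left0: "(\<And>n. 1 \<le> B n) \<Longrightarrow> computable B D left"
  by (rule computable_basic, rule exI[of _ "LeftE (Var _)"], rule exI[of _ 3])
    (auto intro: le_trans[OF size_left])

lemma computable_right0: "(\<And>n. 1 \<le> B n) \<Longrightarrow> computable B D right"
  by (rule computable_basic, rule exI[of _ "RightE (Var _)"], rule exI[of _ 3])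
    (auto intro: le_trans[OF size_right])

primrec const_exp :: "bintree \<Rightarrow> exp" where
  "const_exp Leaf = LeafE"
| "const_exp (Node l r) = NodeE (const_exp l) (const_exp r)"

lemma eval_const_exp[simp]: "eval_exp (const_exp c) s = c"
  by (induction c) auto

lemma computable_const: "(\<And>n. 1 \<le> B n) \<Longrightarrow> computable B D (\<lambda>x. c)"
  by (rule computable_basic, rule exI[of _ "const_exp c"], rule exI[of _ "cost_exp (const_exp c) + size c + 1"]) auto

lemma real_bound_mult:
  assumes "t \<le> real m * B" "m \<le> m'" "1 \<le> (B::real)"
  shows "t \<le> real m' * B"
  using assms by (smt (verit) mult_right_mono of_nat_le_iff)

lemma computable_comp:
  assumes f: "computable B D f" and g: "computable B D' g" and sub: "\<And>n x. x \<in> D n \<Longrightarrow> f x \<in> D' n"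
    and B: "\<And>n. 1 \<le> B n"
  shows "computable B D (\<lambda>x. g (f x))"
proof (rule computableI)
  fix a
  obtain p k where p: "computes_at a k B D p f" using f by (rule computableE)
  obtain r j where r: "computes_at a j B D' r g" using g by (rule computableE)
  define K where "K = k + ((k + 2) * j + 0 + 1) + 1"
  have "computes_at a K B D (Seq p r) (\<lambda>x. g (f x))"
  proof (rule computes_atI)
    fix n s assume s: "s a \<in> D n"
    obtain t s' where 1: "exec p s t s'" "s' a = f (s a)" "\<And>v. v < a \<Longrightarrow> s' v = s v"
      "real t \<le> real ((size (s a) + 2) ^ k) * B n" "size (f (s a)) \<le> (size (s a) + 2) ^ k"
      using computes_atE[OF p, where s = s and n = n] s by metis
    have s': "s' a \<in> D' n" using sub[OF s] 1 by simp
    obtain t' s'' where 2: "exec r s' t' s''" "s'' a = g (s' a)" "\<And>v. v < a \<Longrightarrow> s'' v = s' v"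
      "real t' \<le> real ((size (s' a) + 2) ^ j) * B n" "size (g (s' a)) \<le> (size (s' a) + 2) ^ j"
      using computes_atE[OF r, where s = s' and n = n] s' by metis
    define b where "b = size (s a) + 2"
    have b: "2 \<le> b" by (simp add: b_def)
    have "size (s' a) + 2 \<le> b ^ k + 2" using 1 by (simp add: b_def)
    also have "\<dots> \<le> b ^ (k + 2)" by (rule power_plus_two[OF b])
    finally have "(size (s' a) + 2) ^ j \<le> (b ^ (k + 2)) ^ j" by (rule power_mono) simp
    also have "\<dots> = b ^ ((k + 2) * j)" by (rule power_mult[symmetric])
    finally have j: "(size (s' a) + 2) ^ j \<le> b ^ ((k + 2) * j)" .
    have "b ^ k + (b ^ ((k + 2) * j) + b ^ 0) \<le> b ^ k + b ^ ((k + 2) * j + 0 + 1)"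
      using power_sum_le[OF b, of "(k + 2) * j" 0] by simp
    also have "\<dots> \<le> b ^ K" unfolding K_def by (rule power_sum_le[OF b])
    finally have K: "b ^ k + b ^ ((k + 2) * j) + 1 \<le> b ^ K" by simp
    have "real (t + t' + 1) \<le> real (b ^ k) * B n + real (b ^ ((k + 2) * j)) * B n + 1 * B n"
      using 1(4) real_bound_mult[OF 2(4) j B] B[of n] unfolding b_def by simp
    also have "\<dots> = real (b ^ k + b ^ ((k + 2) * j) + 1) * B n" by (simp add: algebra_simps)
    finally have t: "real (t + t' + 1) \<le> real (b ^ K) * B n" by (rule real_bound_mult[OF _ K B])
    have sz: "size (g (f (s a))) \<le> b ^ K" using 2(5) j K 1(2) by simp
    show "\<exists>t s''. exec (Seq p r) s t s'' \<and> s'' a = g (f (s a)) \<and> (\<forall>v<a. s'' v = s v) \<and>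
        real t \<le> real ((size (s a) + 2) ^ K) * B n \<and> size (g (f (s a))) \<le> (size (s a) + 2) ^ K"
      unfolding b_def[symmetric]
      by (rule exI[of _ "t + t' + 1"], rule exI[of _ s'']) (use exec.Seq[OF 1(1) 2(1)] 1 2 t sz in auto)
  qed
  then show "\<exists>p k. computes_at a k B D p (\<lambda>x. g (f x))" by blast
qed

lemma computable_left: "computable B D f \<Longrightarrow> (\<And>n. 1 \<le> B n) \<Longrightarrow> computable B D (\<lambda>x. left (f x))"
  by (erule computable_comp[where D' = "\<lambda>_. UNIV"]) (auto intro: computable_left0)

lemma computable_right: "computable B D f \<Longrightarrow> (\<And>n. 1 \<le> B n) \<Longrightarrow> computable B D (\<lambda>x. right (f x))"
  by (erule computable_comp[where D' = "\<lambda>_. UNIV"]) (auto intro: computable_right0)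

text \<open>\<open>f\<close> works at \<open>a + 1\<close> and \<open>g\<close> at
  \<open>a + 2\<close>, each on a copy of the input. A program leaves all variables below its own
  untouched, so neither the input nor the first result is lost.\<close>

lemma computable_Node:
  assumes f: "computable B D f" and g: "computable B D g" and B: "\<And>n. 1 \<le> B n"
  shows "computable B D (\<lambda>x. Node (f x) (g x))"
proof (rule computableI)
  fix a
  obtain p k where p: "computes_at (a + 1) k B D p f" using f by (rule computableE)
  obtain r j where r: "computes_at (a + 2) j B D r g" using g by (rule computableE)
  define c where "c = Seq (Assign (a + 1) (Var a)) (Seq p (Seq (Assign (a + 2) (Var a)) (Seq r
    (Assign a (NodeE (Var (a + 1)) (Var (a + 2)))))))"
  define K where "K = (k + j + 1) + 12 + 1"
  have "computes_at a K B D c (\<lambda>x. Node (f x) (g x))"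
  proof (rule computes_atI)
    fix n s assume s: "s a \<in> D n"
    define s1 where "s1 = s(a + 1 := s a)"
    have e1: "exec (Assign (a + 1) (Var a)) s 2 s1"
      using exec.Assign[of "a + 1" "Var a" s] by (simp add: s1_def numeral_2_eq_2)
    have s1: "s1 (a + 1) \<in> D n" "s1 (a + 1) = s a" using s by (auto simp: s1_def)
    obtain t2 s2 where 2: "exec p s1 t2 s2" "s2 (a + 1) = f (s1 (a + 1))" "\<And>v. v < a + 1 \<Longrightarrow> s2 v = s1 v"
      "real t2 \<le> real ((size (s1 (a + 1)) + 2) ^ k) * B n"
      "size (f (s1 (a + 1))) \<le> (size (s1 (a + 1)) + 2) ^ k"
      using computes_atE[OF p, where s = s1 and n = n] s1(1) by metis
    define s3 where "s3 = s2(a + 2 := s a)"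
    have s2a: "s2 a = s a" using 2(3)[of a] by (simp add: s1_def)
    have e3: "exec (Assign (a + 2) (Var a)) s2 2 s3"
      using exec.Assign[of "a + 2" "Var a" s2] s2a by (simp add: s3_def numeral_2_eq_2)
    have s3: "s3 (a + 2) \<in> D n" "s3 (a + 2) = s a" using s by (auto simp: s3_def)
    obtain t4 s4 where 4: "exec r s3 t4 s4" "s4 (a + 2) = g (s3 (a + 2))" "\<And>v. v < a + 2 \<Longrightarrow> s4 v = s3 v"
      "real t4 \<le> real ((size (s3 (a + 2)) + 2) ^ j) * B n"
      "size (g (s3 (a + 2))) \<le> (size (s3 (a + 2)) + 2) ^ j"
      using computes_atE[OF r, where s = s3 and n = n] s3(1) by metis
    define s5 where "s5 = s4(a := Node (f (s a)) (g (s a)))"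
    have "s4 (a + 1) = f (s a)" using 4(3)[of "a + 1"] 2(2) s1 by (simp add: s3_def)
    then have e5: "exec (Assign a (NodeE (Var (a + 1)) (Var (a + 2)))) s4 4 s5"
      using exec.Assign[of a "NodeE (Var (a + 1)) (Var (a + 2))" s4] 4(2) s3
      by (simp add: s5_def numeral_eq_Suc)
    have ex: "exec c s (2 + (t2 + (2 + (t4 + 4 + 1) + 1) + 1) + 1) s5"
      unfolding c_def by (rule exec.Seq[OF e1 exec.Seq[OF 2(1) exec.Seq[OF e3 exec.Seq[OF 4(1) e5]]]])
    define b where "b = size (s a) + 2"
    have b: "2 \<le> b" by (simp add: b_def)
    have "b ^ k + b ^ j + 12 \<le> b ^ (k + j + 1) + b ^ 12"
      using power_sum_le[OF b, of k j] const_le_power[OF b, of 12] by simp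
    also have "\<dots> \<le> b ^ K" unfolding K_def by (rule power_sum_le[OF b])
    finally have K: "b ^ k + b ^ j + 12 \<le> b ^ K" .
    have "real (2 + (t2 + (2 + (t4 + 4 + 1) + 1) + 1) + 1) \<le> real (b ^ k) * B n + real (b ^ j) * B n + 12 * B n"
      using 2(4) 4(4) s1 s3 B[of n] by (simp add: b_def)
    also have "\<dots> = real (b ^ k + b ^ j + 12) * B n" by (simp add: algebra_simps)
    finally have t: "real (2 + (t2 + (2 + (t4 + 4 + 1) + 1) + 1) + 1) \<le> real (b ^ K) * B n"
      by (rule real_bound_mult[OF _ K B])
    have sz: "size (Node (f (s a)) (g (s a))) \<le> b ^ K"
      using 2(5) 4(5) s1 s3 K by (simp add: b_def)
    have "\<forall>v<a. s5 v = s v" using 2(3) 4(3) by (auto simp: s5_def s3_def s1_def)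
    with ex t sz show "\<exists>t s'. exec c s t s' \<and> s' a = Node (f (s a)) (g (s a)) \<and> (\<forall>v<a. s' v = s v) \<and>
        real t \<le> real ((size (s a) + 2) ^ K) * B n \<and> size (Node (f (s a)) (g (s a))) \<le> (size (s a) + 2) ^ K"
      unfolding b_def[symmetric] by (intro exI[of _ s5] exI conjI) (auto simp: s5_def)
  qed
  then show "\<exists>p k. computes_at a k B D p (\<lambda>x. Node (f x) (g x))" by blast
qed

lemma enc_bool_eq_Leaf[simp]: "enc_bool b = Leaf \<longleftrightarrow> \<not> b"
  by (simp add: enc_bool_def)

text \<open>Each branch has to be computable only on the inputs that reach it. A guard can thus
  establish the domain and the time bound of the code behind it, in particular of calls of the
  oracle.\<close>

lemma computable_if:
  assumes P: "computable B D P"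
    and f: "computable B (\<lambda>n. {x \<in> D n. P x \<noteq> Leaf}) f" and g: "computable B (\<lambda>n. {x \<in> D n. P x = Leaf}) g"
    and B: "\<And>n. 1 \<le> B n"
  shows "computable B D (\<lambda>x. if P x \<noteq> Leaf then f x else g x)"
proof (rule computableI)
  fix a
  obtain c0 i where c0: "computes_at (a + 1) i B D c0 P" using P by (rule computableE)
  obtain p k where p: "computes_at a k B (\<lambda>n. {x \<in> D n. P x \<noteq> Leaf}) p f" using f by (rule computableE)
  obtain r j where r: "computes_at a j B (\<lambda>n. {x \<in> D n. P x = Leaf}) r g" using g by (rule computableE)
  define c where "c = Seq (Assign (a + 1) (Var a)) (Seq c0 (If (Var (a + 1)) p r))"
  define K where "K = (i + (k + j + 1) + 1) + 6 + 1"
  let ?h = "\<lambda>x. if P x \<noteq> Leaf then f x else g x"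
  have "computes_at a K B D c ?h"
  proof (rule computes_atI)
    fix n s assume s: "s a \<in> D n"
    define s1 where "s1 = s(a + 1 := s a)"
    have e1: "exec (Assign (a + 1) (Var a)) s 2 s1"
      using exec.Assign[of "a + 1" "Var a" s] by (simp add: s1_def numeral_2_eq_2)
    have s1: "s1 (a + 1) \<in> D n" "s1 (a + 1) = s a" using s by (auto simp: s1_def)
    obtain t2 s2 where 2: "exec c0 s1 t2 s2" "s2 (a + 1) = P (s1 (a + 1))"
      "\<And>v. v < a + 1 \<Longrightarrow> s2 v = s1 v" "real t2 \<le> real ((size (s1 (a + 1)) + 2) ^ i) * B n"
      using computes_atE[OF c0, where s = s1 and n = n] s1(1) by metis
    have s2a: "s2 a = s a" using 2(3)[of a] by (simp add: s1_def)
    define b where "b = size (s a) + 2"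
    have b: "2 \<le> b" by (simp add: b_def)
    have kj: "b ^ k + b ^ j \<le> b ^ (k + j + 1)" by (rule power_sum_le[OF b])
    have "\<exists>t3 s3. exec (If (Var (a + 1)) p r) s2 (1 + t3 + 1) s3 \<and> s3 a = ?h (s a) \<and> (\<forall>v<a. s3 v = s2 v) \<and>
       real t3 \<le> real (b ^ (k + j + 1)) * B n \<and> size (?h (s a)) \<le> b ^ (k + j + 1)"
    proof (cases "P (s a) \<noteq> Leaf")
      case True
      then have "s2 a \<in> {x \<in> D n. P x \<noteq> Leaf}" using s s2a by simp
      then obtain t3 s3 where 3: "exec p s2 t3 s3" "s3 a = f (s2 a)" "\<And>v. v < a \<Longrightarrow> s3 v = s2 v"
        "real t3 \<le> real ((size (s2 a) + 2) ^ k) * B n" "size (f (s2 a)) \<le> (size (s2 a) + 2) ^ k"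
        using computes_atE[OF p, where s = s2 and n = n] by metis
      have "eval_exp (Var (a + 1)) s2 \<noteq> Leaf" using True 2(2) s1 by simp
      from exec.IfTrue[OF this 3(1), of r] have "exec (If (Var (a + 1)) p r) s2 (1 + t3 + 1) s3" by simp
      moreover have "real t3 \<le> real (b ^ (k + j + 1)) * B n"
        by (rule real_bound_mult[OF 3(4) _ B]) (use kj in \<open>auto simp: b_def s2a\<close>)
      ultimately show ?thesis using 3 True kj s2a by (auto simp: b_def)
    next
      case False
      then have "s2 a \<in> {x \<in> D n. P x = Leaf}" using s s2a by simp
      then obtain t3 s3 where 3: "exec r s2 t3 s3" "s3 a = g (s2 a)" "\<And>v. v < a \<Longrightarrow> s3 v = s2 v"
        "real t3 \<le> real ((size (s2 a) + 2) ^ j) * B n" "size (g (s2 a)) \<le> (size (s2 a) + 2) ^ j"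
        using computes_atE[OF r, where s = s2 and n = n] by metis
      have "eval_exp (Var (a + 1)) s2 = Leaf" using False 2(2) s1 by simp
      from exec.IfFalse[OF this 3(1), of p] have "exec (If (Var (a + 1)) p r) s2 (1 + t3 + 1) s3" by simp
      moreover have "real t3 \<le> real (b ^ (k + j + 1)) * B n"
        by (rule real_bound_mult[OF 3(4) _ B]) (use kj in \<open>auto simp: b_def s2a\<close>)
      ultimately show ?thesis using 3 False kj s2a by (auto simp: b_def)
    qed
    then obtain t3 s3 where 3: "exec (If (Var (a + 1)) p r) s2 (1 + t3 + 1) s3" "s3 a = ?h (s a)"
      "\<forall>v<a. s3 v = s2 v" "real t3 \<le> real (b ^ (k + j + 1)) * B n" "size (?h (s a)) \<le> b ^ (k + j + 1)"
      by blast
    have ex: "exec c s (2 + (t2 + (1 + t3 + 1) + 1) + 1) s3"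
      unfolding c_def by (rule exec.Seq[OF e1 exec.Seq[OF 2(1) 3(1)]])
    have "b ^ i + b ^ (k + j + 1) + 6 \<le> b ^ (i + (k + j + 1) + 1) + b ^ 6"
      using power_sum_le[OF b, of i "k + j + 1"] const_le_power[OF b, of 6] by simp
    also have "\<dots> \<le> b ^ K" unfolding K_def by (rule power_sum_le[OF b])
    finally have K: "b ^ i + b ^ (k + j + 1) + 6 \<le> b ^ K" .
    have "real (2 + (t2 + (1 + t3 + 1) + 1) + 1) \<le> real (b ^ i) * B n + real (b ^ (k + j + 1)) * B n + 6 * B n"
      using 2(4) 3(4) s1 B[of n] by (simp add: b_def)
    also have "\<dots> = real (b ^ i + b ^ (k + j + 1) + 6) * B n" by (simp add: algebra_simps)
    finally have t: "real (2 + (t2 + (1 + t3 + 1) + 1) + 1) \<le> real (b ^ K) * B n"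
      by (rule real_bound_mult[OF _ K B])
    have sz: "size (?h (s a)) \<le> b ^ K" using 3(5) K by simp
    have "\<forall>v<a. s3 v = s v" using 2(3) 3(3) by (auto simp: s1_def)
    with ex t sz 3(2) show "\<exists>t s'. exec c s t s' \<and> s' a = ?h (s a) \<and> (\<forall>v<a. s' v = s v) \<and>
        real t \<le> real ((size (s a) + 2) ^ K) * B n \<and> size (?h (s a)) \<le> (size (s a) + 2) ^ K"
      unfolding b_def[symmetric] by (intro exI[of _ s3] exI conjI)
  qed
  then show "\<exists>p k. computes_at a k B D p ?h" by blast
qed

text \<open>\<open>W\<close> is a potential that decreases with each iteration, so its initial value
  bounds their number, while the invariant \<open>I\<close> keeps the state of polynomial size.
  \<open>N\<close> leaves room for exponentially many iterations. A state is final when its left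
  component is \<open>Leaf\<close>; \<open>F x0\<close> is that whole state, from which callers
  project their result.\<close>

lemma computable_loop:
  assumes h: "computable B D h"
    and inv: "\<And>n x0. x0 \<in> D0 n \<Longrightarrow> \<exists>I W. x0 \<in> I \<and> real (W x0) \<le> real ((size x0 + 2) ^ j) * N n \<and>
      (\<forall>x\<in>I. size x \<le> (size x0 + 2) ^ j \<and>
        (if left x = Leaf then x = F x0 else x \<in> D n \<and> h x \<in> I \<and> W (h x) < (W x :: nat)))"
    and B: "\<And>n. 1 \<le> B n" and N: "\<And>n. 1 \<le> N n"
  shows "computable (\<lambda>n. B n * N n) D0 F"
proof (rule computableI)
  fix a
  obtain p k where p: "computes_at a k B D p h" using h by (rule computableE)
  define c where "c = While (LeftE (Var a)) p"
  define E where "E = (j + 2) * k"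
  define K where "K = (E + 3 + 1) + (j + 0 + 1)"
  have "computes_at a K (\<lambda>n. B n * N n) D0 c F"
  proof (rule computes_atI)
    fix n s assume s: "s a \<in> D0 n"
    obtain I W where IW: "s a \<in> I \<and> real (W (s a)) \<le> real ((size (s a) + 2) ^ j) * N n \<and>
      (\<forall>x\<in>I. size x \<le> (size (s a) + 2) ^ j \<and>
        (if left x = Leaf then x = F (s a) else x \<in> D n \<and> h x \<in> I \<and> W (h x) < (W x :: nat)))"
      using inv[OF s] by (elim exE)
    have I: "s a \<in> I" and W0: "real (W (s a)) \<le> real ((size (s a) + 2) ^ j) * N n"
      using IW by simp_all
    have step: "size x \<le> (size (s a) + 2) ^ j \<and>
        (if left x = Leaf then x = F (s a) else x \<in> D n \<and> h x \<in> I \<and> W (h x) < (W x :: nat))" if "x \<in> I" for x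
      using IW that by (elim conjE) (rule bspec)
    define b where "b = size (s a) + 2"
    have b: "2 \<le> b" by (simp add: b_def)
    define M where "M = real (b ^ E + 3) * B n"
    have M0: "3 \<le> M" unfolding M_def
      using mult_mono[of 3 "real (b ^ E + 3)" 1 "B n"] B[of n] by simp
    have loop: "\<exists>t s'. exec c s1 t s' \<and> s' a = F (s a) \<and> (\<forall>v<a. s' v = s1 v) \<and> real t \<le> (real (W (s1 a)) + 1) * M \<and>
        size (F (s a)) \<le> b ^ j"
      if "s1 a \<in> I" for s1
      using that
    proof (induction "W (s1 a)" arbitrary: s1 rule: less_induct)
      case less
      show ?case
      proof (cases "left (s1 a) = Leaf")
        case True
        then have "exec c s1 (2 + 1) s1" unfolding c_def
          using exec.WhileFalse[of "LeftE (Var a)" s1 p] by (simp add: numeral_2_eq_2)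
        moreover have "s1 a = F (s a)" "size (F (s a)) \<le> b ^ j"
          using step[OF less.prems] True by (auto simp: b_def)
        moreover have "real (2 + 1) \<le> (real (W (s1 a)) + 1) * M"
          using M0 mult_mono[of 1 "real (W (s1 a)) + 1" 3 M] by simp
        ultimately show ?thesis by blast
      next
        case False
        have sI: "s1 a \<in> D n" "size (s1 a) \<le> b ^ j" "h (s1 a) \<in> I" "W (h (s1 a)) < W (s1 a)"
          using step[OF less.prems] False by (auto simp: b_def)
        obtain t2 s2 where 2: "exec p s1 t2 s2" "s2 a = h (s1 a)" "\<And>v. v < a \<Longrightarrow> s2 v = s1 v"
          "real t2 \<le> real ((size (s1 a) + 2) ^ k) * B n"
          using computes_atE[OF p, where s = s1 and n = n] sI(1) by metis
        obtain t3 s3 where 3: "exec c s2 t3 s3" "s3 a = F (s a)" "\<forall>v<a. s3 v = s2 v"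
          "real t3 \<le> (real (W (s2 a)) + 1) * M" "size (F (s a)) \<le> b ^ j"
          using less.hyps[of s2] sI 2(2) by auto
        have "eval_exp (LeftE (Var a)) s1 \<noteq> Leaf" using False by simp
        from exec.WhileTrue[OF this 2(1) 3(1)[unfolded c_def]]
        have ex: "exec c s1 (2 + t2 + t3 + 1) s3" by (simp add: c_def numeral_2_eq_2)
        have "size (s1 a) + 2 \<le> b ^ (j + 2)" using power_plus_two[OF b, of j] sI(2) by simp
        then have "(size (s1 a) + 2) ^ k \<le> (b ^ (j + 2)) ^ k" by (rule power_mono) simp
        then have "(size (s1 a) + 2) ^ k \<le> b ^ E" by (simp only: power_mult E_def)
        from real_bound_mult[OF 2(4) this B] have "real t2 + 3 \<le> real (b ^ E) * B n + 3 * B n"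
          using B[of n] by simp
        also have "\<dots> = M" by (simp add: M_def algebra_simps)
        finally have "real t2 + 3 \<le> M" .
        moreover have "(real (W (s2 a)) + 1) * M \<le> real (W (s1 a)) * M"
          using sI(4) 2(2) M0 by (intro mult_right_mono) auto
        ultimately have "real (2 + t2 + t3 + 1) \<le> (real (W (s1 a)) + 1) * M"
          using 3(4) by (simp add: algebra_simps)
        with ex 3 2 show ?thesis by metis
      qed
    qed
    obtain t s' where t: "exec c s t s'" "s' a = F (s a)" "\<forall>v<a. s' v = s v" "real t \<le> (real (W (s a)) + 1) * M"
        "size (F (s a)) \<le> b ^ j"
      using loop[of s, OF I] by blast
    have E3: "b ^ E + 3 \<le> b ^ (E + 3 + 1)"
      using power_sum_le[OF b, of E 3] const_le_power[OF b, of 3] by simp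
    have j1: "b ^ j + 1 \<le> b ^ (j + 0 + 1)" using power_sum_le[OF b, of j 0] by simp
    have K: "(b ^ j + 1) * (b ^ E + 3) \<le> b ^ K"
      using mult_le_mono[OF j1 E3] unfolding K_def power_add[symmetric] by (simp only: ac_simps)
    have "real (W (s a)) + 1 \<le> real (b ^ j + 1) * N n"
      using W0 N[of n] by (simp add: b_def algebra_simps)
    then have "(real (W (s a)) + 1) * M \<le> (real (b ^ j + 1) * N n) * M"
      using M0 by (intro mult_right_mono) auto
    also have "\<dots> = real ((b ^ j + 1) * (b ^ E + 3)) * (B n * N n)"
      by (simp only: M_def of_nat_mult ac_simps)
    finally have tt: "real t \<le> real ((b ^ j + 1) * (b ^ E + 3)) * (B n * N n)" using t(4) by linarith
    have "1 * 1 \<le> B n * N n" using B[of n] N[of n] by (intro mult_mono) auto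
    then have tK: "real t \<le> real (b ^ K) * (B n * N n)" using real_bound_mult[OF tt K] by simp
    have "b ^ j \<le> b ^ K" using b by (intro power_increasing) (auto simp: K_def)
    then have sz: "size (F (s a)) \<le> b ^ K" using t(5) by linarith
    show "\<exists>t s'. exec c s t s' \<and> s' a = F (s a) \<and> (\<forall>v<a. s' v = s v) \<and>
        real t \<le> real ((size (s a) + 2) ^ K) * (B n * N n) \<and> size (F (s a)) \<le> (size (s a) + 2) ^ K"
      using t(1-3) tK sz unfolding b_def[symmetric] by blast
  qed
  then show "\<exists>p k. computes_at a k (\<lambda>n. B n * N n) D0 p F" by blast
qed

section \<open>Closure properties\<close>

lemma computable_poly_lift:
  assumes "computable (\<lambda>_. 1) (\<lambda>_. UNIV) f" "\<And>n. 1 \<le> B n"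
  shows "computable B D f"
  by (rule computable_mono[OF assms(1)]) (use assms(2) in auto)

abbreviation poly :: "(bintree \<Rightarrow> bintree) \<Rightarrow> bool" where
  "poly f \<equiv> computable (\<lambda>_. 1) (\<lambda>_. UNIV) f"

text \<open>Serves to derive the size bound demanded by \<open>computable_fold\<close> from the
  shape of the expression \<open>e\<close>, by introduction rules.\<close>

definition poly_bounded :: "(nat \<Rightarrow> bintree set) \<Rightarrow> (bintree \<Rightarrow> nat) \<Rightarrow> bool" where
  "poly_bounded D e \<longleftrightarrow> (\<exists>k. \<forall>n. \<forall>x\<in>D n. e x \<le> (size x + 2) ^ k)"

lemma poly_bounded_size: "poly_bounded D size"
  unfolding poly_bounded_def by (rule exI[of _ 1]) auto

lemma poly_bounded_const: "poly_bounded D (\<lambda>_. c)"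
  unfolding poly_bounded_def by (rule exI[of _ c], intro allI ballI const_le_power) simp

lemma poly_bounded_add:
  assumes "poly_bounded D e" "poly_bounded D e'" shows "poly_bounded D (\<lambda>x. e x + e' x)"
proof -
  obtain k k' where k: "\<And>n x. x \<in> D n \<Longrightarrow> e x \<le> (size x + 2) ^ k" "\<And>n x. x \<in> D n \<Longrightarrow> e' x \<le> (size x + 2) ^ k'"
    using assms unfolding poly_bounded_def by blast
  have "e x + e' x \<le> (size x + 2) ^ (k + k' + 1)" if "x \<in> D n" for n x
    using add_mono[OF k(1)[OF that] k(2)[OF that]] power_sum_le[of "size x + 2" k k'] by linarith
  then show ?thesis unfolding poly_bounded_def by blast
qed

lemma poly_bounded_mult:
  assumes "poly_bounded D e" "poly_bounded D e'" shows "poly_bounded D (\<lambda>x. e x * e' x)"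
proof -
  obtain k k' where k: "\<And>n x. x \<in> D n \<Longrightarrow> e x \<le> (size x + 2) ^ k" "\<And>n x. x \<in> D n \<Longrightarrow> e' x \<le> (size x + 2) ^ k'"
    using assms unfolding poly_bounded_def by blast
  have "e x * e' x \<le> (size x + 2) ^ (k + k')" if "x \<in> D n" for n x
    using mult_le_mono[OF k(1)[OF that] k(2)[OF that]] by (simp add: power_add)
  then show ?thesis unfolding poly_bounded_def by blast
qed

lemma poly_bounded_power: "poly_bounded D e \<Longrightarrow> poly_bounded D (\<lambda>x. e x ^ i)"
  by (induction i) (auto intro: poly_bounded_const poly_bounded_mult)

lemma poly_bounded_computable: "computable B D f \<Longrightarrow> poly_bounded D (\<lambda>x. size (f x))"
  unfolding poly_bounded_def by (rule computable_size)

lemmas poly_bounded_intros = poly_bounded_size poly_bounded_add poly_bounded_mult poly_bounded_power poly_bounded_computable poly_bounded_const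

text \<open>Every tree is a list, read along its right spine.\<close>

primrec spine :: "bintree \<Rightarrow> bintree list" where
  "spine Leaf = []"
| "spine (Node x y) = x # spine y"

lemma spine_enc_list[simp]: "spine (enc_list xs) = xs"
  by (induction xs) auto

lemma enc_list_spine[simp]: "enc_list (spine x) = x"
  by (induction x) auto

lemma enc_list_eq_Leaf[simp]: "enc_list xs = Leaf \<longleftrightarrow> xs = []"
  by (cases xs) auto

lemma spine_eq_Nil[simp]: "spine x = [] \<longleftrightarrow> x = Leaf"
  by (cases x) auto

abbreviation len :: "bintree \<Rightarrow> nat" where "len x \<equiv> length (spine x)"

lemma size_enc_list: "size (enc_list xs) = (\<Sum>x\<leftarrow>xs. size x + 1)"
  by (induction xs) auto

lemma len_le_size: "len x \<le> size x"
  by (induction x) auto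

lemma size_spine: "y \<in> set (spine x) \<Longrightarrow> size y < size x"
  by (induction x) auto

lemma spine_right[simp]: "spine (right x) = tl (spine x)"
  by (cases x) auto

lemma left_hd: "x \<noteq> Leaf \<Longrightarrow> left x = hd (spine x)"
  by (cases x) auto

text \<open>The loop state consists of the remaining list, the input \<open>x\<close> and the
  accumulator. The bound \<open>e\<close> on all intermediate accumulators is needed because a fold
  can double its accumulator in every step. Functions of several arguments are treated as functions
  of nested pairs.\<close>

lemma computable_fold:
  assumes h: "computable B D' (\<lambda>z. h (left (left z)) (right (left z)) (right z))"
    and g0: "computable B D g0" and g: "computable B D g"
    and D': "\<And>n x ys y zs. x \<in> D n \<Longrightarrow> spine (g x) = ys @ y # zs \<Longrightarrow> Node (Node x (foldl (h x) (g0 x) ys)) y \<in> D' n"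
    and e: "poly_bounded D e"
    and sz: "\<And>n x ys zs. x \<in> D n \<Longrightarrow> spine (g x) = ys @ zs \<Longrightarrow> size (foldl (h x) (g0 x) ys) \<le> e x"
    and B: "\<And>n. 1 \<le> B n"
  shows "computable B D (\<lambda>x. foldl (h x) (g0 x) (spine (g x)))"
proof -
  define I where "I x = {Node xs (Node x acc) | xs acc. \<exists>ys. spine (g x) = ys @ spine xs \<and> acc = foldl (h x) (g0 x) ys}" for x
  define D1 where "D1 n = {st. \<exists>x\<in>D n. st \<in> I x \<and> left st \<noteq> Leaf}" for n
  define F where "F st = Node Leaf (Node (left (right st))
    (foldl (h (left (right st))) (right (right st)) (spine (left st))))" for st
  define D0 where "D0 n = {Node (g x) (Node x (g0 x)) | x. x \<in> D n}" for n
  let ?hh = "\<lambda>z. h (left (left z)) (right (left z)) (right z)"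
  define step where "step st = Node (right (left st)) (Node (left (right st)) (?hh (Node (right st) (left (left st)))))" for st
  note oc1 = computable_id[OF B] computable_left[OF _ B] computable_right[OF _ B] computable_Node[OF _ _ B] computable_const[OF B]
  have 1: "computable B D1 step"
    unfolding step_def
    apply (rule oc1)
     apply (intro oc1)
    apply (rule oc1)
     apply (intro oc1)
    apply (rule computable_comp[OF _ h _ B])
     apply (intro oc1)
    subgoal premises st for n st
    proof -
      from st obtain x xs ys where x: "x \<in> D n" "st = Node xs (Node x (foldl (h x) (g0 x) ys))" "xs \<noteq> Leaf" "spine (g x) = ys @ spine xs"
        by (auto simp: D1_def I_def)
      then obtain y xs' where "xs = Node y xs'" by (cases xs) auto
      with x show ?thesis using D'[of x n ys y "spine xs'"] by simp
    qed
    done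
  have "poly_bounded D (\<lambda>x. size (g x) + size x + e x + 2)"
    by (intro poly_bounded_intros e poly_bounded_computable[OF g])
  then obtain k where k: "\<And>n x. x \<in> D n \<Longrightarrow> size (g x) + size x + e x + 2 \<le> (size x + 2) ^ k"
    unfolding poly_bounded_def by blast
  have 2: "computable (\<lambda>n. B n * 1) D0 F"
  proof (rule computable_loop[OF 1, where j = k])
    fix n x0 assume "x0 \<in> D0 n"
    then obtain x where x: "x \<in> D n" "x0 = Node (g x) (Node x (g0 x))" by (auto simp: D0_def)
    show "\<exists>I W. x0 \<in> I \<and> real (W x0) \<le> real ((size x0 + 2) ^ k) * 1 \<and>
      (\<forall>y\<in>I. size y \<le> (size x0 + 2) ^ k \<and>
        (if left y = Leaf then y = F x0 else y \<in> D1 n \<and> step y \<in> I \<and> W (step y) < (W y :: nat)))"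
    proof (rule exI[of _ "I x"], rule exI[of _ "\<lambda>st. len (left st)"], intro conjI ballI)
      show "x0 \<in> I x" by (auto simp: I_def x)
      have sx: "(size x + 2) ^ k \<le> (size x0 + 2) ^ k" by (rule power_mono) (auto simp: x)
      have "len (g x) \<le> (size x + 2) ^ k" using k[OF x(1)] len_le_size[of "g x"] by linarith
      then show "real (len (left x0)) \<le> real ((size x0 + 2) ^ k) * 1"
        unfolding mult_1_right of_nat_le_iff using sx by (simp add: x)
      fix st assume st: "st \<in> I x"
      then obtain xs ys where s: "st = Node xs (Node x (foldl (h x) (g0 x) ys))" "spine (g x) = ys @ spine xs"
        by (auto simp: I_def)
      have "size xs \<le> size (g x)"
        using arg_cong[OF s(2), of "\<lambda>l. size (enc_list l)"] size_enc_list[of "spine xs"]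
          by (simp only: enc_list_spine) (simp add: size_enc_list)
      then have "size st \<le> (size x + 2) ^ k" using k[OF x(1)] sz[OF x(1) s(2)] s by simp
      then show "size st \<le> (size x0 + 2) ^ k" using sx by linarith
      show "if left st = Leaf then st = F x0 else st \<in> D1 n \<and> step st \<in> I x \<and> len (left (step st)) < len (left st)"
      proof (cases xs)
        case Leaf
        then show ?thesis using s x by (simp add: F_def)
      next
        case (Node y xs')
        have "step st \<in> I x" unfolding I_def using s Node
          by (auto simp: step_def intro!: exI[of _ "ys @ [y]"])
        then show ?thesis using s Node st x(1) by (auto simp: D1_def step_def)
      qed
    qed
  qed (use B in auto)
  then have 2: "computable B D0 F" by simp
  have 3: "computable B D (\<lambda>x. F (Node (g x) (Node x (g0 x))))"
    by (rule computable_comp[OF _ 2 _ B]) (auto intro!: oc1 g g0 simp: D0_def)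
  have "computable B D (\<lambda>x. right (right (F (Node (g x) (Node x (g0 x))))))"
    by (intro oc1 3)
  then show ?thesis by (simp add: F_def)
qed

lemmas poly_comp = computable_comp[where B = "\<lambda>_. 1" and D = "\<lambda>_. UNIV" and D' = "\<lambda>_. UNIV", OF _ _ UNIV_I order_refl]
lemmas poly_id = computable_id[where B = "\<lambda>_. 1" and D = "\<lambda>_. UNIV", OF order_refl]
lemmas poly_const = computable_const[where B = "\<lambda>_. 1" and D = "\<lambda>_. UNIV", OF order_refl]
lemmas poly_left = computable_left[where B = "\<lambda>_. 1" and D = "\<lambda>_. UNIV", OF _ order_refl]
lemmas poly_right = computable_right[where B = "\<lambda>_. 1" and D = "\<lambda>_. UNIV", OF _ order_refl]
lemmas poly_Node = computable_Node[where B = "\<lambda>_. 1" and D = "\<lambda>_. UNIV", OF _ _ order_refl]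

lemmas poly_basic = poly_left poly_right poly_Node poly_id

lemma poly_fold:
  assumes h: "poly (\<lambda>z. h (left (left z)) (right (left z)) (right z))"
    and g0: "poly g0" and g: "poly g"
    and e: "poly_bounded (\<lambda>_. UNIV) e"
    and sz: "\<And>x ys zs. spine (g x) = ys @ zs \<Longrightarrow> size (foldl (h x) (g0 x) ys) \<le> e x"
  shows "poly (\<lambda>x. foldl (h x) (g0 x) (spine (g x)))"
  by (rule computable_fold[OF h g0 g _ e]) (auto intro: sz)

section \<open>List operations obtained by folding\<close>

definition trev :: "bintree \<Rightarrow> bintree" where "trev x = enc_list (rev (spine x))"

lemma spine_trev[simp]: "spine (trev x) = rev (spine x)"
  by (simp add: trev_def)

lemma foldl_Node: "foldl (\<lambda>acc y. Node (f y) acc) a ys = enc_list (rev (map f ys) @ spine a)"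
  by (induction ys arbitrary: a) auto

lemma size_enc_list_append: "size (enc_list (xs @ ys)) = size (enc_list xs) + size (enc_list ys)"
  by (simp add: size_enc_list)

lemma size_enc_list_rev[simp]: "size (enc_list (rev xs)) = size (enc_list xs)"
  by (induction xs) (auto simp: size_enc_list_append)

lemma size_enc_list_prefix: "spine x = ys @ zs \<Longrightarrow> size (enc_list ys) \<le> size x"
  by (metis enc_list_spine le_add1 size_enc_list_append)

lemma poly_trev0: "poly trev"
proof -
  have "poly (\<lambda>x. foldl (\<lambda>acc y. Node y acc) Leaf (spine x))"
  proof (rule poly_fold[where e = size and h = "\<lambda>_ acc y. Node y acc"])
    fix x ys zs assume "spine x = ys @ zs"
    then show "size (foldl (\<lambda>acc y. Node y acc) Leaf ys) \<le> size x"
      by (simp add: foldl_Node[where f = "\<lambda>x. x", simplified] size_enc_list_prefix)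
  qed (intro poly_basic poly_const poly_bounded_size)+
  then show ?thesis by (simp add: foldl_Node[where f = "\<lambda>x. x", simplified] trev_def[abs_def])
qed

lemma computable_trev: "computable B D f \<Longrightarrow> (\<And>n. 1 \<le> B n) \<Longrightarrow> computable B D (\<lambda>x. trev (f x))"
  by (erule computable_comp[where D' = "\<lambda>_. UNIV"]) (auto intro: computable_poly_lift[OF poly_trev0])

lemmas poly_trev = computable_trev[where B = "\<lambda>_. 1" and D = "\<lambda>_. UNIV", OF _ order_refl]

definition tmap :: "(bintree \<Rightarrow> bintree) \<Rightarrow> bintree \<Rightarrow> bintree" where
  "tmap f x = enc_list (map f (spine x))"

lemma spine_tmap[simp]: "spine (tmap f x) = map f (spine x)"
  by (simp add: tmap_def)

lemma size_enc_list_le: "(\<And>y. y \<in> set ys \<Longrightarrow> size y \<le> b) \<Longrightarrow> size (enc_list ys) \<le> length ys * (b + 1)"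
proof (induction ys)
  case (Cons y ys)
  have "size y \<le> b" "size (enc_list ys) \<le> length ys * (b + 1)" using Cons by auto
  then show ?case by simp
qed simp

lemma computable_tmap:
  assumes h: "computable B D' (\<lambda>z. h (left z) (right z))"
    and g: "computable B D g"
    and D': "\<And>n x y. x \<in> D n \<Longrightarrow> y \<in> set (spine (g x)) \<Longrightarrow> Node x y \<in> D' n"
    and B: "\<And>n. 1 \<le> B n"
  shows "computable B D (\<lambda>x. tmap (h x) (g x))"
proof -
  note oc1 = computable_id[OF B] computable_left[OF _ B] computable_right[OF _ B] computable_Node[OF _ _ B] computable_const[OF B] computable_trev[OF _ B]
  define D'' where "D'' n = {Node (Node x acc) y | x acc y. Node x y \<in> D' n}" for n
  have "computable B D'' (\<lambda>z. (\<lambda>z. h (left z) (right z)) (Node (left (left z)) (right z)))"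
    by (rule computable_comp[OF _ h _ B]) (auto intro!: oc1 simp: D''_def)
  then have 1: "computable B D'' (\<lambda>z. h (left (left z)) (right z))" by simp
  obtain k where k: "\<And>n x. x \<in> D' n \<Longrightarrow> size (h (left x) (right x)) \<le> (size x + 2) ^ k"
    using computable_size[OF h] by blast
  have 2: "computable B D (\<lambda>x. foldl (\<lambda>acc y. Node (h x y) acc) Leaf (spine (g x)))"
  proof (rule computable_fold[where D' = D'' and h = "\<lambda>x acc y. Node (h x y) acc"
        and e = "\<lambda>x. size (g x) * ((size x + size (g x) + 3) ^ k + 1)"])
    show "computable B D'' (\<lambda>z. Node (h (left (left z)) (right z)) (right (left z)))"
      by (intro oc1 1)
    show "poly_bounded D (\<lambda>x. size (g x) * ((size x + size (g x) + 3) ^ k + 1))"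
      by (intro poly_bounded_intros poly_bounded_computable[OF g])
    fix n x ys y zs assume x: "x \<in> D n"
    {
      assume "spine (g x) = ys @ y # zs"
      then show "Node (Node x (foldl (\<lambda>acc y. Node (h x y) acc) Leaf ys)) y \<in> D'' n"
        using D'[OF x, of y] by (auto simp: D''_def)
    next
      assume g: "spine (g x) = ys @ zs"
      have "size (enc_list (map (h x) ys)) \<le> length (map (h x) ys) * ((size x + size (g x) + 3) ^ k + 1)"
      proof (rule size_enc_list_le)
        fix z assume "z \<in> set (map (h x) ys)"
        then obtain y where y: "y \<in> set ys" "z = h x y" by auto
        then have "size z \<le> (size (Node x y) + 2) ^ k" using k[OF D'[OF x], of y] g by simp
        also have "\<dots> \<le> (size x + size (g x) + 3) ^ k"
          using size_spine[of y "g x"] y g by (intro power_mono) auto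
        finally show "size z \<le> (size x + size (g x) + 3) ^ k" .
      qed
      also have "\<dots> \<le> size (g x) * ((size x + size (g x) + 3) ^ k + 1)"
        using g len_le_size[of "g x"] by (intro mult_le_mono) auto
      finally show "size (foldl (\<lambda>acc y. Node (h x y) acc) Leaf ys) \<le> size (g x) * ((size x + size (g x) + 3) ^ k + 1)"
        by (simp add: foldl_Node)
    }
  qed (intro oc1 g B)+
  have "computable B D (\<lambda>x. trev (foldl (\<lambda>acc y. Node (h x y) acc) Leaf (spine (g x))))"
    by (intro oc1 2)
  then show ?thesis by (simp add: foldl_Node trev_def tmap_def)
qed

lemmas poly_tmap = computable_tmap[where B = "\<lambda>_. 1" and D = "\<lambda>_. UNIV" and D' = "\<lambda>_. UNIV", OF _ _ UNIV_I order_refl]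

definition tfilter :: "(bintree \<Rightarrow> bool) \<Rightarrow> bintree \<Rightarrow> bintree" where
  "tfilter P x = enc_list (filter P (spine x))"

lemma spine_tfilter[simp]: "spine (tfilter P x) = filter P (spine x)"
  by (simp add: tfilter_def)

lemma computable_ite:
  assumes "computable B D (\<lambda>x. enc_bool (P x))" "computable B (\<lambda>n. {x \<in> D n. P x}) f" "computable B (\<lambda>n. {x \<in> D n. \<not> P x}) g"
    and "\<And>n. 1 \<le> B n"
  shows "computable B D (\<lambda>x. if P x then f x else g x)"
  using computable_if[OF assms(1) _ _ assms(4)] assms(2,3) by simp

lemma poly_ite:
  assumes "poly (\<lambda>x. enc_bool (P x))" "poly f" "poly g"
  shows "poly (\<lambda>x. if P x then f x else g x)"
  by (rule computable_ite[OF assms(1)]) (auto intro: computable_poly_lift assms)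

lemma foldl_filter: "foldl (\<lambda>acc y. if P y then Node y acc else acc) a ys = enc_list (rev (filter P ys) @ spine a)"
  by (induction ys arbitrary: a) auto

lemma size_filter_le: "size (enc_list (filter P ys)) \<le> size (enc_list ys)"
  by (induction ys) auto

lemma computable_tfilter:
  assumes P: "computable B D' (\<lambda>z. enc_bool (P (left z) (right z)))"
    and g: "computable B D g"
    and D': "\<And>n x y. x \<in> D n \<Longrightarrow> y \<in> set (spine (g x)) \<Longrightarrow> Node x y \<in> D' n"
    and B: "\<And>n. 1 \<le> B n"
  shows "computable B D (\<lambda>x. tfilter (P x) (g x))"
proof -
  note oc1 = computable_id[OF B] computable_left[OF _ B] computable_right[OF _ B] computable_Node[OF _ _ B] computable_const[OF B] computable_trev[OF _ B]
  define D'' where "D'' n = {Node (Node x acc) y | x acc y. Node x y \<in> D' n}" for n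
  have "computable B D'' (\<lambda>z. (\<lambda>z. enc_bool (P (left z) (right z))) (Node (left (left z)) (right z)))"
    by (rule computable_comp[OF _ P _ B]) (auto intro!: oc1 simp: D''_def)
  then have 1: "computable B D'' (\<lambda>z. enc_bool (P (left (left z)) (right z)))" by simp
  have 2: "computable B D (\<lambda>x. foldl (\<lambda>acc y. if P x y then Node y acc else acc) Leaf (spine (g x)))"
  proof (rule computable_fold[where D' = D'' and h = "\<lambda>x acc y. if P x y then Node y acc else acc" and e = "\<lambda>x. size (g x)"])
    show "computable B D'' (\<lambda>z. if P (left (left z)) (right z) then Node (right z) (right (left z)) else right (left z))"
      by (rule computable_ite[OF 1]) (intro oc1 B)+
    show "poly_bounded D (\<lambda>x. size (g x))" by (rule poly_bounded_computable[OF g])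
    fix n x ys y zs assume x: "x \<in> D n"
    {
      assume "spine (g x) = ys @ y # zs"
      then show "Node (Node x (foldl (\<lambda>acc y. if P x y then Node y acc else acc) Leaf ys)) y \<in> D'' n"
        using D'[OF x, of y] by (auto simp: D''_def)
    next
      assume g: "spine (g x) = ys @ zs"
      then show "size (foldl (\<lambda>acc y. if P x y then Node y acc else acc) Leaf ys) \<le> size (g x)"
        using size_enc_list_prefix[OF g] size_filter_le[of "P x" ys] by (simp add: foldl_filter)
    }
  qed (intro oc1 g B)+
  have "computable B D (\<lambda>x. trev (foldl (\<lambda>acc y. if P x y then Node y acc else acc) Leaf (spine (g x))))"
    by (intro oc1 2)
  then show ?thesis by (simp add: foldl_filter trev_def tfilter_def)
qed

lemmas poly_tfilter = computable_tfilter[where B = "\<lambda>_. 1" and D = "\<lambda>_. UNIV" and D' = "\<lambda>_. UNIV", OF _ _ UNIV_I order_refl]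

section \<open>Boolean connectives and bounded quantifiers\<close>

lemma computable_nonLeaf:
  assumes "computable B D f" and B: "\<And>n. 1 \<le> B n"
  shows "computable B D (\<lambda>x. enc_bool (f x \<noteq> Leaf))"
proof -
  have "computable B D (\<lambda>x. if f x \<noteq> Leaf then enc_bool True else enc_bool False)"
    by (rule computable_if[OF assms(1)]) (intro computable_const B)+
  then show ?thesis by (rule computable_cong) auto
qed

lemma computable_not:
  assumes "computable B D (\<lambda>x. enc_bool (P x))" and B: "\<And>n. 1 \<le> B n"
  shows "computable B D (\<lambda>x. enc_bool (\<not> P x))"
proof -
  have "computable B D (\<lambda>x. if P x then enc_bool False else enc_bool True)"
    by (rule computable_ite[OF assms(1)]) (intro computable_const B)+
  then show ?thesis by (rule computable_cong) auto
qed

lemma computable_conj: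
  assumes "computable B D (\<lambda>x. enc_bool (P x))" "computable B (\<lambda>n. {x \<in> D n. P x}) (\<lambda>x. enc_bool (Q x))" and B: "\<And>n. 1 \<le> B n"
  shows "computable B D (\<lambda>x. enc_bool (P x \<and> Q x))"
proof -
  have "computable B D (\<lambda>x. if P x then enc_bool (Q x) else enc_bool False)"
    by (rule computable_ite[OF assms(1)]) (intro computable_const B assms)+
  then show ?thesis by (rule computable_cong) auto
qed

lemma computable_disj:
  assumes "computable B D (\<lambda>x. enc_bool (P x))" "computable B (\<lambda>n. {x \<in> D n. \<not> P x}) (\<lambda>x. enc_bool (Q x))" and B: "\<And>n. 1 \<le> B n"
  shows "computable B D (\<lambda>x. enc_bool (P x \<or> Q x))"
proof -
  have "computable B D (\<lambda>x. if P x then enc_bool True else enc_bool (Q x))"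
    by (rule computable_ite[OF assms(1)]) (intro computable_const B assms)+
  then show ?thesis by (rule computable_cong) auto
qed

lemma computable_ex:
  assumes P: "computable B D' (\<lambda>z. enc_bool (P (left z) (right z)))"
    and g: "computable B D g"
    and D': "\<And>n x y. x \<in> D n \<Longrightarrow> y \<in> set (spine (g x)) \<Longrightarrow> Node x y \<in> D' n"
    and B: "\<And>n. 1 \<le> B n"
  shows "computable B D (\<lambda>x. enc_bool (\<exists>y\<in>set (spine (g x)). P x y))"
proof -
  have "computable B D (\<lambda>x. enc_bool (tfilter (P x) (g x) \<noteq> Leaf))"
    by (rule computable_nonLeaf[OF computable_tfilter[OF P g D' B] B])
  then show ?thesis by (simp add: tfilter_def filter_empty_conv)
qed

lemma poly_nonLeaf: "poly f \<Longrightarrow> poly (\<lambda>x. enc_bool (f x \<noteq> Leaf))"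
  by (rule computable_nonLeaf) auto

lemma poly_not: "poly (\<lambda>x. enc_bool (P x)) \<Longrightarrow> poly (\<lambda>x. enc_bool (\<not> P x))"
  by (rule computable_not) auto

lemma poly_isLeaf: "poly f \<Longrightarrow> poly (\<lambda>x. enc_bool (f x = Leaf))"
  using poly_not[OF poly_nonLeaf] by simp

lemma poly_conj: "poly (\<lambda>x. enc_bool (P x)) \<Longrightarrow> poly (\<lambda>x. enc_bool (Q x)) \<Longrightarrow> poly (\<lambda>x. enc_bool (P x \<and> Q x))"
  by (rule computable_conj) (auto intro: computable_poly_lift)

lemma poly_disj: "poly (\<lambda>x. enc_bool (P x)) \<Longrightarrow> poly (\<lambda>x. enc_bool (Q x)) \<Longrightarrow> poly (\<lambda>x. enc_bool (P x \<or> Q x))"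
  by (rule computable_disj) (auto intro: computable_poly_lift)

lemma poly_ex:
  "poly (\<lambda>z. enc_bool (P (left z) (right z))) \<Longrightarrow> poly g \<Longrightarrow> poly (\<lambda>x. enc_bool (\<exists>y\<in>set (spine (g x)). P x y))"
  by (rule computable_ex) auto

lemma poly_all:
  "poly (\<lambda>z. enc_bool (P (left z) (right z))) \<Longrightarrow> poly g \<Longrightarrow> poly (\<lambda>x. enc_bool (\<forall>y\<in>set (spine (g x)). P x y))"
  using poly_not[OF poly_ex[OF poly_not, of P g]] by simp

definition tapp :: "bintree \<Rightarrow> bintree \<Rightarrow> bintree" where
  "tapp x y = enc_list (spine x @ spine y)"

lemma spine_tapp[simp]: "spine (tapp x y) = spine x @ spine y"
  by (simp add: tapp_def)

lemma poly_tapp: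
  assumes f: "poly f" and g: "poly g"
  shows "poly (\<lambda>x. tapp (f x) (g x))"
proof -
  have "poly (\<lambda>x. foldl (\<lambda>acc y. Node y acc) (g x) (spine (trev (f x))))"
  proof (rule poly_fold[where e = "\<lambda>x. size (f x) + size (g x)" and h = "\<lambda>_ acc y. Node y acc"])
    show "poly_bounded (\<lambda>_. UNIV) (\<lambda>x. size (f x) + size (g x))"
      by (intro poly_bounded_intros poly_bounded_computable[OF f] poly_bounded_computable[OF g])
    fix x ys zs assume "spine (trev (f x)) = ys @ zs"
    from size_enc_list_prefix[OF this] show "size (foldl (\<lambda>acc y. Node y acc) (g x) ys) \<le> size (f x) + size (g x)"
      by (simp add: foldl_Node[where f = "\<lambda>x. x", simplified] size_enc_list_append trev_def)
  qed (intro poly_basic poly_trev f g)+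
  then show ?thesis by (simp add: foldl_Node[where f = "\<lambda>x. x", simplified] tapp_def)
qed

definition tconcat :: "bintree \<Rightarrow> bintree" where
  "tconcat x = enc_list (concat (map spine (spine x)))"

lemma spine_tconcat[simp]: "spine (tconcat x) = concat (map spine (spine x))"
  by (simp add: tconcat_def)

lemma foldl_tapp: "foldl (\<lambda>acc y. tapp y acc) a ys = enc_list (concat (map spine (rev ys)) @ spine a)"
  by (induction ys arbitrary: a) (auto simp: tapp_def)

lemma size_concat_le: "size (enc_list (concat (map spine ys))) \<le> size (enc_list ys)"
  by (induction ys) (auto simp: size_enc_list_append)

lemma poly_tconcat:
  assumes g: "poly g" shows "poly (\<lambda>x. tconcat (g x))"
proof -
  have "poly (\<lambda>x. foldl (\<lambda>acc y. tapp y acc) Leaf (spine (trev (g x))))"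
  proof (rule poly_fold[where e = "\<lambda>x. size (g x)" and h = "\<lambda>_ acc y. tapp y acc"])
    show "poly_bounded (\<lambda>_. UNIV) (\<lambda>x. size (g x))" by (rule poly_bounded_computable[OF g])
    fix x ys zs assume "spine (trev (g x)) = ys @ zs"
    from size_enc_list_prefix[OF this] show "size (foldl (\<lambda>acc y. tapp y acc) Leaf ys) \<le> size (g x)"
      using size_concat_le[of "rev ys"] by (simp add: foldl_tapp trev_def)
  qed (intro poly_basic poly_const poly_tapp poly_trev g)+
  then show ?thesis by (simp add: foldl_tapp tconcat_def)
qed

text \<open>A tree also encodes a number in unary, namely its length as a list; \<open>tdrop\<close> is then
  truncated subtraction.\<close>

definition tdrop :: "bintree \<Rightarrow> bintree \<Rightarrow> bintree" where
  "tdrop v i = enc_list (drop (len i) (spine v))"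

lemma foldl_right: "foldl (\<lambda>acc y. right acc) v ys = enc_list (drop (length ys) (spine v))"
proof (induction ys arbitrary: v)
  case (Cons y ys)
  then show ?case by (simp add: drop_Suc)
qed simp

lemma size_drop_le: "size (enc_list (drop k ys)) \<le> size (enc_list ys)"
  by (metis append_take_drop_id le_add2 size_enc_list_append)

lemma poly_tdrop:
  assumes f: "poly f" and g: "poly g" shows "poly (\<lambda>x. tdrop (f x) (g x))"
proof -
  have "poly (\<lambda>x. foldl (\<lambda>acc y. right acc) (f x) (spine (g x)))"
  proof (rule poly_fold[where e = "\<lambda>x. size (f x)" and h = "\<lambda>_ acc y. right acc"])
    show "poly_bounded (\<lambda>_. UNIV) (\<lambda>x. size (f x))" by (rule poly_bounded_computable[OF f])
    fix x ys zs
    show "size (foldl (\<lambda>acc y. right acc) (f x) ys) \<le> size (f x)"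
      using size_drop_le[of "length ys" "spine (f x)"] by (simp add: foldl_right)
  qed (intro poly_basic f g)+
  then show ?thesis by (simp add: foldl_right tdrop_def)
qed

definition tbit :: "bintree \<Rightarrow> nat \<Rightarrow> bool" where
  "tbit v k \<longleftrightarrow> k < len v \<and> spine v ! k \<noteq> Leaf"

text \<open>\<open>left Leaf = Leaf\<close> makes positions beyond the end of the list read as
  false, in agreement with \<open>tbit\<close>.\<close>

lemma left_tdrop: "left (tdrop v i) \<noteq> Leaf \<longleftrightarrow> tbit v (len i)"
proof (cases "len i < len v")
  case True
  then show ?thesis by (simp add: tdrop_def Cons_nth_drop_Suc[symmetric] tbit_def)
qed (simp add: tdrop_def tbit_def)

lemma poly_bit: "poly f \<Longrightarrow> poly g \<Longrightarrow> poly (\<lambda>x. enc_bool (tbit (f x) (len (g x))))"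
  using poly_nonLeaf[OF poly_left[OF poly_tdrop], of f g] by (simp add: left_tdrop)

lemma poly_le: "poly f \<Longrightarrow> poly g \<Longrightarrow> poly (\<lambda>x. enc_bool (len (f x) \<le> len (g x)))"
  using poly_isLeaf[OF poly_tdrop, of f g] by (simp add: tdrop_def)

lemma poly_eq: "poly f \<Longrightarrow> poly g \<Longrightarrow> poly (\<lambda>x. enc_bool (len (f x) = len (g x)))"
  using poly_conj[OF poly_le poly_le, of f g g f] by (simp add: eq_iff)

primrec tmul :: "nat \<Rightarrow> bintree \<Rightarrow> bintree" where
  "tmul 0 x = Leaf"
| "tmul (Suc k) x = tapp x (tmul k x)"

lemma len_tmul[simp]: "len (tmul k x) = k * len x"
  by (induction k) auto

lemma poly_tmul: "poly f \<Longrightarrow> poly (\<lambda>x. tmul k (f x))"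
  by (induction k) (auto intro: poly_const poly_tapp)

definition tupt :: "bintree \<Rightarrow> bintree" where
  "tupt x = enc_list (map enc_nat [0..<len x])"

lemma spine_tupt[simp]: "spine (tupt x) = map enc_nat [0..<len x]"
  by (simp add: tupt_def)

lemma spine_enc_nat[simp]: "spine (enc_nat n) = replicate n Leaf"
  by (simp add: enc_nat_def)

text \<open>The head of the accumulator is the largest number so far, and its unary successor
  becomes the new head. Starting from the list of the single number 0 yields one number too many, at
  the head.\<close>

lemma foldl_count: "foldl (\<lambda>acc y. Node (Node Leaf (left acc)) acc) (Node Leaf Leaf) ys
   = enc_list (map enc_nat (rev [0..<length ys + 1]))"
proof (induction ys rule: rev_induct)
  case (snoc y ys)
  then show ?case by (simp add: enc_nat_def)
qed (simp add: enc_nat_def)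

lemma size_enc_nat[simp]: "size (enc_nat n) = n"
  by (induction n) (auto simp: enc_nat_def)

lemma poly_tupt:
  assumes f: "poly f" shows "poly (\<lambda>x. tupt (f x))"
proof -
  have 1: "poly (\<lambda>x. foldl (\<lambda>acc y. Node (Node Leaf (left acc)) acc) (Node Leaf Leaf) (spine (f x)))"
  proof (rule poly_fold[where e = "\<lambda>x. (size (f x) + 1) * (size (f x) + 1)"
        and h = "\<lambda>_ acc y. Node (Node Leaf (left acc)) acc"])
    show "poly_bounded (\<lambda>_. UNIV) (\<lambda>x. (size (f x) + 1) * (size (f x) + 1))"
      by (intro poly_bounded_intros poly_bounded_computable[OF f])
    fix x ys zs assume "spine (f x) = ys @ zs"
    then have l: "length ys \<le> size (f x)" using len_le_size[of "f x"] by simp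
    have "size (enc_list (map enc_nat (rev [0..<length ys + 1]))) \<le> length (map enc_nat (rev [0..<length ys + 1])) * (length ys + 1)"
      by (rule size_enc_list_le) auto
    then have "size (enc_list (map enc_nat (rev [0..<length ys + 1]))) \<le> (length ys + 1) * (length ys + 1)"
      by (simp only: length_map length_rev length_upt diff_zero)
    also have "\<dots> \<le> (size (f x) + 1) * (size (f x) + 1)" using l by (intro mult_le_mono) auto
    finally show "size (foldl (\<lambda>acc y. Node (Node Leaf (left acc)) acc) (Node Leaf Leaf) ys) \<le> (size (f x) + 1) * (size (f x) + 1)"
      unfolding foldl_count .
  qed (intro poly_basic poly_const f)+
  have "poly (\<lambda>x. trev (right (foldl (\<lambda>acc y. Node (Node Leaf (left acc)) acc) (Node Leaf Leaf) (spine (f x)))))"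
    by (intro poly_trev poly_basic 1)
  then show ?thesis by (simp add: foldl_count trev_def tupt_def rev_map)
qed

lemmas poly_list = poly_trev poly_tmap poly_tfilter poly_tapp poly_tconcat poly_tdrop poly_tmul poly_tupt
lemmas poly_logic = poly_ite poly_isLeaf poly_nonLeaf poly_bit poly_le poly_eq poly_not poly_conj poly_disj poly_ex poly_all
lemmas poly_rules = poly_list poly_logic poly_basic poly_const

text \<open>Lists shorter than \<open>r\<close> are included, since guesses and groups may have
  fewer sets than allowed. For constant \<open>r\<close> the result has polynomial length, so
  guessing up to \<open>r\<close> sets is affordable.\<close>

primrec tuples :: "nat \<Rightarrow> bintree \<Rightarrow> bintree" where
  "tuples 0 L = Node Leaf Leaf"
| "tuples (Suc r) L = Node Leaf (tconcat (tmap (\<lambda>l. tmap (\<lambda>y. Node y l) L) (tuples r L)))"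

lemma set_tuples: "set (spine (tuples r L)) = {l. len l \<le> r \<and> set (spine l) \<subseteq> set (spine L)}"
proof (induction r)
  case (Suc r)
  show ?case
  proof (intro set_eqI)
    fix l show "l \<in> set (spine (tuples (Suc r) L)) \<longleftrightarrow> l \<in> {l. len l \<le> Suc r \<and> set (spine l) \<subseteq> set (spine L)}"
      by (cases l) (auto simp: Suc)
  qed
qed auto

lemma poly_tuples:
  assumes "poly f" shows "poly (\<lambda>x. tuples r (f x))"
proof (induction r)
  case (Suc r)
  have "poly (\<lambda>z. f (left z))" "poly (\<lambda>z. f (left (left z)))"
    by (intro poly_comp[OF _ assms] poly_basic)+
  then show ?case unfolding tuples.simps by (intro poly_rules Suc)
qed (simp add: poly_const)

section \<open>Embeddings and trees\<close>

text \<open>Arcs of a \<open>pair_graph\<close> are pairs of vertices, so an isomorphism is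
  determined by its vertex map. From left to right this map is inverted; from right to left the
  image of \<open>T\<close> serves as the subgraph \<open>H\<close>.\<close>

lemma has_subgraph_isomorphic_to_iff:
  assumes G: "pair_graph G" and T: "pair_graph T"
  shows "has_subgraph_isomorphic_to G T \<longleftrightarrow>
    (\<exists>\<phi>. inj_on \<phi> (pverts T) \<and> \<phi> ` pverts T \<subseteq> pverts G \<and> (\<forall>u v. (u, v) \<in> parcs T \<longrightarrow> (\<phi> u, \<phi> v) \<in> parcs G))"
proof
  assume "has_subgraph_isomorphic_to G T"
  then obtain H f where H: "pair_graph H" "subgraph (with_proj H) (with_proj G)"
    and f: "pre_digraph.digraph_isomorphism (with_proj H) f" "with_proj T = app_iso f (with_proj H)"
    unfolding has_subgraph_isomorphic_to_def digraph_iso_def by blast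
  interpret H: pair_graph H by (rule H)
  have T': "pverts T = iso_verts f ` pverts H" "parcs T = iso_arcs f ` parcs H" "fst = iso_tail f" "snd = iso_head f"
    using arg_cong[OF f(2), of verts] arg_cong[OF f(2), of arcs] arg_cong[OF f(2), of tail] arg_cong[OF f(2), of head]
    by auto
  have f': "inj_on (iso_verts f) (pverts H)"
    "\<And>a. a \<in> parcs H \<Longrightarrow> iso_verts f (fst a) = fst (iso_arcs f a) \<and> iso_verts f (snd a) = snd (iso_arcs f a)"
    using f(1) unfolding pre_digraph.digraph_isomorphism_def T'[symmetric] by auto
  define \<phi> where "\<phi> = the_inv_into (pverts H) (iso_verts f)"
  have HG: "pverts H \<subseteq> pverts G" "parcs H \<subseteq> parcs G" using H(2) by (auto simp: subgraph_def)
  have "inj_on \<phi> (pverts T)" unfolding \<phi>_def T' by (rule inj_on_the_inv_into[OF f'(1)])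
  moreover have "\<phi> ` pverts T \<subseteq> pverts G"
    using HG(1) the_inv_into_f_f[OF f'(1)] by (auto simp: \<phi>_def T')
  moreover have "(\<phi> u, \<phi> v) \<in> parcs G" if "(u, v) \<in> parcs T" for u v
  proof -
    from that obtain a where a: "a \<in> parcs H" "(u, v) = iso_arcs f a" by (auto simp: T')
    then have "u = iso_verts f (fst a)" "v = iso_verts f (snd a)" using f'(2)[of a] by (metis fst_conv snd_conv)+
    then have "\<phi> u = fst a" "\<phi> v = snd a"
      using the_inv_into_f_f[OF f'(1)] H.arc_fst_in_verts[OF a(1)] H.arc_snd_in_verts[OF a(1)] by (auto simp: \<phi>_def)
    then show ?thesis using a(1) HG by auto
  qed
  ultimately show "\<exists>\<phi>. inj_on \<phi> (pverts T) \<and> \<phi> ` pverts T \<subseteq> pverts G \<and> (\<forall>u v. (u, v) \<in> parcs T \<longrightarrow> (\<phi> u, \<phi> v) \<in> parcs G)"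
    by blast
next
  assume "\<exists>\<phi>. inj_on \<phi> (pverts T) \<and> \<phi> ` pverts T \<subseteq> pverts G \<and> (\<forall>u v. (u, v) \<in> parcs T \<longrightarrow> (\<phi> u, \<phi> v) \<in> parcs G)"
  then obtain \<phi> where \<phi>: "inj_on \<phi> (pverts T)" "\<phi> ` pverts T \<subseteq> pverts G"
    "\<And>u v. (u, v) \<in> parcs T \<Longrightarrow> (\<phi> u, \<phi> v) \<in> parcs G" by blast
  interpret T: pair_graph T by (rule T)
  interpret G: pair_graph G by (rule G)
  define H where "H = \<lparr>pverts = \<phi> ` pverts T, parcs = (\<lambda>(u, v). (\<phi> u, \<phi> v)) ` parcs T\<rparr>"
  have H: "pair_graph H"
  proof unfold_locales
    show "finite (pverts H)" "finite (parcs H)" by (auto simp: H_def)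
    show "symmetric (with_proj H)"
      unfolding symmetric_def with_proj_simps by (rule symI) (auto simp: H_def intro: rev_image_eqI dest: T.arcs_symmetric)
    fix e assume "e \<in> parcs H"
    then obtain u v where uv: "(u, v) \<in> parcs T" "e = (\<phi> u, \<phi> v)" by (auto simp: H_def)
    then show "fst e \<in> pverts H" "snd e \<in> pverts H" by (auto simp: H_def dest: T.in_arcsD1 T.in_arcsD2)
    show "fst e \<noteq> snd e" using G.no_loops'[OF \<phi>(3)[OF uv(1)]] uv by simp
  qed
  interpret H: pair_graph H by (rule H)
  define \<psi> where "\<psi> = the_inv_into (pverts T) \<phi>"
  have \<psi>: "\<psi> (\<phi> v) = v" if "v \<in> pverts T" for v using the_inv_into_f_f[OF \<phi>(1) that] by (simp add: \<psi>_def)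
  have \<psi>': "\<psi> (\<phi> u) = u \<and> \<psi> (\<phi> v) = v" if "(u, v) \<in> parcs T" for u v
    using that \<psi> by (auto dest: T.in_arcsD1 T.in_arcsD2)
  have "wf_digraph (with_proj G)" "wf_digraph (with_proj H)" by unfold_locales
  then have sub: "subgraph (with_proj H) (with_proj G)"
    using \<phi>(2,3) by (auto simp: subgraph_def compatible_def H_def)
  define f where "f = \<lparr>iso_verts = \<psi>, iso_arcs = (\<lambda>(u, v). (\<psi> u, \<psi> v)), iso_head = snd, iso_tail = fst\<rparr>"
  have "pre_digraph.digraph_isomorphism (with_proj H) f"
    unfolding pre_digraph.digraph_isomorphism_def
    using \<open>wf_digraph (with_proj H)\<close> \<psi> \<psi>' by (auto simp: f_def H_def inj_on_def)
  moreover have "with_proj T = app_iso f (with_proj H)"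
  proof -
    have "pverts T = \<psi> ` \<phi> ` pverts T" using \<psi> by force
    moreover have "parcs T = (\<lambda>(u, v). (\<psi> u, \<psi> v)) ` (\<lambda>(u, v). (\<phi> u, \<phi> v)) ` parcs T" using \<psi>' by force
    ultimately show ?thesis by (auto simp: with_proj_def app_iso_def f_def H_def)
  qed
  ultimately show "has_subgraph_isomorphic_to G T"
    unfolding has_subgraph_isomorphic_to_def digraph_iso_def using H sub by blast
qed

lemma pcas_nth:
  assumes "pcas u p w"
  shows "p \<noteq> [] \<Longrightarrow> fst (p ! 0) = u" "p \<noteq> [] \<Longrightarrow> snd (last p) = w"
    "Suc i < length p \<Longrightarrow> fst (p ! Suc i) = snd (p ! i)"
proof -
  show "p \<noteq> [] \<Longrightarrow> fst (p ! 0) = u" using assms by (cases p) auto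
  show "p \<noteq> [] \<Longrightarrow> snd (last p) = w" using assms by (induction p arbitrary: u) auto
  show "Suc i < length p \<Longrightarrow> fst (p ! Suc i) = snd (p ! i)"
    using assms
  proof (induction p arbitrary: u i)
    case (Cons e p)
    then show ?case by (cases i; cases p) auto
  qed simp
qed

lemma tl_pawalk_verts: "pcas u p w \<Longrightarrow> tl (pawalk_verts u p) = map snd p"
proof (induction p arbitrary: u)
  case (Cons e p)
  then show ?case by (cases p) auto
qed simp

text \<open>On a cycle of length at least 3, a vertex of maximal depth would have two different parents.\<close>

lemma undirected_treeI:
  assumes T: "pair_graph T" and r: "r \<in> pverts T" "d r = (0 :: nat)"
    and par: "\<And>v. v \<in> pverts T \<Longrightarrow> v \<noteq> r \<Longrightarrow> (v, par v) \<in> parcs T \<and> d (par v) < d v"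
    and arc: "\<And>u v. (u, v) \<in> parcs T \<Longrightarrow> u = par v \<and> d u < d v \<or> v = par u \<and> d v < d u"
  shows "undirected_tree T"
proof -
  interpret T: pair_graph T by (rule T)
  have reach: "v \<rightarrow>\<^sup>*\<^bsub>with_proj T\<^esub> r" if "v \<in> pverts T" for v
    using that
  proof (induction "d v" arbitrary: v rule: less_induct)
    case less
    show ?case
    proof (cases "v = r")
      case True
      then show ?thesis using less.prems by (simp add: reachable_def)
    next
      case False
      note p = par[OF less.prems False]
      have "par v \<in> pverts T" using p by (auto dest: T.in_arcsD2)
      from less.hyps[OF _ this] p have "par v \<rightarrow>\<^sup>*\<^bsub>with_proj T\<^esub> r" by blast
      moreover have "v \<rightarrow>\<^bsub>with_proj T\<^esub> par v" using p by simp
      ultimately show ?thesis using T.adj_reachable_trans[of v "par v" r] by simp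
    qed
  qed
  have "u \<rightarrow>\<^sup>*\<^bsub>with_proj T\<^esub> v" if "u \<in> pverts T" "v \<in> pverts T" for u v
    using T.reachable_trans[OF reach[OF that(1)] T.symmetric_reachable'[OF reach[OF that(2)]]] .
  then have "Digraph_Component.connected (with_proj T)"
    unfolding connected_def strongly_connected_def using r by (auto intro!: T.reachable_mk_symmetricI)
  moreover have False if p: "pre_digraph.cycle (with_proj T) p" "3 \<le> length p" for p
  proof -
    obtain u where u: "set p \<subseteq> parcs T" "pcas u p u" "distinct (tl (pawalk_verts u p))"
      using p(1) unfolding pre_digraph.cycle_def pre_digraph.awalk_def
      by (auto simp: cas_with_proj_eq awalk_verts_with_proj_eq)
    define L where "L = length p"
    have L: "3 \<le> L" "p \<noteq> []" using p(2) by (auto simp: L_def)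
    have dist: "distinct (map snd p)" using u tl_pawalk_verts by metis
    define nxt where "nxt i = (i + 1) mod L" for i
    have nxt: "fst (p ! nxt i) = snd (p ! i)" if "i < L" for i
    proof (cases "Suc i < L")
      case True
      then show ?thesis using pcas_nth(3)[OF u(2), of i] by (simp add: nxt_def L_def)
    next
      case False
      then have "i = L - 1" using that by simp
      then show ?thesis using pcas_nth(1,2)[OF u(2)] L by (simp add: nxt_def last_conv_nth L_def)
    qed
    have nL: "nxt i < L" for i using L by (simp add: nxt_def)
    obtain i where i: "i < L" "\<And>j. j < L \<Longrightarrow> d (snd (p ! j)) \<le> d (snd (p ! i))"
    proof -
      define S where "S = (\<lambda>j. d (snd (p ! j))) ` {..<L}"
      have S: "finite S" "d (snd (p ! 0)) \<in> S" using L by (auto simp: S_def)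
      then have "Max S \<in> S" by (intro Max_in) auto
      then obtain i where i: "i < L" "Max S = d (snd (p ! i))" by (auto simp: S_def)
      have "d (snd (p ! j)) \<le> d (snd (p ! i))" if "j < L" for j
      proof -
        have "d (snd (p ! j)) \<in> S" using that by (auto simp: S_def)
        from Max_ge[OF S(1) this] i(2) show ?thesis by simp
      qed
      then show ?thesis using i(1) by (rule that[rotated])
    qed
    define k where "k = (if i = 0 then L - 1 else i - 1)"
    have k: "k < L" "nxt k = i" using i(1) L by (cases "i = 0"; simp add: k_def nxt_def)+
    have arcs: "(fst (p ! j), snd (p ! j)) \<in> parcs T" if "j < L" for j
      using subsetD[OF u(1) nth_mem, of j] that by (simp add: L_def)
    have "fst (p ! i) = snd (p ! k)" using nxt[OF k(1)] k by simp
    \<comment> \<open>The arc joins \<open>snd (p ! i)\<close> to a vertex that is not deeper, which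
      by \<open>arc\<close> can only be its parent. The same holds for the next arc of the
      cycle.\<close>
    then have 1: "snd (p ! k) = par (snd (p ! i))"
      using arc[OF arcs[OF i(1)]] i(2)[OF k(1)] by simp
    have 2: "snd (p ! nxt i) = par (snd (p ! i))"
      using arc[OF arcs[OF nL[of i]]] i(2)[OF nL[of i]] nxt[OF i(1)] by simp
    have "k = nxt i"
    proof -
      have "map snd p ! k = map snd p ! nxt i" using 1 2 k(1) nL[of i] by (simp add: L_def)
      then show ?thesis using nth_eq_iff_index_eq[OF dist, of k "nxt i"] k(1) nL[of i] by (simp add: L_def)
    qed
    \<comment> \<open>Predecessor and successor positions would coincide on a cycle of length 2;
      here \<open>3 \<le> L\<close> enters.\<close>
    moreover have "k \<noteq> nxt i"
    proof (cases "i + 1 = L")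
      case True
      then show ?thesis using L by (simp add: k_def nxt_def)
    next
      case False
      then show ?thesis using i(1) L by (auto simp: k_def nxt_def)
    qed
    ultimately show False by simp
  qed
  ultimately show ?thesis unfolding undirected_tree_def using T by blast
qed

section \<open>Incidence graphs\<close>

text \<open>The elements are the vertices \<open>0, \<dots>, n - 1\<close>; the vertex of the set \<open>Ss ! j\<close> is \<open>n + j\<close>.\<close>

definition igraph :: "nat \<Rightarrow> nat set list \<Rightarrow> nat pair_pre_digraph" where
  "igraph n Ss = \<lparr>pverts = {..<n + length Ss},
     parcs = {(i, n + j) | i j. i < n \<and> j < length Ss \<and> i \<in> Ss ! j} \<union>
             {(n + j, i) | i j. i < n \<and> j < length Ss \<and> i \<in> Ss ! j}\<rparr>"

lemma pverts_igraph[simp]: "pverts (igraph n Ss) = {..<n + length Ss}"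
  by (simp add: igraph_def)

lemma igraph_arc:
  "(u, v) \<in> parcs (igraph n Ss) \<longleftrightarrow>
     (u < n \<and> n \<le> v \<and> v < n + length Ss \<and> u \<in> Ss ! (v - n)) \<or>
     (v < n \<and> n \<le> u \<and> u < n + length Ss \<and> v \<in> Ss ! (u - n))"
proof -
  have "(\<exists>j. v = n + j \<and> u < n \<and> j < length Ss \<and> u \<in> Ss ! j) \<longleftrightarrow>
      u < n \<and> n \<le> v \<and> v < n + length Ss \<and> u \<in> Ss ! (v - n)" for u v
  proof
    assume "u < n \<and> n \<le> v \<and> v < n + length Ss \<and> u \<in> Ss ! (v - n)"
    then show "\<exists>j. v = n + j \<and> u < n \<and> j < length Ss \<and> u \<in> Ss ! j"
      by (intro exI[of _ "v - n"]) auto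
  qed auto
  from this[of v u] this[of u v] show ?thesis by (simp add: igraph_def)
qed

lemma pair_graph_igraph: "pair_graph (igraph n Ss)"
proof unfold_locales
  have "parcs (igraph n Ss) \<subseteq> {..<n + length Ss} \<times> {..<n + length Ss}" by (auto simp: igraph_arc)
  then show "finite (parcs (igraph n Ss))" by (rule finite_subset) auto
  show "symmetric (with_proj (igraph n Ss))"
    unfolding symmetric_def with_proj_simps by (rule symI) (auto simp: igraph_arc)
qed (auto simp: igraph_arc)

text \<open>The root is the parent of every set, and \<open>f i\<close> is the only set containing
  the element \<open>i\<close>. Depths 0, 1 and 2 with unique parents are therefore available for
  \<open>undirected_treeI\<close>.\<close>

lemma undirected_tree_igraph:
  assumes root: "\<And>P. P \<in> set Ps \<Longrightarrow> 0 \<in> P"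
    and f: "\<And>i j. 0 < i \<Longrightarrow> i < n \<Longrightarrow> j < length Ps \<Longrightarrow> i \<in> Ps ! j \<longleftrightarrow> j = f i"
    and f': "\<And>i. 0 < i \<Longrightarrow> i < n \<Longrightarrow> f i < length Ps" and n: "0 < n"
  shows "undirected_tree (igraph n Ps)"
proof (rule undirected_treeI[OF pair_graph_igraph, where r = 0 and par = "\<lambda>v. if n \<le> v then 0 else n + f v"
      and d = "\<lambda>v. if v = 0 then 0 else if n \<le> v then 1 else 2"])
  fix v assume "v \<in> pverts (igraph n Ps)" "v \<noteq> 0"
  then show "(v, if n \<le> v then 0 else n + f v) \<in> parcs (igraph n Ps) \<and>
    (if (if n \<le> v then 0 else n + f v) = 0 then 0 else if n \<le> (if n \<le> v then 0 else n + f v) then 1 else 2) <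
    (if v = 0 then 0 else if n \<le> v then 1 else 2 :: nat)"
    using n f[of v "f v"] f'[of v] root by (auto simp: igraph_arc)
next
  fix u v assume "(u, v) \<in> parcs (igraph n Ps)"
  then show "u = (if n \<le> v then 0 else n + f v) \<and> (if u = 0 then 0 else if n \<le> u then 1 else 2) < (if v = 0 then 0 else if n \<le> v then 1 else 2 :: nat) \<or>
    v = (if n \<le> u then 0 else n + f u) \<and> (if v = 0 then 0 else if n \<le> v then 1 else 2) < (if u = 0 then 0 else if n \<le> u then 1 else 2 :: nat)"
    unfolding igraph_arc
  proof (elim disjE conjE)
    assume "u < n" "n \<le> v" "v < n + length Ps" "u \<in> Ps ! (v - n)"
    then show ?thesis using n f[of u "v - n"] by (cases "u = 0") auto
  next
    assume "v < n" "n \<le> u" "u < n + length Ps" "v \<in> Ps ! (u - n)"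
    then show ?thesis using n f[of v "u - n"] by (cases "v = 0") auto
  qed
qed (use n in auto)

section \<open>Covers as tree embeddings\<close>

text \<open>In the pattern tree, the root is element 0, leaf \<open>i < z\<close> is element \<open>i + 1\<close> and hangs on hub
  \<open>w i\<close>. The singletons \<open>{0}\<close> are pendant vertices at the root: in the pattern they give the root a
  degree which no set vertex of the host has.\<close>

definition hub :: "nat \<Rightarrow> (nat \<Rightarrow> nat) \<Rightarrow> nat \<Rightarrow> nat set" where
  "hub z w j = insert 0 {Suc i | i. i < z \<and> w i = j}"

definition pattern :: "nat \<Rightarrow> (nat \<Rightarrow> nat) \<Rightarrow> nat \<Rightarrow> nat \<Rightarrow> nat pair_pre_digraph" where
  "pattern z w a x = igraph (Suc z) (map (hub z w) [0..<a] @ replicate x {0})"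

definition host :: "nat \<Rightarrow> nat set list \<Rightarrow> nat \<Rightarrow> nat pair_pre_digraph" where
  "host n gs c = igraph (Suc n) (gs @ replicate c {0})"

lemma hub_nth: "j < a + x \<Longrightarrow> (map (hub z w) [0..<a] @ replicate x {0}) ! j = (if j < a then hub z w j else {0})"
  by (auto simp: nth_append)

lemma undirected_tree_pattern:
  assumes "\<And>i. i < z \<Longrightarrow> w i < a"
  shows "undirected_tree (pattern z w a x)"
  unfolding pattern_def
proof (rule undirected_tree_igraph[where f = "\<lambda>i. w (i - 1)"])
  fix i assume i: "0 < i" "i < Suc z"
  then have "w (i - 1) < a" using assms by simp
  then show "w (i - 1) < length (map (hub z w) [0..<a] @ replicate x {0})" by simp
  fix j assume "j < length (map (hub z w) [0..<a] @ replicate x {0})"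
  then have "j < a + x" by simp
  from hub_nth[OF this] show "i \<in> (map (hub z w) [0..<a] @ replicate x {0}) ! j \<longleftrightarrow> j = w (i - 1)"
    using i \<open>w (i - 1) < a\<close> by (cases i) (auto simp: hub_def)
qed (auto simp: hub_def)

lemma pattern_arcs:
  "(0, Suc z + j) \<in> parcs (pattern z w a x) \<longleftrightarrow> j < a + x"
  "i < z \<Longrightarrow> w i < a \<Longrightarrow> (Suc i, Suc z + w i) \<in> parcs (pattern z w a x)"
proof -
  define Ps where "Ps = map (hub z w) [0..<a] @ replicate x {0}"
  have P: "pattern z w a x = igraph (Suc z) Ps" and len: "length Ps = a + x"
    by (simp_all add: pattern_def Ps_def)
  have Ps: "Ps ! j = (if j < a then hub z w j else {0})" if "j < a + x" for j
    using hub_nth[OF that] by (simp add: Ps_def)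
  have "0 \<in> Ps ! j" if "j < a + x" using Ps[OF that] by (simp add: hub_def)
  then show "(0, Suc z + j) \<in> parcs (pattern z w a x) \<longleftrightarrow> j < a + x"
    unfolding P igraph_arc len by auto
  assume w: "i < z" "w i < a"
  then have "Suc i \<in> Ps ! w i" using Ps[of "w i"] by (simp add: hub_def)
  then show "(Suc i, Suc z + w i) \<in> parcs (pattern z w a x)"
    unfolding P igraph_arc len using w by simp
qed

text \<open>A set vertex of the host has at most \<open>s\<close> neighbours, fewer than the root,
  so the root goes to an element, the hubs to sets and the leaves to elements. All sets lie in
  \<open>insert 0 U\<close>, which the \<open>Suc z\<close> images of root and leaves fill
  completely. Hence each element of \<open>U\<close> lies in the image of a hub.\<close>

lemma embedding_imp_cover:
  assumes sub: "has_subgraph_isomorphic_to (host n gs c) (pattern z w a x)"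
    and U: "U \<subseteq> {1..n}" "card U = z"
    and gs: "\<And>g. g \<in> set gs \<Longrightarrow> g \<subseteq> insert 0 U \<and> card g \<le> s"
    and w: "\<And>i. i < z \<Longrightarrow> w i < a" and s: "1 \<le> s" "s < a + x" "0 < a"
  shows "\<exists>hs \<subseteq> set gs. card hs \<le> a \<and> U \<subseteq> \<Union> hs"
proof -
  let ?T = "pattern z w a x" and ?G = "host n gs c"
  let ?Fs = "gs @ replicate c {0}"
  have Gg: "pair_graph ?G" "pair_graph ?T" by (simp_all add: host_def pattern_def pair_graph_igraph)
  obtain \<phi> where \<phi>: "inj_on \<phi> (pverts ?T)" "\<phi> ` pverts ?T \<subseteq> pverts ?G"
    "\<And>u v. (u, v) \<in> parcs ?T \<Longrightarrow> (\<phi> u, \<phi> v) \<in> parcs ?G"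
    using sub unfolding has_subgraph_isomorphic_to_iff[OF Gg] by blast
  have Tv: "pverts ?T = {..<Suc z + (a + x)}" by (simp add: pattern_def)
  have Fs: "?Fs ! k \<in> set gs \<or> ?Fs ! k = {0}" if "k < length ?Fs" for k
    using that by (auto simp: nth_append)
  have finU: "finite U" using U(1) finite_subset by blast
  have Fs': "?Fs ! k \<subseteq> insert 0 U \<and> finite (?Fs ! k) \<and> card (?Fs ! k) \<le> s" if "k < length ?Fs" for k
    using Fs[OF that] gs s finU by (auto intro: finite_subset)
  have root: "\<phi> 0 < Suc n"
  proof (rule ccontr)
    assume "\<not> \<phi> 0 < Suc n"
    then have ge: "Suc n \<le> \<phi> 0" by simp
    have el: "\<phi> (Suc z + j) \<in> ?Fs ! (\<phi> 0 - Suc n) \<and> \<phi> 0 - Suc n < length ?Fs" if "j < a + x" for j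
      using \<phi>(3)[of 0 "Suc z + j"] pattern_arcs(1)[of z j w a x] that ge by (auto simp: host_def igraph_arc)
    have k: "\<phi> 0 - Suc n < length ?Fs" using el[of 0] s by auto
    have "card ((\<lambda>j. \<phi> (Suc z + j)) ` {..<a + x}) = a + x"
    proof (subst card_image)
      show "inj_on (\<lambda>j. \<phi> (Suc z + j)) {..<a + x}"
        using inj_onD[OF \<phi>(1), of "Suc z + _" "Suc z + _"] by (intro inj_onI) (simp add: Tv)
    qed simp
    moreover have "(\<lambda>j. \<phi> (Suc z + j)) ` {..<a + x} \<subseteq> ?Fs ! (\<phi> 0 - Suc n)" using el by auto
    ultimately have "a + x \<le> card (?Fs ! (\<phi> 0 - Suc n))" using card_mono Fs'[OF k] by metis
    then show False using Fs'[OF k] s by auto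
  qed
  define \<psi> where "\<psi> j = \<phi> (Suc z + j) - Suc n" for j
  have hubs: "Suc n \<le> \<phi> (Suc z + j) \<and> \<psi> j < length ?Fs \<and> \<phi> 0 \<in> ?Fs ! \<psi> j" if "j < a + x" for j
    using \<phi>(3)[of 0 "Suc z + j"] pattern_arcs(1)[of z j w a x] that root by (auto simp: host_def igraph_arc \<psi>_def)
  have leaves: "\<phi> (Suc i) \<in> ?Fs ! \<psi> (w i)" if "i < z" for i
  proof -
    have wi: "w i < a" using w[OF that] .
    have "(\<phi> (Suc i), \<phi> (Suc z + w i)) \<in> parcs (igraph (Suc n) ?Fs)"
      using \<phi>(3)[OF pattern_arcs(2)[of i z w a x, OF that wi]] unfolding host_def .
    moreover have "Suc n \<le> \<phi> (Suc z + w i)" using hubs[of "w i"] wi by simp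
    ultimately show ?thesis unfolding igraph_arc \<psi>_def by (meson leD)
  qed
  have im: "\<phi> ` {..z} \<subseteq> insert 0 U"
  proof
    fix v assume "v \<in> \<phi> ` {..z}"
    then obtain i where i: "i \<le> z" "v = \<phi> i" by auto
    show "v \<in> insert 0 U"
    proof (cases i)
      case 0
      then show ?thesis using hubs[of 0] Fs'[of "\<psi> 0"] s i by auto
    next
      case (Suc i')
      then show ?thesis using leaves[of i'] hubs[of "w i'"] w[of i'] Fs'[of "\<psi> (w i')"] i by auto
    qed
  qed
  have "card (\<phi> ` {..z}) = Suc z" by (subst card_image) (use \<phi>(1) in \<open>auto simp: inj_on_def Tv\<close>)
  moreover have "card (insert 0 U) = Suc z" using U finU by (subst card_insert_disjoint) auto
  ultimately have surj: "\<phi> ` {..z} = insert 0 U" using im finU by (intro card_subset_eq) auto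
  define hs where "hs = (\<lambda>j. ?Fs ! \<psi> j) ` {..<a} \<inter> set gs"
  have "card hs \<le> card ((\<lambda>j. ?Fs ! \<psi> j) ` {..<a})" unfolding hs_def by (intro card_mono) auto
  also have "\<dots> \<le> a" using card_image_le[of "{..<a}"] by auto
  finally have "card hs \<le> a" .
  moreover have "U \<subseteq> \<Union> hs"
  proof
    fix u assume u: "u \<in> U"
    then have "u \<noteq> 0" using U by auto
    obtain i where i: "i \<le> z" "u = \<phi> i" using surj u by (metis atMost_iff imageE insertI2)
    \<comment> \<open>If \<open>u\<close> is the image of the root rather than of a leaf, the image
      of every hub contains it, and \<open>0 < a\<close> provides one.\<close>
    have "\<exists>j<a. u \<in> ?Fs ! \<psi> j"
    proof (cases i)
      case 0
      then show ?thesis using hubs[of 0] s i by auto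
    next
      case (Suc i')
      then show ?thesis using leaves[of i'] w[of i'] i by auto
    qed
    then obtain j where j: "j < a" "u \<in> ?Fs ! \<psi> j" by blast
    have "\<psi> j < length ?Fs" using hubs[of j] j(1) by simp
    \<comment> \<open>A hub may be mapped to a pendant vertex of the host, but the set
      \<open>{0}\<close> contains no element of \<open>U\<close>.\<close>
    from Fs[OF this] have "?Fs ! \<psi> j \<in> set gs" using j(2) \<open>u \<noteq> 0\<close> by (metis singletonD)
    then have "?Fs ! \<psi> j \<in> hs" unfolding hs_def using j(1) by blast
    then show "u \<in> \<Union> hs" using j(2) by (rule UnionI)
  qed
  moreover have "hs \<subseteq> set gs" by (simp add: hs_def)
  ultimately show ?thesis by (intro exI[of _ hs] conjI)
qed

text \<open>A hub \<open>j\<close> with leaves goes to the vertex of the set \<open>V j\<close>, and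
  its leaves go bijectively to the elements assigned to \<open>j\<close>. A hub without leaves has
  no set and goes to a pendant vertex of the host, which is why \<open>x + a\<close> of these are
  required.\<close>

lemma cover_imp_embedding:
  assumes U: "U \<subseteq> {1..n}"
    and f: "\<And>u. u \<in> U \<Longrightarrow> f u < a \<and> V (f u) \<in> set gs \<and> u \<in> V (f u)"
    and V: "inj_on V (f ` U)"
    and num_nodes: "\<And>j. j < a \<Longrightarrow> card {u \<in> U. f u = j} = card {i. i < z \<and> w i = j}"
    and w: "\<And>i. i < z \<Longrightarrow> w i < a"
    and gs: "\<And>g. g \<in> set gs \<Longrightarrow> 0 \<in> g" and c: "x + a \<le> c"
  shows "has_subgraph_isomorphic_to (host n gs c) (pattern z w a x)"
proof -
  let ?T = "pattern z w a x" and ?G = "host n gs c"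
  let ?Fs = "gs @ replicate c {0}"
  have Gg: "pair_graph ?G" "pair_graph ?T" by (simp_all add: host_def pattern_def pair_graph_igraph)
  have finU: "finite U" using U(1) finite_subset by blast
  have "\<exists>b. bij_betw b {i. i < z \<and> w i = j} {u \<in> U. f u = j}" if "j < a" for j
    by (rule finite_same_card_bij) (use finU num_nodes[OF that] in auto)
  then obtain b where b: "\<And>j. j < a \<Longrightarrow> bij_betw (b j) {i. i < z \<and> w i = j} {u \<in> U. f u = j}" by metis
  define \<beta> where "\<beta> i = b (w i) i" for i
  have \<beta>: "\<beta> i \<in> U \<and> f (\<beta> i) = w i" if "i < z" for i
    using bij_betwE[OF b[OF w[OF that]]] that by (auto simp: \<beta>_def)
  have \<beta>inj: "i = i'" if "i < z" "i' < z" "\<beta> i = \<beta> i'" for i i'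
  proof -
    have "w i = w i'" using \<beta>[OF that(1)] \<beta>[OF that(2)] that(3) by simp
    then show ?thesis using bij_betw_imp_inj_on[OF b[OF w[OF that(1)]]] that by (auto simp: inj_on_def \<beta>_def)
  qed
  have "\<exists>k<length gs. gs ! k = V j" if "j \<in> f ` U" for j using that f by (auto simp: in_set_conv_nth[symmetric])
  then obtain idx where idx: "\<And>j. j \<in> f ` U \<Longrightarrow> idx j < length gs \<and> gs ! idx j = V j" by metis
  \<comment> \<open>Positions in the list of host sets: the first \<open>x\<close> pendant vertices
    receive the pendants of the pattern, the next \<open>a\<close> are reserved for hubs without
    leaves.\<close>
  define h where "h j = (if j < a then if j \<in> f ` U then idx j else length gs + x + j else length gs + (j - a))" for j
  have h: "h j < length ?Fs" if "j < a + x" for j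
    using that c idx[of j] by (auto simp: h_def)
  have hinj: "j = j'" if "j < a + x" "j' < a + x" "h j = h j'" for j j'
  proof -
    have "idx j \<noteq> idx j'" if "j \<in> f ` U" "j' \<in> f ` U" "j \<noteq> j'"
      using idx[OF that(1)] idx[OF that(2)] V that by (metis inj_on_def)
    then show ?thesis using that idx[of j] idx[of j'] by (auto simp: h_def split: if_splits)
  qed
  have h0: "0 \<in> ?Fs ! h j" if "j < a + x" for j
  proof -
    have "?Fs ! h j \<in> set ?Fs" using h[OF that] nth_mem by blast
    then show ?thesis using gs by auto
  qed
  have hV: "\<beta> i \<in> ?Fs ! h (w i)" if "i < z" for i
    using \<beta>[OF that] f[of "\<beta> i"] idx[of "w i"] w[OF that] by (auto simp: h_def nth_append image_iff)
  define \<phi> where "\<phi> v = (if v = 0 then 0 else if v \<le> z then \<beta> (v - 1) else Suc n + h (v - Suc z))" for v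
  have \<phi>': "\<phi> 0 = 0" "\<And>i. i < z \<Longrightarrow> \<phi> (Suc i) = \<beta> i" "\<And>j. \<phi> (Suc z + j) = Suc n + h j"
    by (auto simp: \<phi>_def)
  have \<beta>n: "0 < \<beta> i \<and> \<beta> i \<le> n" if "i < z" for i using \<beta>[OF that] U by auto
  have cases: "v = 0 \<or> (\<exists>i<z. v = Suc i) \<or> (\<exists>j<a + x. v = Suc z + j)" if "v < Suc z + (a + x)" for v
  proof (cases v)
    case (Suc v')
    show ?thesis
    proof (cases "v' < z")
      case False
      then have "v = Suc z + (v' - z)" "v' - z < a + x" using that Suc by auto
      then show ?thesis by blast
    qed (use Suc in auto)
  qed simp
  have "inj_on \<phi> (pverts ?T)"
  proof (rule inj_onI)
    fix u v assume uv: "u \<in> pverts ?T" "v \<in> pverts ?T" "\<phi> u = \<phi> v"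
    have "u < Suc z + (a + x)" "v < Suc z + (a + x)" using uv by (auto simp: pattern_def)
    from cases[OF this(1)] cases[OF this(2)] show "u = v"
      using uv(3) \<beta>n \<beta>inj hinj by (elim disjE exE conjE) (auto simp: \<phi>' simp del: add_Suc, fastforce+)
  qed
  moreover have "\<phi> ` pverts ?T \<subseteq> pverts ?G"
  proof
    fix y assume "y \<in> \<phi> ` pverts ?T"
    then obtain v where v: "v < Suc z + (a + x)" "y = \<phi> v" by (auto simp: pattern_def)
    from cases[OF v(1)] show "y \<in> pverts ?G"
      using v(2) \<beta>n h by (elim disjE exE conjE) (auto simp: \<phi>' host_def simp del: add_Suc, fastforce+)
  qed
  moreover have "(\<phi> u, \<phi> v) \<in> parcs ?G" if "(u, v) \<in> parcs ?T" for u v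
  proof -
    have main: "(\<phi> u, \<phi> v) \<in> parcs ?G \<and> (\<phi> v, \<phi> u) \<in> parcs ?G"
      if uv: "u < Suc z" "Suc z \<le> v" "v < Suc z + (a + x)" "u \<in> (map (hub z w) [0..<a] @ replicate x {0}) ! (v - Suc z)" for u v
    proof -
      define j where "j = v - Suc z"
      have j: "v = Suc z + j" "j < a + x" using uv by (auto simp: j_def)
      have u: "u \<in> (if j < a then hub z w j else {0})" using uv(4) hub_nth[OF j(2)] by (simp add: j_def)
      show ?thesis
      proof (cases u)
        case 0
        then show ?thesis using h[OF j(2)] h0[OF j(2)] by (auto simp: \<phi>' j(1) host_def igraph_arc simp del: add_Suc)
      next
        case (Suc i)
        then have "j < a" "i < z" "w i = j" using u by (auto simp: hub_def split: if_splits)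
        then show ?thesis using Suc h[OF j(2)] hV[of i] \<beta>n[of i]
          by (auto simp: \<phi>' j(1) host_def igraph_arc simp del: add_Suc)
      qed
    qed
    from that show ?thesis using main[of u v] main[of v u] by (auto simp: pattern_def igraph_arc)
  qed
  ultimately show ?thesis unfolding has_subgraph_isomorphic_to_iff[OF Gg] by blast
qed

section \<open>Encoding incidence graphs\<close>

lemma poly_comp2:
  assumes "poly (\<lambda>x. F (left x) (right x))" "poly f" "poly g"
  shows "poly (\<lambda>x. F (f x) (g x))"
  using poly_comp[OF poly_Node[OF assms(2,3)] assms(1)] by simp

definition bits :: "bintree \<Rightarrow> nat set" where
  "bits v = {k. tbit v k}"

abbreviation tt :: bintree where "tt \<equiv> Node Leaf Leaf"

text \<open>A label carries its side of the bipartition and either the number of the element or the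
  characteristic vector of the set. Adjacency then depends on the two labels alone, and the matrix
  arises from two nested maps.\<close>

definition labels :: "bintree \<Rightarrow> bintree \<Rightarrow> bintree" where
  "labels N vs = tapp (tmap (\<lambda>i. Node Leaf i) (tupt N)) (tmap (\<lambda>v. Node tt v) vs)"

definition adj :: "bintree \<Rightarrow> bintree \<Rightarrow> bool" where
  "adj u v \<longleftrightarrow> (left u = Leaf \<and> left v \<noteq> Leaf \<and> tbit (right v) (len (right u))) \<or>
               (left v = Leaf \<and> left u \<noteq> Leaf \<and> tbit (right u) (len (right v)))"

definition incidence_matrix :: "bintree \<Rightarrow> bintree \<Rightarrow> bintree" where
  "incidence_matrix N vs = tmap (\<lambda>u. tmap (\<lambda>v. enc_bool (adj u v)) (labels N vs)) (labels N vs)"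

lemma poly_incidence_matrix: "poly f \<Longrightarrow> poly g \<Longrightarrow> poly (\<lambda>x. incidence_matrix (f x) (g x))"
  by (rule poly_comp2[where F = incidence_matrix]) (unfold incidence_matrix_def labels_def adj_def, intro poly_rules)

lemma spine_labels: "spine (labels N vs) = map (\<lambda>i. Node Leaf (enc_nat i)) [0..<len N] @ map (Node tt) (spine vs)"
  by (simp add: labels_def)

lemma enc_graph_igraph: "enc_graph (igraph (len N) (map bits (spine vs))) = incidence_matrix N vs"
proof -
  let ?L = "spine (labels N vs)" and ?M = "len N + len vs" and ?G = "igraph (len N) (map bits (spine vs))"
  have M: "length ?L = ?M" by (simp add: spine_labels)
  have nth: "?L ! u = (if u < len N then Node Leaf (enc_nat u) else Node tt (spine vs ! (u - len N)))" if "u < ?M" for u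
    using that by (auto simp: spine_labels nth_append)
  have arc: "(u, v) \<in> parcs ?G \<longleftrightarrow> adj (?L ! u) (?L ! v)" if "u < ?M" "v < ?M" for u v
    using that by (auto simp: igraph_arc nth adj_def bits_def)
  have tm: "spine (tmap f (labels N vs)) = map (\<lambda>u. f (?L ! u)) [0..<?M]" for f
  proof -
    have "map f ?L = map f (map ((!) ?L) [0..<?M])" using map_nth[of ?L] unfolding M by simp
    then show ?thesis by (simp add: comp_def)
  qed
  have "map (\<lambda>u. enc_bits (map (\<lambda>v. (u, v) \<in> parcs ?G) [0..<?M])) [0..<?M]
    = map (\<lambda>u. tmap (\<lambda>v. enc_bool (adj (?L ! u) v)) (labels N vs)) [0..<?M]"
  proof (rule map_cong[OF refl])
    fix u assume "u \<in> set [0..<?M]"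
    then have u: "u < ?M" by simp
    have "map enc_bool (map (\<lambda>v. (u, v) \<in> parcs ?G) [0..<?M]) = map (\<lambda>v. enc_bool (adj (?L ! u) (?L ! v))) [0..<?M]"
      using arc[OF u] by simp
    also have "\<dots> = spine (tmap (\<lambda>v. enc_bool (adj (?L ! u) v)) (labels N vs))"
      by (rule tm[symmetric])
    finally show "enc_bits (map (\<lambda>v. (u, v) \<in> parcs ?G) [0..<?M]) = tmap (\<lambda>v. enc_bool (adj (?L ! u) v)) (labels N vs)"
      unfolding enc_bits_def by (simp only: enc_list_spine)
  qed
  also have "\<dots> = spine (incidence_matrix N vs)" unfolding incidence_matrix_def by (rule tm[symmetric])
  finally show ?thesis unfolding enc_graph_def by (simp add: Let_def)
qed

section \<open>Enumerating the patterns\<close>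

text \<open>The assignments of \<open>len z\<close> further leaves to hubs: each leaf goes to the current hub \<open>o'\<close> or
  opens the next lower one. They correspond to the compositions of \<open>len z\<close> into few parts.\<close>

primrec assignments :: "bintree \<Rightarrow> bintree \<Rightarrow> bintree \<Rightarrow> bintree list" where
  "assignments Leaf o' w = [w]"
| "assignments (Node l z) o' w = assignments z o' (Node o' w) @ (if o' \<noteq> Leaf then assignments z (right o') (Node (right o') w) else [])"

text \<open>This is the size of the recursion tree of \<open>assignments\<close>, inner nodes
  included, and thus the number of iterations of the search.\<close>

primrec num_nodes :: "nat \<Rightarrow> nat \<Rightarrow> nat" where
  "num_nodes 0 k = 1"
| "num_nodes (Suc z) k = 1 + num_nodes z k + (if k > 0 then num_nodes z (k - 1) else 0)"

text \<open>With \<open>X k = (1 + \<xi>) ^ z * (1 / \<xi>) ^ k\<close>, the identity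
  \<open>X (k - 1) = \<xi> * X k\<close> for positive \<open>k\<close> turns the factor
  \<open>1 + \<xi>\<close> of the next level into the sum of the two branches, as in the usual bound
  on partial sums of binomial coefficients. Adding 1 on the left makes the recurrence homogeneous;
  the factor \<open>real z + 1\<close> pays for the case \<open>k = 0\<close>.\<close>

lemma num_nodes_bound:
  assumes "0 < \<xi>" "\<xi> \<le> 1"
  shows "real (num_nodes z k) + 1 \<le> 2 * (real z + 1) * (1 + \<xi>) ^ z * (1 / \<xi>) ^ k"
proof (induction z arbitrary: k)
  case 0
  have "1 \<le> (1 / \<xi>) ^ k" using assms by (intro one_le_power) auto
  then show ?case by simp
next
  case (Suc z)
  define X where "X k = (1 + \<xi>) ^ z * (1 / \<xi>) ^ k" for k
  have X: "1 \<le> X k" for k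
  proof -
    have "1 * 1 \<le> (1 + \<xi>) ^ z * (1 / \<xi>) ^ k" using assms by (intro mult_mono one_le_power) auto
    then show ?thesis by (simp add: X_def)
  qed
  have IH: "real (num_nodes z k) + 1 \<le> 2 * (real z + 1) * X k" for k using Suc[of k] by (simp add: X_def mult.assoc)
  have "(1 + \<xi>) ^ Suc z * (1 / \<xi>) ^ k = X k + \<xi> * X k" by (simp add: X_def algebra_simps)
  then have goal: "2 * (real (Suc z) + 1) * (1 + \<xi>) ^ Suc z * (1 / \<xi>) ^ k = 2 * (real z + 2) * (X k + \<xi> * X k)"
    by (simp add: mult.assoc)
  have pos: "0 \<le> \<xi> * X k" using assms X[of k] by simp
  show ?case
  proof (cases k)
    case 0
    have "real (num_nodes (Suc z) k) + 1 = real (num_nodes z k) + 2" using 0 by simp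
    also have "\<dots> \<le> 2 * (real z + 1) * X k + 1" using IH[of k] by simp
    also have "\<dots> \<le> 2 * (real z + 2) * X k" using X[of k] by (simp add: algebra_simps)
    also have "\<dots> \<le> 2 * (real z + 2) * (X k + \<xi> * X k)" using pos by (intro mult_left_mono) auto
    finally show ?thesis unfolding goal .
  next
    case (Suc k')
    have "real (num_nodes (Suc z) k) + 1 = (real (num_nodes z k) + 1) + (real (num_nodes z k') + 1)" using Suc by simp
    also have "\<dots> \<le> 2 * (real z + 1) * X k + 2 * (real z + 1) * X k'" using IH[of k] IH[of k'] by linarith
    also have "\<dots> \<le> 2 * (real z + 2) * (X k + X k')" using X[of k] X[of k'] by (simp add: algebra_simps)
    also have "X k' = \<xi> * X k" using assms Suc by (simp add: X_def)
    finally show ?thesis unfolding goal .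
  qed
qed

lemma assignments_props:
  "W \<in> set (assignments z k w) \<Longrightarrow> len W = len z + len w \<and> (\<forall>e\<in>set (spine W). e \<in> set (spine w) \<or> len e \<le> len k)"
proof (induction z arbitrary: k w)
  case (Node l z)
  from Node.prems consider "W \<in> set (assignments z k (Node k w))" | "k \<noteq> Leaf" "W \<in> set (assignments z (right k) (Node (right k) w))"
    by (auto split: if_splits)
  then show ?case
  proof cases
    case 1
    then show ?thesis using Node.IH(2)[OF 1] by auto
  next
    case 2
    have "len (right k) \<le> len k" by simp
    then show ?thesis using Node.IH(2)[OF 2(2)] by fastforce
  qed
qed simp

text \<open>An entry still has \<open>len (left x)\<close> leaves to place, and each leaf placed so
  far has left at most one sibling waiting. Hence at most \<open>Z - len (left x)\<close> entries
  lie below it.\<close>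

primrec stack_ok :: "nat \<Rightarrow> nat \<Rightarrow> bintree list \<Rightarrow> bool" where
  "stack_ok Z b [] = True"
| "stack_ok Z b (x # st) = (stack_ok Z b st \<and> size x \<le> b \<and> length st + len (left x) \<le> Z)"

lemma stack_ok_size: "stack_ok Z b st \<Longrightarrow> size (enc_list st) \<le> (Z + 1) * (b + 1)"
proof -
  assume ok: "stack_ok Z b st"
  have "length st \<le> Z + 1" using ok by (cases st) auto
  moreover have "size x \<le> b" if "x \<in> set st" for x using ok that by (induction st) auto
  ultimately show ?thesis using size_enc_list_le[of st b] mult_le_mono1 le_trans by metis
qed

text \<open>Depth-first search through the tree of partial assignments, with an explicit stack: its
  height, unlike the number of steps, is polynomial.\<close>

lemma computable_dfs:
  assumes Q: "computable B D' (\<lambda>z. enc_bool (Q (left z) (right z)))"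
    and D': "\<And>n e z k W. Node e (Node z k) \<in> D0 n \<Longrightarrow> W \<in> set (assignments z k Leaf) \<Longrightarrow> Node e W \<in> D' n"
    and N: "\<And>n e z k. Node e (Node z k) \<in> D0 n \<Longrightarrow>
      real (num_nodes (len z) (len k)) \<le> real ((size (Node e (Node z k)) + 2) ^ j) * N n"
    and D0: "\<And>n x. x \<in> D0 n \<Longrightarrow> \<exists>e z k. x = Node e (Node z k)"
    and B: "\<And>n. 1 \<le> B n" and N1: "\<And>n. 1 \<le> N n"
  shows "computable (\<lambda>n. B n * N n) D0 (\<lambda>x. enc_bool (\<exists>W\<in>set (assignments (left (right x)) (right (right x)) Leaf). Q (left x) W))"
proof -
  note oc1 = computable_left[OF _ B] computable_right[OF _ B] computable_Node[OF _ _ B] computable_id[OF B]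
  note oc2 = computable_const[OF B]
  let ?nd = "\<lambda>s. left (left s)" and ?rest = "\<lambda>s. right (left s)" and ?e = "\<lambda>s. left (right s)" and ?r = "\<lambda>s. right (right s)"
  let ?z = "\<lambda>s. left (?nd s)" and ?k = "\<lambda>s. left (right (?nd s))" and ?w = "\<lambda>s. right (right (?nd s))"
  \<comment> \<open>The state consists of the stack, the fixed data \<open>e\<close> and the answer
    so far. A stack entry \<open>Node z (Node k w)\<close> holds the leaves still to be placed, the
    current hub and the hubs of the leaves placed already.\<close>
  define step where "step s = (if ?z s = Leaf
     then Node (?rest s) (Node (?e s) (enc_bool (?r s \<noteq> Leaf \<or> Q (?e s) (?w s))))
     else Node (Node (Node (right (?z s)) (Node (?k s) (Node (?k s) (?w s))))
       (if ?k s \<noteq> Leaf then Node (Node (right (?z s)) (Node (right (?k s)) (Node (right (?k s)) (?w s)))) (?rest s)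
        else ?rest s)) (Node (?e s) (?r s)))" for s
  \<comment> \<open>\<open>Q\<close> is evaluated only for a complete assignment, so nothing is
    demanded of states whose top entry still has leaves to place.\<close>
  define D1 where "D1 n = {s. ?z s = Leaf \<longrightarrow> Node (?e s) (?w s) \<in> D' n}" for n
  have step: "computable B D1 step"
    unfolding step_def
  proof (rule computable_ite)
    have "poly (\<lambda>s. enc_bool (?z s = Leaf))" by (intro poly_isLeaf poly_basic)
    then show "computable B D1 (\<lambda>s. enc_bool (?z s = Leaf))" by (rule computable_poly_lift[OF _ B])
    let ?D = "\<lambda>n. {s \<in> D1 n. ?z s = Leaf}"
    have 1: "computable B ?D (\<lambda>s. enc_bool (?r s \<noteq> Leaf))" by (intro computable_nonLeaf oc1 B)
    have "computable B (\<lambda>n. {s \<in> ?D n. \<not> ?r s \<noteq> Leaf}) (\<lambda>s. (\<lambda>z. enc_bool (Q (left z) (right z))) (Node (?e s) (?w s)))"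
      by (rule computable_comp[OF _ Q _ B], intro oc1) (auto simp: D1_def)
    then have 2: "computable B (\<lambda>n. {s \<in> ?D n. \<not> ?r s \<noteq> Leaf}) (\<lambda>s. enc_bool (Q (?e s) (?w s)))" by simp
    show "computable B ?D (\<lambda>s. Node (?rest s) (Node (?e s) (enc_bool (?r s \<noteq> Leaf \<or> Q (?e s) (?w s)))))"
      by (intro oc1 computable_disj[OF 1 2 B])
    have "poly (\<lambda>s. (Node (Node (Node (right (?z s)) (Node (?k s) (Node (?k s) (?w s))))
       (if ?k s \<noteq> Leaf then Node (Node (right (?z s)) (Node (right (?k s)) (Node (right (?k s)) (?w s)))) (?rest s)
        else ?rest s)) (Node (?e s) (?r s))))"
      by (intro poly_basic poly_ite poly_nonLeaf)
    then show "computable B (\<lambda>n. {s \<in> D1 n. \<not> ?z s = Leaf}) (\<lambda>s. (Node (Node (Node (right (?z s)) (Node (?k s) (Node (?k s) (?w s))))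
       (if ?k s \<noteq> Leaf then Node (Node (right (?z s)) (Node (right (?k s)) (Node (right (?k s)) (?w s)))) (?rest s)
        else ?rest s)) (Node (?e s) (?r s))))" by (rule computable_poly_lift[OF _ B])
  qed (rule B)
  let ?res = "\<lambda>x. \<exists>W\<in>set (assignments (left (right x)) (right (right x)) Leaf). Q (left x) W"
  define E where "E n = {Node (Node (Node z (Node k Leaf)) Leaf) (Node e Leaf) | e z k. Node e (Node z k) \<in> D0 n}" for n
  define F where "F s = Node Leaf (Node (?e s) (enc_bool (?res (Node (?e s) (Node (?z s) (?k s))))))" for s
  have loop: "computable (\<lambda>n. B n * N n) E F"
  proof (rule computable_loop[OF step, where j = "j + 6"])
    fix n x0 assume "x0 \<in> E n"
    then obtain e z k where x0: "x0 = Node (Node (Node z (Node k Leaf)) Leaf) (Node e Leaf)" "Node e (Node z k) \<in> D0 n"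
      by (auto simp: E_def)
    define b where "b = size x0 + 2"
    have b: "2 \<le> b" by (simp add: b_def)
    define S where "S = b * b + b"
    have zb: "size z + size k + size e + 4 \<le> b" by (simp add: b_def x0)
    have lz: "len z + 1 \<le> b" "size k + 1 \<le> b" using zb len_le_size[of z] by linarith+
    \<comment> \<open>Placing a leaf extends \<open>w\<close> by a hub number of size at most
      \<open>size k\<close>, paid for by shortening \<open>left x\<close>.\<close>
    define sz where "sz x \<longleftrightarrow> size (left x) \<le> size z \<and> size (left (right x)) \<le> size k \<and>
      size (right (right x)) + len (left x) * (size k + 1) \<le> len z * (size k + 1)" for x
    define good where "good x \<longleftrightarrow> sz x \<and> (\<exists>z' k' w. x = Node z' (Node k' w) \<and> (\<forall>W\<in>set (assignments z' k' w). Node e W \<in> D' n))" for x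
    define hit where "hit x \<longleftrightarrow> (\<exists>W\<in>set (assignments (left x) (left (right x)) (right (right x))). Q e W)" for x
    define target where "target = ?res (Node e (Node z k))"
    \<comment> \<open>The last condition says that a solution exists iff one has been recorded
      already or one is still to be found below some stack entry.\<close>
    define I where "I = {Node (enc_list st) (Node e (enc_bool r)) | st r. stack_ok (len z) S st \<and> (\<forall>x\<in>set st. good x) \<and>
      (target \<longleftrightarrow> r \<or> (\<exists>x\<in>set st. hit x))}"
    \<comment> \<open>An iteration removes one node of the recursion tree and pushes its children,
      so the total size of the subtrees on the stack drops by one.\<close>
    define W where "W s = (\<Sum>x\<leftarrow>spine (left s). num_nodes (len (left x)) (len (left (right x))))" for s
    have szS: "size x \<le> S" if "good x" for x
    proof -
      from that obtain z' k' w where x: "x = Node z' (Node k' w)" "sz x" by (auto simp: good_def)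
      then have "size z' \<le> size z" "size k' \<le> size k" "size w \<le> len z * (size k + 1)" by (auto simp: sz_def)
      moreover have "len z * (size k + 1) \<le> b * b" using lz by (intro mult_le_mono) auto
      ultimately show ?thesis using zb unfolding x(1) S_def by simp
    qed
    show "\<exists>I W. x0 \<in> I \<and> real (W x0) \<le> real ((size x0 + 2) ^ (j + 6)) * N n \<and>
      (\<forall>x\<in>I. size x \<le> (size x0 + 2) ^ (j + 6) \<and>
        (if left x = Leaf then x = F x0 else x \<in> D1 n \<and> step x \<in> I \<and> W (step x) < (W x :: nat)))"
    proof (rule exI[of _ I], rule exI[of _ W], intro conjI ballI)
      have good0: "good (Node z (Node k Leaf))" using D'[OF x0(2)] by (auto simp: good_def sz_def)
      then show "x0 \<in> I" using szS[OF good0]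
        unfolding I_def mem_Collect_eq
        by (intro exI[of _ "[Node z (Node k Leaf)]"] exI[of _ False]) (auto simp: x0 hit_def target_def enc_bool_def)
      have "real (W x0) = real (num_nodes (len z) (len k))" by (simp add: W_def x0)
      also have "\<dots> \<le> real ((size (Node e (Node z k)) + 2) ^ j) * N n" by (rule N[OF x0(2)])
      also have "\<dots> \<le> real (b ^ (j + 6)) * N n"
      proof (rule real_bound_mult[OF order_refl _ N1])
        have "(size (Node e (Node z k)) + 2) ^ j \<le> b ^ j" by (rule power_mono) (auto simp: b_def x0)
        also have "\<dots> \<le> b ^ (j + 6)" using b by (intro power_increasing) auto
        finally show "(size (Node e (Node z k)) + 2) ^ j \<le> b ^ (j + 6)" .
      qed
      finally show "real (W x0) \<le> real ((size x0 + 2) ^ (j + 6)) * N n" by (simp add: b_def)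
      fix s assume "s \<in> I"
      then obtain st r where s: "s = Node (enc_list st) (Node e (enc_bool r))" "stack_ok (len z) S st"
        "\<And>x. x \<in> set st \<Longrightarrow> good x" "target \<longleftrightarrow> r \<or> (\<exists>x\<in>set st. hit x)" by (auto simp: I_def)
      show "size s \<le> (size x0 + 2) ^ (j + 6)"
      proof -
        have "2 * b \<le> b * b" using b by (rule mult_le_mono1)
        then have "S + 1 \<le> 2 * (b * b)" using b unfolding S_def by linarith
        also have "\<dots> \<le> b * (b * b)" using b by (rule mult_le_mono1)
        finally have "(len z + 1) * (S + 1) \<le> b * (b * (b * b))" using lz(1) by (rule mult_le_mono[rotated])
        then have "size (enc_list st) \<le> b ^ 4"
          using stack_ok_size[OF s(2)] by (simp add: numeral_eq_Suc)
        moreover have "size (enc_bool r) \<le> 1" by (simp add: enc_bool_def)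
        ultimately have "size s \<le> b ^ 4 + b ^ 1" using zb by (simp add: s(1))
        also have "\<dots> \<le> b ^ (4 + 1 + 1)" by (rule power_sum_le[OF b])
        also have "\<dots> \<le> b ^ (j + 6)" using b by (intro power_increasing) auto
        finally show ?thesis by (simp add: b_def)
      qed
      show "if left s = Leaf then s = F x0 else s \<in> D1 n \<and> step s \<in> I \<and> W (step s) < W s"
      proof (cases st)
        case Nil
        then show ?thesis using s(1,4) by (simp add: F_def x0 target_def)
      next
        case (Cons x st')
        have gx: "good x" using s(3) Cons by simp
        then obtain z' k' w where x: "x = Node z' (Node k' w)" "sz x" "\<And>W. W \<in> set (assignments z' k' w) \<Longrightarrow> Node e W \<in> D' n"
          unfolding good_def by blast
        have ok: "stack_ok (len z) S st'" "length st' + len z' \<le> len z" using s(2) by (auto simp: Cons x(1))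
        have rest: "\<And>x. x \<in> set st' \<Longrightarrow> good x" using s(3) Cons by simp
        show ?thesis
        proof (cases z')
          case Leaf
          have D: "s \<in> D1 n" using x(3)[of w] Leaf by (simp add: D1_def s(1) Cons x(1))
          have st: "step s = Node (enc_list st') (Node e (enc_bool (r \<or> Q e w)))"
            by (simp add: step_def s(1) Cons x(1) Leaf)
          have "target \<longleftrightarrow> (r \<or> Q e w) \<or> (\<exists>x\<in>set st'. hit x)"
            using s(4) by (simp add: Cons hit_def x(1) Leaf)
          then have "step s \<in> I" unfolding I_def st using ok rest by blast
          moreover have "W (step s) < W s"
            unfolding W_def st unfolding s(1) Cons x(1) Leaf by simp
          ultimately show ?thesis using D by (simp add: s(1) Cons x(1))
        next
          case (Node l z'')
          have D: "s \<in> D1 n" by (simp add: D1_def s(1) Cons x(1) Node)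
          define x1 where "x1 = Node z'' (Node k' (Node k' w))"
          define x2 where "x2 = Node z'' (Node (right k') (Node (right k') w))"
          define new where "new = (if k' \<noteq> Leaf then [x1, x2] else [x1])"
          have st: "step s = Node (enc_list (new @ st')) (Node e (enc_bool r))"
            by (simp add: step_def s(1) Cons x(1) Node x1_def x2_def new_def)
          have g: "good y" if "y \<in> set new" for y
          proof -
            have "sz x1" "sz x2" using x(2) size_right[of k'] by (auto simp: sz_def x(1) x1_def x2_def Node)
            moreover have "\<forall>W\<in>set (assignments z'' k' (Node k' w)). Node e W \<in> D' n" using x(3) by (simp add: Node)
            moreover have "\<forall>W\<in>set (assignments z'' (right k') (Node (right k') w)). Node e W \<in> D' n" if "k' \<noteq> Leaf"
              using x(3) that by (simp add: Node)
            ultimately show ?thesis using that by (auto simp: good_def x1_def x2_def new_def split: if_splits)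
          qed
          have "stack_ok (len z) S (new @ st')"
          proof -
            have "\<forall>y\<in>set new. size y \<le> S" using szS[OF g] by blast
            then show ?thesis using ok unfolding new_def Node by (cases "k' = Leaf") (auto simp: x1_def x2_def)
          qed
          moreover have "hit x \<longleftrightarrow> (\<exists>y\<in>set new. hit y)"
            by (auto simp: hit_def x(1) Node new_def x1_def x2_def)
          then have "target \<longleftrightarrow> r \<or> (\<exists>x\<in>set (new @ st'). hit x)" using s(4) by (auto simp: Cons)
          moreover have "\<forall>x\<in>set (new @ st'). good x" using g rest by auto
          ultimately have "step s \<in> I" unfolding I_def st by blast
          moreover have "W (step s) < W s"
            unfolding W_def st unfolding s(1) Cons x(1) Node by (auto simp: new_def x1_def x2_def)
          ultimately show ?thesis using D by (simp add: s(1) Cons x(1))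
        qed
      qed
    qed
  qed (rule B N1)+
  have BN: "1 \<le> B n * N n" for n using B[of n] N1[of n] mult_mono[of 1 "B n" 1 "N n"] by simp
  note oc3 = computable_left[OF _ BN] computable_right[OF _ BN] computable_Node[OF _ _ BN] computable_id[OF BN] computable_const[OF BN]
  have "computable (\<lambda>n. B n * N n) D0 (\<lambda>x. F (Node (Node (Node (left (right x)) (Node (right (right x)) Leaf)) Leaf) (Node (left x) Leaf)))"
    by (rule computable_comp[OF _ loop _ BN], intro oc3) (use D0 in \<open>fastforce simp: E_def\<close>)
  then have "computable (\<lambda>n. B n * N n) D0 (\<lambda>x. right (right (F (Node (Node (Node (left (right x)) (Node (right (right x)) Leaf)) Leaf) (Node (left x) Leaf)))))"
    by (intro oc3)
  then show ?thesis by (simp add: F_def)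
qed

section \<open>Subroutines\<close>

text \<open>A given program reads and writes variable 0 and relies on blank scratch variables. To
  run it as a subroutine at \<open>a\<close>, all its variables are renamed upwards by
  \<open>a\<close>.\<close>

primrec shift_exp :: "nat \<Rightarrow> exp \<Rightarrow> exp" where
  "shift_exp a (Var x) = Var (x + a)"
| "shift_exp a LeafE = LeafE"
| "shift_exp a (NodeE d e) = NodeE (shift_exp a d) (shift_exp a e)"
| "shift_exp a (LeftE e) = LeftE (shift_exp a e)"
| "shift_exp a (RightE e) = RightE (shift_exp a e)"

primrec shift :: "nat \<Rightarrow> com \<Rightarrow> com" where
  "shift a (Assign x e) = Assign (x + a) (shift_exp a e)"
| "shift a (Seq c d) = Seq (shift a c) (shift a d)"
| "shift a (If e c d) = If (shift_exp a e) (shift a c) (shift a d)"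
| "shift a (While e c) = While (shift_exp a e) (shift a c)"

primrec vars_exp :: "exp \<Rightarrow> nat" where
  "vars_exp (Var x) = Suc x"
| "vars_exp LeafE = 0"
| "vars_exp (NodeE d e) = max (vars_exp d) (vars_exp e)"
| "vars_exp (LeftE e) = vars_exp e"
| "vars_exp (RightE e) = vars_exp e"

primrec vars :: "com \<Rightarrow> nat" where
  "vars (Assign x e) = max (Suc x) (vars_exp e)"
| "vars (Seq c d) = max (vars c) (vars d)"
| "vars (If e c d) = max (vars_exp e) (max (vars c) (vars d))"
| "vars (While e c) = max (vars_exp e) (vars c)"

lemma cost_shift_exp[simp]: "cost_exp (shift_exp a e) = cost_exp e"
  by (induction e) auto

lemma eval_shift_exp: "vars_exp e \<le> m \<Longrightarrow> (\<And>v. v < m \<Longrightarrow> r (v + a) = s v) \<Longrightarrow> eval_exp (shift_exp a e) r = eval_exp e s"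
  by (induction e) auto

lemma exec_shift:
  assumes "exec p s t s'" "vars p \<le> m" "\<forall>v<m. r (v + a) = s v"
  shows "\<exists>r'. exec (shift a p) r t r' \<and> (\<forall>v<m. r' (v + a) = s' v) \<and> (\<forall>v<a. r' v = r v)"
  using assms
proof (induction arbitrary: r rule: exec.induct)
  case (Assign x e s)
  have "eval_exp (shift_exp a e) r = eval_exp e s" by (rule eval_shift_exp[where m = m]) (use Assign in auto)
  then have "exec (shift a (Assign x e)) r (cost_exp e + 1) (r(x + a := eval_exp e s))"
    using exec.Assign[of "x + a" "shift_exp a e" r] by simp
  then show ?case by (intro exI conjI) (use Assign in auto)
next
  case (Seq c1 s1 t1 s2 c2 t2 s3)
  obtain r' where 1: "exec (shift a c1) r t1 r'" "\<forall>v<m. r' (v + a) = s2 v" "\<forall>v<a. r' v = r v"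
    using Seq.IH(1)[of r] Seq.prems by auto
  obtain r'' where 2: "exec (shift a c2) r' t2 r''" "\<forall>v<m. r'' (v + a) = s3 v" "\<forall>v<a. r'' v = r' v"
    using Seq.IH(2)[of r'] Seq.prems 1 by auto
  show ?case unfolding shift.simps using exec.Seq[OF 1(1) 2(1)] 1 2 by (intro exI[of _ r'']) auto
next
  case (IfTrue e s c1 t s' c2)
  have e: "eval_exp (shift_exp a e) r = eval_exp e s" by (rule eval_shift_exp[where m = m]) (use IfTrue in auto)
  obtain r' where 1: "exec (shift a c1) r t r'" "\<forall>v<m. r' (v + a) = s' v" "\<forall>v<a. r' v = r v"
    using IfTrue.IH[of r] IfTrue.prems by auto
  show ?case using exec.IfTrue[OF _ 1(1), of "shift_exp a e" "shift a c2"] e IfTrue.hyps(1) 1 by auto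
next
  case (IfFalse e s c2 t s' c1)
  have e: "eval_exp (shift_exp a e) r = eval_exp e s" by (rule eval_shift_exp[where m = m]) (use IfFalse in auto)
  obtain r' where 1: "exec (shift a c2) r t r'" "\<forall>v<m. r' (v + a) = s' v" "\<forall>v<a. r' v = r v"
    using IfFalse.IH[of r] IfFalse.prems by auto
  show ?case using exec.IfFalse[OF _ 1(1), of "shift_exp a e" "shift a c1"] e IfFalse.hyps(1) 1 by auto
next
  case (WhileFalse e s c)
  have e: "eval_exp (shift_exp a e) r = eval_exp e s" by (rule eval_shift_exp[where m = m]) (use WhileFalse in auto)
  show ?case using exec.WhileFalse[of "shift_exp a e" r "shift a c"] e WhileFalse by auto
next
  case (WhileTrue e s1 c t1 s2 t2 s3)
  have e: "eval_exp (shift_exp a e) r = eval_exp e s1" by (rule eval_shift_exp[where m = m]) (use WhileTrue in auto)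
  obtain r' where 1: "exec (shift a c) r t1 r'" "\<forall>v<m. r' (v + a) = s2 v" "\<forall>v<a. r' v = r v"
    using WhileTrue.IH(1)[of r] WhileTrue.prems by auto
  obtain r'' where 2: "exec (While (shift_exp a e) (shift a c)) r' t2 r''" "\<forall>v<m. r'' (v + a) = s3 v" "\<forall>v<a. r'' v = r' v"
    using WhileTrue.IH(2)[of r'] WhileTrue.prems 1 by auto
  have ne: "eval_exp (shift_exp a e) r \<noteq> Leaf" using e WhileTrue.hyps(1) by simp
  show ?case unfolding shift.simps using exec.WhileTrue[OF ne 1(1) 2(1)] 1 2 by (intro exI[of _ r'']) auto
qed

text \<open>The variables above \<open>a\<close> may hold leftovers of earlier computations, whereas
  \<open>runs\<close> starts with \<open>Leaf\<close> in them. The base case is an assignment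
  without effect, in place of a skip.\<close>

primrec clear :: "nat \<Rightarrow> nat \<Rightarrow> com" where
  "clear a 0 = Assign a (Var a)"
| "clear a (Suc k) = Seq (clear a k) (Assign (a + Suc k) LeafE)"

lemma exec_clear: "exec (clear a k) s (2 + 3 * k) (\<lambda>v. if a < v \<and> v \<le> a + k then Leaf else s v)"
proof (induction k)
  case 0
  have "(\<lambda>v. if a < v \<and> v \<le> a + 0 then Leaf else s v) = s(a := eval_exp (Var a) s)"
    by (rule ext) auto
  then show ?case using exec.Assign[of a "Var a" s] by (simp add: numeral_2_eq_2)
next
  case (Suc k)
  let ?s = "\<lambda>k v. if a < v \<and> v \<le> a + k then Leaf else s v"
  have "?s (Suc k) = (?s k)(a + Suc k := eval_exp LeafE (?s k))" by (rule ext) auto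
  moreover have "2 + 3 * k + (cost_exp LeafE + 1) + 1 = 2 + 3 * Suc k" by simp
  ultimately show ?case unfolding clear.simps using exec.Seq[OF Suc exec.Assign[of "a + Suc k" LeafE "?s k"]] by metis
qed

text \<open>Execution is deterministic, so the answer is a function \<open>h\<close> of the
  encoding, even if instances shared an encoding. The program is trusted on instances only; among
  these, \<open>D n\<close> selects those whose time factor \<open>F i\<close> is covered by
  \<open>B n\<close>. Answers of size at most 1 meet the demand for outputs of polynomial
  size.\<close>

lemma computable_oracle:
  fixes c d :: nat
  assumes p: "\<And>i. i \<in> I \<Longrightarrow> \<exists>t. runs p (enc i) t (g i) \<and> real t \<le> real c * real (size (enc i) + 1) ^ d * F i"
    and g: "\<And>i. i \<in> I \<Longrightarrow> size (g i) \<le> 1"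
    and B: "\<And>n. 1 \<le> B n" and D: "\<And>n i. i \<in> D n \<Longrightarrow> i \<in> I \<and> F i \<le> B n"
  shows "\<exists>h. (\<forall>i\<in>I. h (enc i) = g i) \<and> computable B (\<lambda>n. enc ` D n) h"
proof -
  define h where "h x = (THE y. \<exists>t. runs p x t y)" for x
  have h: "h (enc i) = g i" if "i \<in> I" for i
    unfolding h_def
  proof (rule the_equality)
    show "\<exists>t. runs p (enc i) t (g i)" using p[OF that] by blast
    then show "y = g i" if "\<exists>t. runs p (enc i) t y" for y
      using that unfolding runs_def by (metis exec_deterministic)
  qed
  have "computable B (\<lambda>n. enc ` D n) h"
  proof (rule computableI)
    fix a
    define m where "m = vars p"
    define M where "M = 3 * m + 3"
    define K where "K = (c + d) + M + 1"
    have "computes_at a K B (\<lambda>n. enc ` D n) (Seq (clear a m) (shift a p)) h"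
    proof (rule computes_atI)
      fix n s assume "s a \<in> enc ` D n"
      then obtain i where i: "s a = enc i" "i \<in> I" "F i \<le> B n" using D by auto
      obtain t s' where t: "exec p ((\<lambda>_. Leaf)(0 := enc i)) t s'" "s' 0 = g i"
          "real t \<le> real c * real (size (enc i) + 1) ^ d * F i"
        using p[OF i(2)] unfolding runs_def by blast
      define r where "r = (\<lambda>v. if a < v \<and> v \<le> a + m then Leaf else s v)"
      have "\<forall>v<m. r (v + a) = ((\<lambda>_. Leaf)(0 := enc i)) v" by (auto simp: r_def i(1))
      with exec_shift[OF t(1), of m r a] obtain r' where r': "exec (shift a p) r t r'"
          "\<forall>v<m. r' (v + a) = s' v" "\<forall>v<a. r' v = r v" by (auto simp: m_def)
      have ra: "r' a = g i"
      proof (cases "m = 0")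
        case False
        then show ?thesis using r'(2) t(2) by (metis add_0 gr0I)
      next
        case True
        \<comment> \<open>Every program contains an assignment, so variable 0 is among those related
          to the original run.\<close>
        have "vars c \<noteq> 0" for c by (induction c) auto
        from this[of p] True show ?thesis by (simp add: m_def)
      qed
      have ex: "exec (Seq (clear a m) (shift a p)) s (2 + 3 * m + t + 1) r'"
        using exec.Seq[OF exec_clear[of a m s] r'(1)[unfolded r_def]] by simp
      define b where "b = size (s a) + 2"
      have b: "2 \<le> b" by (simp add: b_def)
      have "c * (size (enc i) + 1) ^ d \<le> b ^ c * b ^ d"
        using const_le_power[OF b, of c] by (intro mult_le_mono power_mono) (auto simp: b_def i(1))
      then have cd: "c * (size (enc i) + 1) ^ d \<le> b ^ (c + d)" by (simp only: power_add)
      have "b ^ (c + d) + M \<le> b ^ (c + d) + b ^ M" using const_le_power[OF b, of M] by simp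
      also have "\<dots> \<le> b ^ K" unfolding K_def by (rule power_sum_le[OF b])
      finally have K: "b ^ (c + d) + M \<le> b ^ K" .
      have "real t \<le> real (c * (size (enc i) + 1) ^ d) * F i" using t(3) by simp
      also have "\<dots> \<le> real (c * (size (enc i) + 1) ^ d) * B n" using i(3) by (intro mult_left_mono) auto
      finally have "real t \<le> real (b ^ (c + d)) * B n" by (rule real_bound_mult[OF _ cd B])
      moreover have "real M \<le> real M * B n" using mult_left_mono[OF B[of n], of "real M"] by simp
      ultimately have "real (2 + 3 * m + t + 1) \<le> real (b ^ (c + d) + M) * B n"
        by (simp add: M_def algebra_simps)
      then have T: "real (2 + 3 * m + t + 1) \<le> real (b ^ K) * B n" by (rule real_bound_mult[OF _ K B])
      have "1 \<le> b ^ K" using b by simp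
      then have "size (h (s a)) \<le> b ^ K" using g[OF i(2)] h[OF i(2)] i(1) by simp
      moreover have "\<forall>v<a. r' v = s v" using r'(3) by (auto simp: r_def)
      moreover have "r' a = h (s a)" using ra h[OF i(2)] i(1) by simp
      ultimately show "\<exists>t s'. exec (Seq (clear a m) (shift a p)) s t s' \<and> s' a = h (s a) \<and> (\<forall>v<a. s' v = s v) \<and>
        real t \<le> real ((size (s a) + 2) ^ K) * B n \<and> size (h (s a)) \<le> (size (s a) + 2) ^ K"
        unfolding b_def[symmetric] using ex T by blast
    qed
    then show "\<exists>p k. computes_at a k B (\<lambda>n. enc ` D n) p h" by blast
  qed
  then show ?thesis using h by blast
qed

section \<open>Deciding whether few sets suffice\<close>

text \<open>A guess consists of single sets \<open>K\<close>, of bounds \<open>y\<close> and \<open>a\<close>, and of a pattern \<open>W\<close>. The elements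
  left uncovered by \<open>K\<close> have to be covered by \<open>a + 1\<close> groups of \<open>q\<close> sets each, where every set of
  a group contains at most \<open>y\<close> of these elements.\<close>

definition uncovered_list :: "bintree \<Rightarrow> bintree \<Rightarrow> bintree" where
  "uncovered_list n K = tfilter (\<lambda>i. \<not> (\<exists>S\<in>set (spine K). tbit S (len i))) (tupt n)"

definition small_sets :: "bintree \<Rightarrow> bintree \<Rightarrow> bintree \<Rightarrow> bintree \<Rightarrow> bintree" where
  "small_sets n K y Vs = tfilter (\<lambda>S. len (tfilter (\<lambda>i. tbit S (len i)) (uncovered_list n K)) \<le> len y) Vs"

text \<open>Bit 0 stands for the root, so element \<open>i\<close>, counted from 0, sits at bit
  \<open>i + 1\<close>. Elements covered by \<open>K\<close> are removed, so that the sizes tested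
  in \<open>small_sets\<close> bound the degree of the group vertex.\<close>

definition group_vector :: "bintree \<Rightarrow> bintree \<Rightarrow> bintree \<Rightarrow> bintree" where
  "group_vector n K g = Node tt (tmap (\<lambda>i. enc_bool ((\<exists>S\<in>set (spine g). tbit S (len i)) \<and> \<not> (\<exists>S\<in>set (spine K). tbit S (len i)))) (tupt n))"

text \<open>A group has at most \<open>q * len y\<close> elements besides the root. Together with at
  least one hub, \<open>q * len y + 1\<close> pendants give the root of the pattern more neighbours
  than any set vertex of the host has.\<close>

definition pendants :: "nat \<Rightarrow> bintree \<Rightarrow> bintree" where
  "pendants q y = Node Leaf (tmul q y)"

definition pendant_vectors :: "bintree \<Rightarrow> bintree" where
  "pendant_vectors X = tmap (\<lambda>_. Node tt Leaf) X"

text \<open>The host gets \<open>len n\<close> pendant vertices more than the pattern. They can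
  receive the hubs without leaves, as \<open>decide\<close> uses at most \<open>len n\<close>
  hubs.\<close>

definition host_matrix :: "nat \<Rightarrow> bintree \<Rightarrow> bintree \<Rightarrow> bintree \<Rightarrow> bintree \<Rightarrow> bintree" where
  "host_matrix q n K y Vs = incidence_matrix (Node Leaf n) (tapp (tmap (group_vector n K) (tuples q (small_sets n K y Vs))) (pendant_vectors (tapp (pendants q y) n)))"

definition hub_vector :: "bintree \<Rightarrow> bintree \<Rightarrow> bintree" where
  "hub_vector W j = Node tt (tmap (\<lambda>e. enc_bool (len e = len j)) W)"

definition pattern_matrix :: "bintree \<Rightarrow> bintree \<Rightarrow> bintree \<Rightarrow> bintree" where
  "pattern_matrix a X W = incidence_matrix (Node Leaf W) (tapp (tmap (hub_vector W) (tupt (Node Leaf a))) (pendant_vectors X))"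

lemma poly_uncovered_list: "poly f \<Longrightarrow> poly g \<Longrightarrow> poly (\<lambda>x. uncovered_list (f x) (g x))"
  by (rule poly_comp2[where F = uncovered_list]) (unfold uncovered_list_def, intro poly_rules)

lemma poly_pendant_vectors: "poly f \<Longrightarrow> poly (\<lambda>x. pendant_vectors (f x))"
  unfolding pendant_vectors_def by (intro poly_rules)

lemma poly_pendants: "poly f \<Longrightarrow> poly (\<lambda>x. pendants q (f x))"
  unfolding pendants_def by (intro poly_rules)

lemma poly_small_sets:
  assumes "poly n" "poly K" "poly y" "poly Vs"
  shows "poly (\<lambda>x. small_sets (n x) (K x) (y x) (Vs x))"
proof -
  have "poly (\<lambda>x. small_sets (left (left x)) (right (left x)) (left (right x)) (right (right x)))"
    unfolding small_sets_def by (intro poly_uncovered_list poly_rules)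
  from poly_comp2[OF this poly_Node[OF assms(1,2)] poly_Node[OF assms(3,4)]]
  show ?thesis by simp
qed

lemma poly_host_matrix:
  assumes "poly n" "poly K" "poly y" "poly Vs"
  shows "poly (\<lambda>x. host_matrix q (n x) (K x) (y x) (Vs x))"
proof -
  have "poly (\<lambda>x. host_matrix q (left (left x)) (right (left x)) (left (right x)) (right (right x)))"
    unfolding host_matrix_def group_vector_def by (intro poly_incidence_matrix poly_small_sets poly_pendants poly_pendant_vectors poly_tuples poly_rules)
  from poly_comp2[OF this poly_Node[OF assms(1,2)] poly_Node[OF assms(3,4)]]
  show ?thesis by simp
qed

lemma poly_pattern_matrix:
  assumes "poly a" "poly X" "poly W"
  shows "poly (\<lambda>x. pattern_matrix (a x) (X x) (W x))"
proof -
  have "poly (\<lambda>x. pattern_matrix (left x) (left (right x)) (right (right x)))"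
    unfolding pattern_matrix_def hub_vector_def by (intro poly_incidence_matrix poly_pendant_vectors poly_rules)
  from poly_comp2[OF this[folded comp_def] assms(1) poly_Node[OF assms(2,3)]]
  show ?thesis by simp
qed

lemma tbit_Node: "tbit (Node x v) k \<longleftrightarrow> (case k of 0 \<Rightarrow> x \<noteq> Leaf | Suc i \<Rightarrow> tbit v i)"
  by (cases k) (auto simp: tbit_def)

lemma tbit_tmap: "tbit (tmap f v) k \<longleftrightarrow> k < len v \<and> f (spine v ! k) \<noteq> Leaf"
  by (auto simp: tbit_def)

lemma bits_hub_vector: "bits (hub_vector W j) = hub (len W) (\<lambda>i. len (spine W ! i)) (len j)"
proof (rule set_eqI)
  fix k show "k \<in> bits (hub_vector W j) \<longleftrightarrow> k \<in> hub (len W) (\<lambda>i. len (spine W ! i)) (len j)"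
    by (cases k) (auto simp: bits_def hub_vector_def hub_def tbit_Node tbit_tmap)
qed

lemma bits_pendant: "bits (Node tt Leaf) = {0}"
  by (auto simp: bits_def tbit_def)

lemma bits_group_vector: "bits (group_vector n K g) =
    insert 0 (Suc ` {i. i < len n \<and> (\<exists>S\<in>set (spine g). tbit S i) \<and> \<not> (\<exists>S\<in>set (spine K). tbit S i)})"
    (is "_ = insert 0 (Suc ` ?A)")
proof (rule set_eqI)
  fix k show "k \<in> bits (group_vector n K g) \<longleftrightarrow> k \<in> insert 0 (Suc ` ?A)"
    by (cases k) (auto simp: bits_def group_vector_def tbit_Node tbit_tmap image_def)
qed

lemma bits_pendant_vectors: "map bits (spine (pendant_vectors X)) = replicate (len X) {0}"
  by (simp add: pendant_vectors_def bits_pendant map_replicate_const comp_def)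

lemma pattern_matrix_pattern: "pattern_matrix a X W = enc_graph (pattern (len W) (\<lambda>i. len (spine W ! i)) (Suc (len a)) (len X))"
proof -
  let ?vs = "tapp (tmap (hub_vector W) (tupt (Node Leaf a))) (pendant_vectors X)"
  have eq: "map bits (spine ?vs) = map (hub (len W) (\<lambda>i. len (spine W ! i))) [0..<Suc (len a)] @ replicate (len X) {0}"
    by (simp add: bits_pendant_vectors bits_hub_vector comp_def del: upt_Suc)
  show ?thesis unfolding pattern_matrix_def pattern_def enc_graph_igraph[symmetric] eq by simp
qed

definition groups :: "nat \<Rightarrow> bintree \<Rightarrow> bintree \<Rightarrow> bintree \<Rightarrow> bintree \<Rightarrow> nat set list" where
  "groups q n K y Vs = map (\<lambda>g. bits (group_vector n K g)) (spine (tuples q (small_sets n K y Vs)))"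

lemma host_matrix_host: "host_matrix q n K y Vs = enc_graph (host (len n) (groups q n K y Vs) (len (pendants q y) + len n))"
  unfolding host_matrix_def host_def enc_graph_igraph[symmetric] groups_def
  by (simp add: bits_pendant_vectors comp_def)

lemma instance_host_pattern:
  assumes "\<And>i. i < z \<Longrightarrow> w i < a"
  shows "(host n gs c, pattern z w a x) \<in> ktree_instances"
  using undirected_tree_pattern[of z w a x, OF assms] pair_graph_igraph
  by (simp add: ktree_instances_def host_def pattern_def)

text \<open>The test on \<open>tmul p y\<close> replaces a division: it admits only \<open>y\<close>
  with \<open>n \<le> p * y \<le> n + p\<close>. There are \<open>len a + 1\<close> groups, hence
  the form \<open>Node Leaf a\<close> in the test on the total number of sets. All these tests
  precede the search, whose time bound relies on them.\<close>

definition decide :: "(bintree \<Rightarrow> bintree) \<Rightarrow> nat \<Rightarrow> nat \<Rightarrow> nat \<Rightarrow> bintree \<Rightarrow> bintree \<Rightarrow> bintree \<Rightarrow> bool" where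
  "decide orc R q p n Vs t \<longleftrightarrow> (\<exists>K\<in>set (spine (tuples R Vs)). len K \<le> len t \<and>
     (uncovered_list n K = Leaf \<or>
      (\<exists>y\<in>set (spine (tupt (Node Leaf n))). (len n \<le> len (tmul p y) \<and> len (tmul p y) \<le> len (tapp n (enc_nat p))) \<and>
       (\<exists>a\<in>set (spine (tupt n)). len (tapp K (tmul q (Node Leaf a))) \<le> len t \<and>
         (\<exists>W\<in>set (assignments (uncovered_list n K) a Leaf). orc (Node (host_matrix q n K y Vs) (pattern_matrix a (pendants q y) W)) \<noteq> Leaf)))))"

text \<open>\<open>n\<close> leaves, \<open>n div q\<close> hubs, the pendants for the largest
  admissible \<open>y\<close>, and two more vertices: the root and the additional pendant.\<close>

definition pattern_size_bound :: "nat \<Rightarrow> nat \<Rightarrow> nat \<Rightarrow> nat" where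
  "pattern_size_bound q p n = n + n div q + q * ((n + p) div p) + 2"

text \<open>For constant \<open>R\<close>, \<open>p\<close> and \<open>q\<close> there are
  polynomially many choices of \<open>K\<close>, \<open>y\<close> and \<open>a\<close>. The
  exponential factor comes from the search through the assignments, multiplied by the cost
  \<open>B\<close> of one call of the oracle.\<close>

lemma computable_decide:
  assumes orc: "computable B (\<lambda>n. enc_ktree ` {i \<in> ktree_instances. card (pverts (snd i)) \<le> pattern_size_bound q p n}) orc"
    and B: "\<And>n. 1 \<le> B n" and \<xi>: "0 < \<xi>" "\<xi> \<le> 1" and pq: "0 < p" "0 < q"
  shows "computable (\<lambda>n. B n * ((1 + \<xi>) ^ n * (1 / \<xi>) ^ (n div q))) (\<lambda>n. {x. len (left x) = n \<and> len (right (right x)) \<le> n})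
    (\<lambda>x. enc_bool (decide orc R q p (left x) (left (right x)) (right (right x))))"
proof -
  define N where "N n = (1 + \<xi>) ^ n * (1 / \<xi>) ^ (n div q)" for n
  have N1: "1 \<le> N n" for n
    using mult_mono[of 1 "(1 + \<xi>) ^ n" 1 "(1 / \<xi>) ^ (n div q)"] \<xi> by (simp add: N_def one_le_power)
  have BN: "1 \<le> B n * N n" for n using B[of n] N1[of n] mult_mono[of 1 "B n" 1 "N n"] by simp
  let ?x = "\<lambda>z. left (left (left z))" and ?K = "\<lambda>z. right (left (left z))" and ?y = "\<lambda>z. right (left z)" and ?a = "right"
  let ?n = "\<lambda>z. left (?x z)" and ?Vs = "\<lambda>z. left (right (?x z))"
  define Q where "Q e W \<longleftrightarrow> orc (Node (left e) (pattern_matrix (left (right e)) (right (right e)) W)) \<noteq> Leaf" for e W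
  \<comment> \<open>The host does not depend on the assignment, so its matrix is built once per
    guess and handed to the search as fixed data.\<close>
  define prep where "prep z = Node (Node (host_matrix q (?n z) (?K z) (?y z) (?Vs z)) (Node (?a z) (pendants q (?y z)))) (Node (uncovered_list (?n z) (?K z)) (?a z))" for z
  \<comment> \<open>What the guards of \<open>decide\<close> guarantee when the search
    starts.\<close>
  define D3 where "D3 n = {z. len (?n z) = n \<and> p * len (?y z) \<le> n + p \<and> q * Suc (len (?a z)) \<le> n}" for n
  define D' where "D' n = {z. Node (left (left z)) (pattern_matrix (left (right (left z))) (right (right (left z))) (right z)) \<in>
    enc_ktree ` {i \<in> ktree_instances. card (pverts (snd i)) \<le> pattern_size_bound q p n}}" for n
  have Q: "computable B D' (\<lambda>z. enc_bool (Q (left z) (right z)))"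
    unfolding Q_def
  proof (rule computable_nonLeaf[OF _ B], rule computable_comp[OF _ orc _ B])
    show "computable B D' (\<lambda>z. Node (left (left z)) (pattern_matrix (left (right (left z))) (right (right (left z))) (right z)))"
      by (rule computable_poly_lift[OF _ B]) (intro poly_pattern_matrix poly_rules)
  qed (simp add: D'_def)
  have lenU: "len (uncovered_list n K) \<le> len n" for n K
    unfolding uncovered_list_def by (simp add: order.trans[OF length_filter_le])
  have qdiv: "Suc (len (?a z)) \<le> n div q" if "z \<in> D3 n" for n z
    using that pq div_le_mono[of "q * Suc (len (?a z))" n q] by (simp add: D3_def)
  have pdiv: "len (?y z) \<le> (n + p) div p" if "z \<in> D3 n" for n z
    using that pq div_le_mono[of "p * len (?y z)" "n + p" p] by (simp add: D3_def)
  have dfs: "computable (\<lambda>n. B n * N n) (\<lambda>n. prep ` D3 n) (\<lambda>x. enc_bool (\<exists>W\<in>set (assignments (left (right x)) (right (right x)) Leaf). Q (left x) W))"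
  proof (rule computable_dfs[OF Q _ _ _ B N1, where j = 2])
    fix n e z k
    assume "Node e (Node z k) \<in> prep ` D3 n"
    then obtain d where d: "d \<in> D3 n" "e = Node (host_matrix q (?n d) (?K d) (?y d) (?Vs d)) (Node (?a d) (pendants q (?y d)))"
      "z = uncovered_list (?n d) (?K d)" "k = ?a d" by (auto simp: prep_def)
    have z: "len z \<le> n" using lenU[of "?n d" "?K d"] d by (simp add: D3_def)
    {
      fix W assume W: "W \<in> set (assignments z k Leaf)"
      have ids: "len (spine W ! i) < Suc (len (?a d))" if "i < len W" for i
        using assignments_props[OF W] nth_mem[OF that] d(4) by (auto simp: less_Suc_eq_le)
      let ?G = "host (len (?n d)) (groups q (?n d) (?K d) (?y d) (?Vs d)) (len (pendants q (?y d)) + len (?n d))"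
      let ?T = "pattern (len W) (\<lambda>i. len (spine W ! i)) (Suc (len (?a d))) (len (pendants q (?y d)))"
      have "card (pverts ?T) = Suc (len W) + (Suc (len (?a d)) + (1 + q * len (?y d)))"
        by (simp add: pattern_def pendants_def)
      moreover have "len W \<le> n" using assignments_props[OF W] z by simp
      moreover have "q * len (?y d) \<le> q * ((n + p) div p)" using pdiv[OF d(1)] by simp
      ultimately have "card (pverts ?T) \<le> pattern_size_bound q p n" using qdiv[OF d(1)] unfolding pattern_size_bound_def by linarith
      then have "enc_ktree (?G, ?T) \<in> enc_ktree ` {i \<in> ktree_instances. card (pverts (snd i)) \<le> pattern_size_bound q p n}"
        using instance_host_pattern[OF ids] by auto
      then show "Node e W \<in> D' n" by (simp add: D'_def d(2) host_matrix_host pattern_matrix_pattern enc_ktree_def)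
    }
    have "real (num_nodes (len z) (len k)) \<le> 2 * (real (len z) + 1) * ((1 + \<xi>) ^ len z * (1 / \<xi>) ^ len k)"
      using num_nodes_bound[OF \<xi>, of "len z" "len k"] by (simp add: mult.assoc)
    also have "\<dots> \<le> 2 * (real (len z) + 1) * N n"
    proof (rule mult_left_mono)
      have "len k \<le> n div q" using qdiv[OF d(1)] d(4) by simp
      then show "(1 + \<xi>) ^ len z * (1 / \<xi>) ^ len k \<le> N n"
        unfolding N_def using z \<xi> by (intro mult_mono power_increasing) auto
    qed simp
    also have "\<dots> \<le> real ((size (Node e (Node z k)) + 2) ^ 2) * N n"
    proof (rule mult_right_mono)
      have "2 * (len z + 1) \<le> (size (Node e (Node z k)) + 2) * (size (Node e (Node z k)) + 2)"
        using len_le_size[of z] by (intro mult_le_mono) auto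
      then have "real (2 * (len z + 1)) \<le> real ((size (Node e (Node z k)) + 2) ^ 2)"
        unfolding of_nat_le_iff power2_eq_square .
      then show "2 * (real (len z) + 1) \<le> real ((size (Node e (Node z k)) + 2) ^ 2)" by simp
    qed (use N1[of n] in simp)
    finally show "real (num_nodes (len z) (len k)) \<le> real ((size (Node e (Node z k)) + 2) ^ 2) * N n" .
  qed (auto simp: prep_def)
  have "computable (\<lambda>n. B n * N n) D3 (\<lambda>z. (\<lambda>x. enc_bool (\<exists>W\<in>set (assignments (left (right x)) (right (right x)) Leaf). Q (left x) W)) (prep z))"
  proof (rule computable_comp[OF _ dfs _ BN])
    show "computable (\<lambda>n. B n * N n) D3 prep"
      unfolding prep_def by (rule computable_poly_lift[OF _ BN]) (intro poly_host_matrix poly_uncovered_list poly_pendants poly_rules)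
  qed auto
  then have main: "computable (\<lambda>n. B n * N n) D3 (\<lambda>z. enc_bool (\<exists>W\<in>set (assignments (uncovered_list (?n z) (?K z)) (?a z) Leaf).
      orc (Node (host_matrix q (?n z) (?K z) (?y z) (?Vs z)) (pattern_matrix (?a z) (pendants q (?y z)) W)) \<noteq> Leaf))"
    by (simp add: prep_def Q_def)
  let ?D = "\<lambda>n. {x. len (left x) = n \<and> len (right (right x)) \<le> n}"
  define D1 where "D1 n = {z. left z \<in> ?D n}" for n
  have lift: "poly f \<Longrightarrow> computable (\<lambda>n. B n * N n) D f" for f D by (rule computable_poly_lift[OF _ BN])
  have "computable (\<lambda>n. B n * N n) ?D (\<lambda>x. enc_bool (decide orc R q p (left x) (left (right x)) (right (right x))))"
    unfolding decide_def
    \<comment> \<open>Nested loops over \<open>K\<close>, \<open>y\<close> and \<open>a\<close>: at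
      each level the domain records the guards passed so far, until it is contained in
      \<open>D3\<close>.\<close>
    apply (rule computable_ex[where D' = "\<lambda>n. {z. left z \<in> ?D n}"])
       apply (rule computable_conj)
         apply (rule lift, intro poly_rules)
        apply (rule computable_disj)
          apply (rule lift, intro poly_uncovered_list poly_rules)
         apply (rule computable_ex[where D' = "\<lambda>n. {z. left (left z) \<in> ?D n}"])
            apply (rule computable_conj)
              apply (rule lift, intro poly_rules)
             apply (rule computable_ex[where D' = "\<lambda>n. {z. left (left (left z)) \<in> ?D n \<and> len (tmul p (right (left z))) \<le> len (tapp (?n z) (enc_nat p))}"])
                apply (rule computable_conj)
                  apply (rule lift, intro poly_rules)
                 apply (rule computable_mono[OF main order_refl])
                 apply (auto simp: D3_def)[1]
                apply (rule BN)
               apply (rule lift, intro poly_rules)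
              apply (auto)[1]
             apply (rule BN)
            apply (rule BN)
           apply (rule lift, intro poly_rules)
          apply (auto)[1]
         apply (rule BN)
        apply (rule BN)
       apply (rule BN)
      apply (rule lift, intro poly_tuples poly_rules)
     apply (auto)[1]
    apply (rule BN)
    done
  then show ?thesis by (simp add: N_def)
qed

section \<open>Correctness of the decision procedure\<close>

text \<open>The branch that keeps the current hub, taken \<open>m\<close> times, leads to this state
  of the search, and the results below it are among those of the whole search.\<close>

lemma assignments_join:
  assumes "len z = m + r"
  shows "\<exists>z'. len z' = r \<and> set (assignments z' k (enc_list (replicate m k @ spine w))) \<subseteq> set (assignments z k w)"
  using assms
proof (induction m arbitrary: z w)
  case 0
  then show ?case by auto
next
  case (Suc m)
  then obtain l z1 where z: "z = Node l z1" "len z1 = m + r" by (cases z) auto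
  from Suc.IH[OF z(2), of "Node k w"] obtain z' where z': "len z' = r"
    "set (assignments z' k (enc_list (replicate m k @ k # spine w))) \<subseteq> set (assignments z1 k (Node k w))" by auto
  have "replicate m k @ k # spine w = replicate (Suc m) k @ spine w" by (simp add: replicate_app_Cons_same)
  with z'(2) have "set (assignments z' k (enc_list (replicate (Suc m) k @ spine w))) \<subseteq> set (assignments z1 k (Node k w))"
    by metis
  moreover have "set (assignments z1 k (Node k w)) \<subseteq> set (assignments z k w)" by (auto simp: z(1))
  ultimately have "set (assignments z' k (enc_list (replicate (Suc m) k @ spine w))) \<subseteq> set (assignments z k w)"
    by (rule order_trans)
  then show ?case using z' by blast
qed

text \<open>Opening the next hub always places a leaf on it, so the parts have to be positive. Hub
  numbers decrease: the parts go to the hubs \<open>len k - 1\<close>, \<open>len k - 2\<close> and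
  so on, and the remaining hubs stay empty.\<close>

lemma assignments_sizes:
  assumes "\<forall>m\<in>set ns. 1 \<le> m" "length ns \<le> len k" "len z = sum_list ns"
  shows "\<exists>W\<in>set (assignments z k w). \<exists>r. spine W = r @ spine w \<and>
    (\<forall>j. length (filter (\<lambda>e. len e = j) r) =
      (if j < len k \<and> len k - 1 - j < length ns then ns ! (len k - 1 - j) else 0))"
  using assms
proof (induction ns arbitrary: z k w)
  case Nil
  then show ?case by (cases z) auto
next
  case (Cons m ns)
  have m: "1 \<le> m" and k: "k \<noteq> Leaf" "length ns \<le> len (right k)" using Cons.prems by auto
  obtain l z1 where z: "z = Node l z1" "len z1 = (m - 1) + sum_list ns" using Cons.prems m by (cases z) auto
  define k' where "k' = right k"
  have lk: "len k = Suc (len k')" using k(1) by (cases k) (auto simp: k'_def)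
  obtain z' where z': "len z' = sum_list ns"
    "set (assignments z' k' (enc_list (replicate (m - 1) k' @ spine (Node k' w)))) \<subseteq> set (assignments z1 k' (Node k' w))"
    using assignments_join[OF z(2), of k' "Node k' w"] by blast
  have rep: "replicate (m - 1) k' @ spine (Node k' w) = replicate m k' @ spine w"
    using m by (cases m) (simp_all add: replicate_app_Cons_same)
  obtain W r where W: "W \<in> set (assignments z' k' (enc_list (replicate m k' @ spine w)))" "spine W = r @ replicate m k' @ spine w"
    "\<And>j. length (filter (\<lambda>e. len e = j) r) = (if j < len k' \<and> len k' - 1 - j < length ns then ns ! (len k' - 1 - j) else 0)"
    using Cons.IH[of k' z' "enc_list (replicate m k' @ spine w)"] Cons.prems(1) k(2) z'(1) unfolding k'_def by auto
  have "W \<in> set (assignments z k w)" using W(1) z'(2) unfolding rep using k(1) by (auto simp: z(1) k'_def)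
  moreover have "spine W = (r @ replicate m k') @ spine w" using W(2) by simp
  moreover have "length (filter (\<lambda>e. len e = j) (r @ replicate m k')) =
      (if j < len k \<and> len k - 1 - j < length (m # ns) then (m # ns) ! (len k - 1 - j) else 0)" for j
  proof -
    consider "j = len k'" | "j < len k'" | "j > len k'" by linarith
    then show ?thesis
    proof cases
      case 2
      then obtain i where "len k' - j = Suc i" "len k' - 1 - j = i" by (cases "len k' - j") auto
      then show ?thesis using 2 W(3)[of j] by (simp add: lk)
    qed (auto simp: W(3) lk)
  qed
  ultimately show ?case by blast
qed

text \<open>The hub \<open>k\<close> is open from the start and takes the first part;
  \<open>assignments_sizes\<close> distributes the others.\<close>

lemma assignments_exists:
  assumes "\<forall>m\<in>set ns. 1 \<le> m" "length ns \<le> Suc (len k)" "len z = sum_list ns" "ns \<noteq> []"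
  shows "\<exists>W\<in>set (assignments z k Leaf). \<forall>j\<le>len k. card {i. i < len W \<and> len (spine W ! i) = j} =
      (if len k - j < length ns then ns ! (len k - j) else 0)"
proof -
  obtain m ns' where ns: "ns = m # ns'" using assms(4) by (cases ns) auto
  obtain z' where z': "len z' = sum_list ns'"
    "set (assignments z' k (enc_list (replicate m k @ spine Leaf))) \<subseteq> set (assignments z k Leaf)"
    using assignments_join[of z m "sum_list ns'" k Leaf] assms(3) ns by auto
  obtain W r where W: "W \<in> set (assignments z' k (enc_list (replicate m k)))" "spine W = r @ replicate m k"
    "\<And>j. length (filter (\<lambda>e. len e = j) r) = (if j < len k \<and> len k - 1 - j < length ns' then ns' ! (len k - 1 - j) else 0)"
    using assignments_sizes[of ns' k z' "enc_list (replicate m k)"] assms z'(1) ns by auto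
  have "card {i. i < len W \<and> len (spine W ! i) = j} = (if len k - j < length ns then ns ! (len k - j) else 0)" if jk: "j \<le> len k" for j
  proof -
    have "card {i. i < len W \<and> len (spine W ! i) = j} = length (filter (\<lambda>e. len e = j) (spine W))"
      by (simp add: length_filter_conv_card)
    also have "\<dots> = (if len k - j < length ns then ns ! (len k - j) else 0)"
    proof (cases "j = len k")
      case False
      then obtain i where "len k - j = Suc i" "len k - 1 - j = i" using jk by (cases "len k - j") auto
      then show ?thesis using W(2,3) False jk ns by auto
    qed (simp add: W(2,3) ns)
    finally show ?thesis .
  qed
  moreover have "W \<in> set (assignments z k Leaf)" using W(1) z'(2) by auto
  ultimately show ?thesis by (intro bexI[of _ W]) simp_all
qed

text \<open>Within a subfamily \<open>H'\<close> of least cardinality, each element is assigned to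
  the first set that contains it. A set left without elements could be omitted, so all numbers of
  assigned elements are positive, as the enumeration requires.\<close>

lemma pattern_exists:
  assumes U: "U \<subseteq> {1..n}" "U \<noteq> {}" "card U = len z"
    and H: "finite H" "card H \<le> Suc (len k)" "U \<subseteq> \<Union> H" "H \<subseteq> set gs"
    and gs: "\<And>g. g \<in> set gs \<Longrightarrow> 0 \<in> g" and c: "x + Suc (len k) \<le> c"
  shows "\<exists>W\<in>set (assignments z k Leaf). has_subgraph_isomorphic_to (host n gs c)
    (pattern (len W) (\<lambda>i. len (spine W ! i)) (Suc (len k)) x)"
proof -
  have finU: "finite U" using U(1) finite_subset by blast
  define covers where "covers X \<longleftrightarrow> X \<subseteq> H \<and> U \<subseteq> \<Union> X" for X
  have "covers H" using H by (simp add: covers_def)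
  then obtain H' where H': "covers H'" "\<And>X. covers X \<Longrightarrow> card H' \<le> card X"
    using ex_has_least_nat[of covers H card] by blast
  have finH': "finite H'" using H' H(1) finite_subset covers_def by blast
  obtain hs where hs: "set hs = H'" "distinct hs" using finite_distinct_list[OF finH'] by blast
  define b where "b = length hs"
  have b: "b = card H'" using hs distinct_card b_def by metis
  have bk: "b \<le> Suc (len k)" using H'(2)[OF \<open>covers H\<close>] H(2) b by simp
  define idx where "idx u = (LEAST j. j < b \<and> u \<in> hs ! j)" for u
  have idx: "idx u < b \<and> u \<in> hs ! idx u" if u: "u \<in> U" for u
  proof -
    obtain h where "h \<in> H'" "u \<in> h" using u H'(1) unfolding covers_def by blast
    then have "\<exists>j. j < b \<and> u \<in> hs ! j" using hs by (metis b_def in_set_conv_nth)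
    then show ?thesis unfolding idx_def by (rule LeastI_ex)
  qed
  have block: "1 \<le> card {u \<in> U. idx u = j}" if "j < b" for j
  proof (rule ccontr)
    assume "\<not> 1 \<le> card {u \<in> U. idx u = j}"
    then have "card {u \<in> U. idx u = j} = 0" by linarith
    moreover have "finite {u \<in> U. idx u = j}" using finU by simp
    ultimately have "{u \<in> U. idx u = j} = {}" using card_0_eq by blast
    then have ne: "idx u \<noteq> j" if "u \<in> U" for u using that by blast
    have "covers (H' - {hs ! j})"
      unfolding covers_def
    proof (intro conjI subsetI)
      fix u assume u: "u \<in> U"
      have "hs ! idx u \<noteq> hs ! j" using idx[OF u] ne[OF u] \<open>j < b\<close> hs(2) by (simp add: nth_eq_iff_index_eq b_def)
      then show "u \<in> \<Union> (H' - {hs ! j})" using idx[OF u] hs(1) by (auto simp: b_def)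
    qed (use H'(1) in \<open>auto simp: covers_def\<close>)
    moreover have "hs ! j \<in> H'" using that hs(1) b_def nth_mem by blast
    ultimately show False using H'(2)[of "H' - {hs ! j}"] finH' card_Diff1_less by fastforce
  qed
  define ns where "ns = map (\<lambda>j. card {u \<in> U. idx u = j}) [0..<b]"
  have "sum_list ns = (\<Sum>j<b. card {u \<in> U. idx u = j})"
    by (simp add: ns_def sum_list_distinct_conv_sum_set lessThan_atLeast0)
  also have "\<dots> = card (\<Union>j<b. {u \<in> U. idx u = j})"
    using finU by (intro card_UN_disjoint[symmetric]) auto
  also have "(\<Union>j<b. {u \<in> U. idx u = j}) = U" using idx by auto
  finally have sum: "len z = sum_list ns" using U(3) by simp
  have "ns \<noteq> []" using U(2) idx by (auto simp: ns_def)
  moreover have "\<forall>m\<in>set ns. 1 \<le> m" using block by (auto simp: ns_def)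
  moreover have lns: "length ns = b" by (simp add: ns_def)
  ultimately obtain W where W: "W \<in> set (assignments z k Leaf)"
    "\<And>j. j \<le> len k \<Longrightarrow> card {i. i < len W \<and> len (spine W ! i) = j} = (if len k - j < b then ns ! (len k - j) else 0)"
    using assignments_exists[of ns k z] bk sum by auto
  \<comment> \<open>The enumeration fills the hubs downwards, so the set at position
    \<open>i\<close> of \<open>hs\<close> belongs to hub \<open>len k - i\<close>.\<close>
  define f where "f u = len k - idx u" for u
  define V where "V j = hs ! (len k - j)" for j
  have Vf: "V (f u) = hs ! idx u" if "u \<in> U" for u using idx[OF that] bk by (simp add: V_def f_def)
  have "has_subgraph_isomorphic_to (host n gs c) (pattern (len W) (\<lambda>i. len (spine W ! i)) (Suc (len k)) x)"
  proof (rule cover_imp_embedding[OF U(1), where f = f and V = V])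
    fix u assume u: "u \<in> U"
    have "hs ! idx u \<in> set hs" using idx[OF u] b_def by simp
    then have "hs ! idx u \<in> set gs" using hs(1) H'(1) H(4) by (auto simp: covers_def)
    then show "f u < Suc (len k) \<and> V (f u) \<in> set gs \<and> u \<in> V (f u)"
      using idx[OF u] Vf[OF u] by (simp add: f_def)
  next
    show "inj_on V (f ` U)"
    proof (rule inj_onI)
      fix i j assume "i \<in> f ` U" "j \<in> f ` U" "V i = V j"
      then obtain u v where uv: "u \<in> U" "v \<in> U" "i = f u" "j = f v" "hs ! idx u = hs ! idx v"
        using Vf by auto
      then have "idx u = idx v" using idx hs(2) by (simp add: nth_eq_iff_index_eq b_def)
      then show "i = j" using uv by (simp add: f_def)
    qed
  next
    fix j assume j: "j < Suc (len k)"
    have "f u = j \<longleftrightarrow> idx u = len k - j" if "u \<in> U" for u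
      using idx[OF that] bk j by (auto simp: f_def)
    then have "{u \<in> U. f u = j} = {u \<in> U. idx u = len k - j}" by blast
    moreover have "card {u \<in> U. idx u = len k - j} = (if len k - j < b then ns ! (len k - j) else 0)"
    proof (cases "len k - j < b")
      case False
      then have "{u \<in> U. idx u = len k - j} = {}" using idx by fastforce
      then show ?thesis using False by (metis card.empty)
    qed (simp add: ns_def)
    ultimately show "card {u \<in> U. f u = j} = card {i. i < len W \<and> len (spine W ! i) = j}"
      using W(2)[of j] j by simp
  next
    fix i assume "i < len W"
    then show "len (spine W ! i) < Suc (len k)"
      using assignments_props[OF W(1)] nth_mem[of i "spine W"] by (auto simp: less_Suc_eq_le)
  qed (use gs c in auto)
  then show ?thesis using W(1) by blast
qed

section \<open>Coverability and the greedy guess\<close>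

definition coverable :: "nat \<Rightarrow> bintree set \<Rightarrow> nat \<Rightarrow> bool" where
  "coverable n V t \<longleftrightarrow> (\<exists>W\<subseteq>V. finite W \<and> card W \<le> t \<and> (\<forall>i<n. \<exists>S\<in>W. tbit S i))"

text \<open>Among the families whose sets account for at least \<open>y + 1\<close> covered elements
  on average, one of maximal cardinality is taken. A further set adds at most \<open>y\<close> new
  elements, or it could be included; and \<open>p\<close> sets would cover at least
  \<open>(y + 1) * p\<close> elements, which is more than \<open>n\<close>.\<close>

lemma greedy_cover:
  fixes A :: "'a \<Rightarrow> nat set"
  assumes W: "finite W" and n: "n \<le> p * y" "0 < p"
  shows "\<exists>K\<subseteq>W. card K < p \<and> (\<forall>S\<in>W - K. card {i. i < n \<and> i \<in> A S \<and> (\<forall>S'\<in>K. i \<notin> A S')} \<le> y)"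
proof -
  define c where "c K = {i. i < n \<and> (\<exists>S\<in>K. i \<in> A S)}" for K
  have fc: "finite (c K)" "card (c K) \<le> n" for K
  proof -
    have "c K \<subseteq> {..<n}" by (auto simp: c_def)
    then show "finite (c K)" "card (c K) \<le> n" using finite_subset card_mono[of "{..<n}"] by auto
  qed
  define good where "good K \<longleftrightarrow> K \<subseteq> W \<and> (y + 1) * card K \<le> card (c K)" for K
  have "good {}" by (simp add: good_def)
  moreover have "\<forall>K. good K \<longrightarrow> card K < Suc (card W)" using W card_mono by (auto simp: good_def less_Suc_eq_le)
  ultimately obtain K where K: "good K" "\<And>K'. good K' \<Longrightarrow> card K' \<le> card K"
    using ex_has_greatest_nat[of good "{}" card "Suc (card W)"] by (metis less_imp_le)
  have finK: "finite K" using K(1) W finite_subset by (auto simp: good_def)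
  have "card K < p"
  proof (rule ccontr)
    assume "\<not> card K < p"
    then have "(y + 1) * p \<le> (y + 1) * card K" by (intro mult_le_mono2) simp
    also have "\<dots> \<le> n" using K(1) fc(2)[of K] by (simp add: good_def)
    finally show False using n by (simp add: algebra_simps)
  qed
  moreover have "card {i. i < n \<and> i \<in> A S \<and> (\<forall>S'\<in>K. i \<notin> A S')} \<le> y" if S: "S \<in> W - K" for S
  proof (rule ccontr)
    let ?N = "{i. i < n \<and> i \<in> A S \<and> (\<forall>S'\<in>K. i \<notin> A S')}"
    assume "\<not> card ?N \<le> y"
    have "c (insert S K) = c K \<union> ?N" by (auto simp: c_def)
    then have "card (c (insert S K)) = card (c K) + card ?N"
      using card_Un_disjoint[OF fc(1), of ?N K] by (auto simp: c_def disjoint_iff)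
    then have "good (insert S K)"
      using K(1) S \<open>\<not> card ?N \<le> y\<close> finK by (auto simp: good_def)
    then show False using K(2)[of "insert S K"] S finK by simp
  qed
  ultimately show ?thesis using K(1) unfolding good_def by blast
qed

lemma partition_into_groups:
  "finite A \<Longrightarrow> card A = q * a \<Longrightarrow> \<exists>P. finite P \<and> card P \<le> a \<and> \<Union> P = A \<and> (\<forall>X\<in>P. finite X \<and> card X \<le> q)"
proof (induction a arbitrary: A)
  case 0
  then show ?case by (intro exI[of _ "{}"]) auto
next
  case (Suc a)
  obtain X where X: "X \<subseteq> A" "card X = q" using obtain_subset_with_card_n[of q A] Suc.prems by auto
  then have "card (A - X) = q * a" using Suc.prems by (simp add: card_Diff_subset finite_subset)
  then obtain P where P: "finite P" "card P \<le> a" "\<Union> P = A - X" "\<forall>X\<in>P. finite X \<and> card X \<le> q"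
    using Suc.IH[of "A - X"] Suc.prems by auto
  have "card (insert X P) \<le> Suc a" using P(1,2) by (simp add: card_insert_if)
  then show ?case using P X Suc.prems(1) by (intro exI[of _ "insert X P"]) (auto intro: finite_subset)
qed

lemma len_filter_tupt: "length (filter P (spine (tupt n))) = card {i. i < len n \<and> P (enc_nat i)}"
proof -
  have "{i. i < len n \<and> P (map enc_nat [0..<len n] ! i)} = {i. i < len n \<and> P (enc_nat i)}" by auto
  then show ?thesis by (simp add: length_filter_conv_card)
qed

lemma len_uncovered_list: "len (uncovered_list n K) = card {i. i < len n \<and> \<not> (\<exists>S\<in>set (spine K). tbit S i)}"
  using len_filter_tupt[of "\<lambda>i. \<not> (\<exists>S\<in>set (spine K). tbit S (len i))" n] by (simp add: uncovered_list_def)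

lemma len_uncovered_list_filter: "len (tfilter (\<lambda>i. tbit S (len i)) (uncovered_list n K)) =
    card {i. i < len n \<and> tbit S i \<and> \<not> (\<exists>S\<in>set (spine K). tbit S i)}"
  using len_filter_tupt[of "\<lambda>i. tbit S (len i) \<and> \<not> (\<exists>S\<in>set (spine K). tbit S (len i))" n]
  by (simp add: uncovered_list_def conj_commute)

definition uncovered :: "bintree \<Rightarrow> bintree \<Rightarrow> nat set" where
  "uncovered n K = Suc ` {i. i < len n \<and> \<not> (\<exists>S\<in>set (spine K). tbit S i)}"

lemma uncovered_subset: "uncovered n K \<subseteq> {1..len n}"
  by (auto simp: uncovered_def)

lemma card_uncovered: "card (uncovered n K) = len (uncovered_list n K)"
  by (simp add: uncovered_def len_uncovered_list card_image)

lemma uncovered_empty: "uncovered n K = {} \<longleftrightarrow> uncovered_list n K = Leaf"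
proof -
  have "finite (uncovered n K)" using uncovered_subset finite_subset by blast
  then show ?thesis using card_uncovered[of n K] by (metis card_0_eq spine_eq_Nil length_0_conv)
qed

lemma orc_iff:
  assumes orc: "\<And>G T. (G, T) \<in> ktree_instances \<Longrightarrow> orc (enc_ktree (G, T)) = enc_bool (has_subgraph_isomorphic_to G T)"
    and W: "W \<in> set (assignments (uncovered_list n K) a Leaf)"
  shows "orc (Node (host_matrix q n K y Vs) (pattern_matrix a (pendants q y) W)) \<noteq> Leaf \<longleftrightarrow>
    has_subgraph_isomorphic_to (host (len n) (groups q n K y Vs) (len (pendants q y) + len n))
      (pattern (len W) (\<lambda>i. len (spine W ! i)) (Suc (len a)) (len (pendants q y)))"
proof -
  have "len (spine W ! i) < Suc (len a)" if "i < len W" for i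
    using assignments_props[OF W] nth_mem[OF that] by (auto simp: less_Suc_eq_le)
  from orc[OF instance_host_pattern, OF this] show ?thesis
    by (simp add: host_matrix_host pattern_matrix_pattern enc_ktree_def)
qed

text \<open>The grouping is undone: each of the at most \<open>len a + 1\<close> groups found is
  replaced by its at most \<open>q\<close> sets. Together with \<open>K\<close> they form the cover,
  whose size the length test of \<open>decide\<close> bounds.\<close>

lemma decide_imp_coverable:
  assumes orc: "\<And>G T. (G, T) \<in> ktree_instances \<Longrightarrow> orc (enc_ktree (G, T)) = enc_bool (has_subgraph_isomorphic_to G T)"
    and decide: "decide orc R q p n Vs t"
  shows "coverable (len n) (set (spine Vs)) (len t)"
proof -
  obtain K where K: "K \<in> set (spine (tuples R Vs))" "len K \<le> len t" and
    alt: "uncovered_list n K = Leaf \<or> (\<exists>y a W. len (tapp K (tmul q (Node Leaf a))) \<le> len t \<and> W \<in> set (assignments (uncovered_list n K) a Leaf) \<and>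
       orc (Node (host_matrix q n K y Vs) (pattern_matrix a (pendants q y) W)) \<noteq> Leaf)"
    using decide unfolding decide_def by blast
  have KV: "set (spine K) \<subseteq> set (spine Vs)" using K(1) by (simp add: set_tuples)
  have unc: "i \<in> {i. \<exists>S\<in>set (spine K). tbit S i} \<or> Suc i \<in> uncovered n K" if "i < len n" for i
    using that by (auto simp: uncovered_def)
  show ?thesis
  proof (cases "uncovered_list n K = Leaf")
    case True
    then have "uncovered n K = {}" by (simp add: uncovered_empty)
    then show ?thesis using unc KV K(2) unfolding coverable_def
      by (intro exI[of _ "set (spine K)"]) (auto intro: order_trans[OF card_length])
  next
    case False
    then obtain y a W where len: "len (tapp K (tmul q (Node Leaf a))) \<le> len t" and W: "W \<in> set (assignments (uncovered_list n K) a Leaf)"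
      and "orc (Node (host_matrix q n K y Vs) (pattern_matrix a (pendants q y) W)) \<noteq> Leaf" using alt by blast
    then have sub: "has_subgraph_isomorphic_to (host (len n) (groups q n K y Vs) (len (pendants q y) + len n))
      (pattern (len W) (\<lambda>i. len (spine W ! i)) (Suc (len a)) (len (pendants q y)))"
      using orc_iff[OF orc W] by blast
    define F where "F = set (spine (small_sets n K y Vs))"
    have F: "F \<subseteq> set (spine Vs)" by (auto simp: F_def small_sets_def)
    define A where "A S = {i. i < len n \<and> tbit S i \<and> \<not> (\<exists>S\<in>set (spine K). tbit S i)}" for S
    have FA: "card (A S) \<le> len y" if "S \<in> F" for S
      using that len_uncovered_list_filter[of S n K] by (simp add: F_def small_sets_def A_def)
    have finA: "finite (A S)" for S by (simp add: A_def)
    have vec: "bits (group_vector n K g) = insert 0 (Suc ` (\<Union>S\<in>set (spine g). A S))" for g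
      unfolding bits_group_vector A_def by (intro arg_cong[where f = "\<lambda>X. insert 0 (Suc ` X)"]) blast
    have "\<exists>hs\<subseteq>set (groups q n K y Vs). card hs \<le> Suc (len a) \<and> uncovered n K \<subseteq> \<Union> hs"
    \<comment> \<open>\<open>s\<close> bounds the size of a group, the root included.\<close>
    proof (rule embedding_imp_cover[OF sub uncovered_subset, where s = "Suc (q * len y)"])
      show "card (uncovered n K) = len W" using assignments_props[OF W] by (simp add: card_uncovered)
      show "Suc (q * len y) < Suc (len a) + len (pendants q y)" by (simp add: pendants_def)
      show "len (spine W ! i) < Suc (len a)" if "i < len W" for i
        using assignments_props[OF W] nth_mem[OF that] by (auto simp: less_Suc_eq_le)
      fix g assume "g \<in> set (groups q n K y Vs)"
      then obtain g' where g': "g = bits (group_vector n K g')" "len g' \<le> q" "set (spine g') \<subseteq> F"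
        by (auto simp: groups_def set_tuples F_def)
      have "card (\<Union>S\<in>set (spine g'). A S) \<le> (\<Sum>S\<in>set (spine g'). card (A S))" by (rule card_UN_le) simp
      also have "\<dots> \<le> (\<Sum>S\<in>set (spine g'). len y)" by (rule sum_mono) (use FA g'(3) in blast)
      also have "\<dots> \<le> q * len y" using g'(2) card_length[of "spine g'"] by simp
      finally have "card (Suc ` (\<Union>S\<in>set (spine g'). A S)) \<le> q * len y" by (simp add: card_image)
      then have "card g \<le> Suc (q * len y)" unfolding g'(1) vec using finA by (simp add: card_insert_if)
      moreover have "g \<subseteq> insert 0 (uncovered n K)"
        unfolding g'(1) vec uncovered_def by (auto simp: A_def)
      ultimately show "g \<subseteq> insert 0 (uncovered n K) \<and> card g \<le> Suc (q * len y)" by blast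
    qed auto
    then obtain hs where hs: "hs \<subseteq> set (groups q n K y Vs)" "card hs \<le> Suc (len a)" "uncovered n K \<subseteq> \<Union> hs" by blast
    have "\<exists>g. h = bits (group_vector n K g) \<and> len g \<le> q \<and> set (spine g) \<subseteq> F" if "h \<in> hs" for h
      using that hs(1) by (auto simp: groups_def set_tuples F_def)
    then obtain g where g: "\<And>h. h \<in> hs \<Longrightarrow> h = bits (group_vector n K (g h)) \<and> len (g h) \<le> q \<and> set (spine (g h)) \<subseteq> F" by metis
    define X where "X = set (spine K) \<union> (\<Union>h\<in>hs. set (spine (g h)))"
    have finhs: "finite hs" using hs(1) finite_subset by blast
    have "card (\<Union>h\<in>hs. set (spine (g h))) \<le> (\<Sum>h\<in>hs. card (set (spine (g h))))" by (rule card_UN_le[OF finhs])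
    also have "\<dots> \<le> (\<Sum>h\<in>hs. q)" by (rule sum_mono) (use g card_length order_trans in blast)
    also have "\<dots> \<le> q * Suc (len a)" using mult_le_mono2[OF hs(2), of q] by (simp add: mult.commute)
    finally have "card (\<Union>h\<in>hs. set (spine (g h))) \<le> q * Suc (len a)" .
    then have "card X \<le> len K + q * Suc (len a)"
      unfolding X_def using card_Un_le[of "set (spine K)" "\<Union>h\<in>hs. set (spine (g h))"] card_length[of "spine K"] by linarith
    then have "card X \<le> len t" using len by simp
    moreover have "finite X" unfolding X_def using finhs by simp
    moreover have "X \<subseteq> set (spine Vs)" unfolding X_def using KV F g by blast
    moreover have "\<exists>S\<in>X. tbit S i" if "i < len n" for i
      using unc[OF that]
    proof
      assume "Suc i \<in> uncovered n K"
      then obtain h where h: "h \<in> hs" "Suc i \<in> h" using hs(3) by blast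
      then have "Suc i \<in> insert 0 (Suc ` (\<Union>S\<in>set (spine (g h)). A S))" using g[OF h(1)] vec by metis
      then obtain S where "S \<in> set (spine (g h))" "i \<in> A S" by auto
      then show ?thesis using h(1) by (auto simp: X_def A_def)
    qed (auto simp: X_def)
    ultimately show ?thesis unfolding coverable_def by blast
  qed
qed

text \<open>The cover splits into the greedily chosen sets \<open>K0\<close>, a remainder
  \<open>K1\<close> of fewer than \<open>q\<close> sets and a multiple of \<open>q\<close> further
  sets, which form the groups. Then \<open>len K + q * a1\<close> equals \<open>card W\<close>, so
  counting \<open>q\<close> sets for each group does not exceed \<open>len t\<close>.\<close>

lemma coverable_imp_decide:
  assumes orc: "\<And>G T. (G, T) \<in> ktree_instances \<Longrightarrow> orc (enc_ktree (G, T)) = enc_bool (has_subgraph_isomorphic_to G T)"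
    and pq: "0 < p" "0 < q" "p + q \<le> R" and t: "len t \<le> len n"
    and coverable: "coverable (len n) (set (spine Vs)) (len t)"
  shows "decide orc R q p n Vs t"
proof -
  obtain W where W: "W \<subseteq> set (spine Vs)" "finite W" "card W \<le> len t" "\<And>i. i < len n \<Longrightarrow> \<exists>S\<in>W. tbit S i"
    using coverable unfolding coverable_def by blast
  \<comment> \<open>\<open>len n / p\<close> rounded up, the least value that the guard
    admits.\<close>
  define y where "y = enc_nat ((len n + p - 1) div p)"
  have ly: "len y = (len n + p - 1) div p" by (simp add: y_def)
  have dm: "p * len y + (len n + p - 1) mod p = len n + p - 1" by (simp add: ly)
  moreover have "(len n + p - 1) mod p < p" using pq(1) by simp
  ultimately have y: "len n \<le> p * len y" "p * len y \<le> len n + p" by linarith+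
  have yn: "len y \<le> len n"
  proof (cases "len n")
    case 0
    then show ?thesis using pq(1) by (simp add: ly)
  next
    case (Suc m)
    have "1 * len n \<le> p * len n" using pq(1) by (intro mult_le_mono1) simp
    moreover have "(len n + 1) * p = p * len n + p" by (simp add: algebra_simps)
    ultimately have "len n + p - 1 < (len n + 1) * p" using pq(1) by linarith
    from less_mult_imp_div_less[OF this] show ?thesis unfolding ly by linarith
  qed
  from greedy_cover[OF W(2) y(1) pq(1), of "\<lambda>S. {i. tbit S i}"]
  obtain K0 where K0: "K0 \<subseteq> W" "card K0 < p"
    "\<forall>S\<in>W - K0. card {i. i < len n \<and> i \<in> {i. tbit S i} \<and> (\<forall>S'\<in>K0. i \<notin> {i. tbit S' i})} \<le> len y"
    by (elim exE conjE)
  have finK0: "finite K0" using K0(1) W(2) finite_subset by blast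
  define J where "J = W - K0"
  have finJ: "finite J" using W(2) by (simp add: J_def)
  have cardJ: "card W = card K0 + card J"
    using W(2) K0(1) finK0 by (simp add: J_def card_Diff_subset card_mono)
  obtain K1 where K1: "K1 \<subseteq> J" "card K1 = card J mod q"
    using obtain_subset_with_card_n[of "card J mod q" J] by auto
  have finK1: "finite K1" using K1(1) finJ finite_subset by blast
  obtain Kl where Kl: "set Kl = K0 \<union> K1" "distinct Kl"
    using finite_distinct_list[of "K0 \<union> K1"] finK0 finK1 by blast
  define K where "K = enc_list Kl"
  have setK: "set (spine K) = K0 \<union> K1" by (simp add: K_def Kl)
  have "K0 \<inter> K1 = {}" using K1(1) by (auto simp: J_def)
  then have lenK: "len K = card K0 + card J mod q"
    using Kl distinct_card[OF Kl(2)] card_Un_disjoint[OF finK0 finK1] K1(2) by (simp add: K_def)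
  define a1 where "a1 = card J div q"
  have qa: "len K + q * a1 = card W" using cardJ lenK by (simp add: a1_def)
  have "card J mod q < q" using pq(2) by simp
  then have "len K \<le> R" using lenK K0(2) pq(3) by linarith
  moreover have "set (spine K) \<subseteq> set (spine Vs)" unfolding setK using K0(1) K1(1) W(1) by (auto simp: J_def)
  ultimately have Ktup: "K \<in> set (spine (tuples R Vs))" by (simp add: set_tuples)
  have Kt: "len K \<le> len t" using qa W(3) by linarith
  have rest: "card (J - K1) = q * a1"
    using K1 finJ finK1 by (simp add: card_Diff_subset a1_def minus_mod_eq_mult_div)
  obtain P where P: "finite P" "card P \<le> a1" "\<Union> P = J - K1" "\<And>X. X \<in> P \<Longrightarrow> finite X \<and> card X \<le> q"
    using partition_into_groups[OF _ rest] finJ by auto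
  have cover: "\<exists>X\<in>P. \<exists>S\<in>X. tbit S i" if "i < len n" "\<not> (\<exists>S\<in>set (spine K). tbit S i)" for i
  proof -
    obtain S where S: "S \<in> W" "tbit S i" using W(4)[OF \<open>i < len n\<close>] by blast
    then have "S \<in> \<Union> P" using that(2) unfolding P(3) setK J_def by blast
    then show ?thesis using S by blast
  qed
  show ?thesis
  proof (cases "uncovered_list n K = Leaf")
    case True
    then show ?thesis using Ktup Kt unfolding decide_def by blast
  next
    case False
    then have ne: "uncovered n K \<noteq> {}" by (simp add: uncovered_empty)
    then obtain i where "i < len n" "\<not> (\<exists>S\<in>set (spine K). tbit S i)" by (auto simp: uncovered_def)
    then have "P \<noteq> {}" using cover by blast
    \<comment> \<open>\<open>decide\<close> uses \<open>Suc (len a)\<close> hubs, so the number of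
      groups must be positive; an uncovered element ensures this.\<close>
    then have "0 < a1" using P(1,2) by (metis card_gt_0_iff gr0I le_zero_eq less_numeral_extra(3))
    define a where "a = enc_nat (a1 - 1)"
    have a: "Suc (len a) = a1" using \<open>0 < a1\<close> by (simp add: a_def)
    have "a1 \<le> q * a1" using pq(2) by simp
    then have a1n: "a1 \<le> len n" using qa W(3) t by linarith
    define F where "F = set (spine (small_sets n K y Vs))"
    \<comment> \<open>\<open>K\<close> extends \<open>K0\<close>, so a set has no more uncovered
      elements with respect to \<open>K\<close> than the greedy choice allows.\<close>
    have JF: "S \<in> F" if S: "S \<in> J" for S
    proof -
      have "{i. i < len n \<and> tbit S i \<and> \<not> (\<exists>S\<in>set (spine K). tbit S i)} \<subseteq>
          {i. i < len n \<and> i \<in> {i. tbit S i} \<and> (\<forall>S'\<in>K0. i \<notin> {i. tbit S' i})}"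
        unfolding setK by blast
      then have "card {i. i < len n \<and> tbit S i \<and> \<not> (\<exists>S\<in>set (spine K). tbit S i)} \<le>
          card {i. i < len n \<and> i \<in> {i. tbit S i} \<and> (\<forall>S'\<in>K0. i \<notin> {i. tbit S' i})}"
        by (intro card_mono) auto
      also have "\<dots> \<le> len y" using bspec[OF K0(3), of S] S unfolding J_def by blast
      finally show ?thesis using S W(1) len_uncovered_list_filter[of S n K] by (auto simp: F_def small_sets_def J_def)
    qed
    have "\<exists>l. set l = X \<and> distinct l" if "X \<in> P" for X using P(4)[OF that] finite_distinct_list by blast
    then obtain l where l: "\<And>X. X \<in> P \<Longrightarrow> set (l X) = X \<and> distinct (l X)" by metis
    define h where "h X = bits (group_vector n K (enc_list (l X)))" for X
    have hg: "h X \<in> set (groups q n K y Vs)" if X: "X \<in> P" for X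
    proof -
      have "length (l X) \<le> q" using l[OF X] P(4)[OF X] distinct_card by metis
      moreover have "set (l X) \<subseteq> F" using l[OF X] P(3) X JF by blast
      ultimately have "enc_list (l X) \<in> set (spine (tuples q (small_sets n K y Vs)))" by (simp add: set_tuples F_def)
      then show ?thesis by (auto simp: groups_def h_def)
    qed
    have "\<exists>W\<in>set (assignments (uncovered_list n K) a Leaf).
      has_subgraph_isomorphic_to (host (len n) (groups q n K y Vs) (len (pendants q y) + len n))
      (pattern (len W) (\<lambda>i. len (spine W ! i)) (Suc (len a)) (len (pendants q y)))"
    proof (rule pattern_exists[OF uncovered_subset ne card_uncovered, where H = "h ` P"])
      show "card (h ` P) \<le> Suc (len a)" using card_image_le[OF P(1), of h] P(2) a by linarith
      show "uncovered n K \<subseteq> \<Union> (h ` P)"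
      proof
        fix u assume "u \<in> uncovered n K"
        then obtain i where i: "u = Suc i" "i < len n" "\<not> (\<exists>S\<in>set (spine K). tbit S i)" by (auto simp: uncovered_def)
        from cover[OF i(2,3)] obtain X S where X: "X \<in> P" "S \<in> X" "tbit S i" by blast
        then have "u \<in> h X" using i l[OF X(1)] by (auto simp: h_def bits_group_vector)
        then show "u \<in> \<Union> (h ` P)" using X(1) by blast
      qed
      show "0 \<in> g" if "g \<in> set (groups q n K y Vs)" for g using that by (auto simp: groups_def bits_group_vector)
      show "len (pendants q y) + Suc (len a) \<le> len (pendants q y) + len n" using a a1n by simp
    qed (use P(1) hg in auto)
    then have "\<exists>W\<in>set (assignments (uncovered_list n K) a Leaf). orc (Node (host_matrix q n K y Vs) (pattern_matrix a (pendants q y) W)) \<noteq> Leaf"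
      using orc_iff[OF orc] by blast
    moreover have "len (tapp K (tmul q (Node Leaf a))) \<le> len t"
    proof -
      have "len (tapp K (tmul q (Node Leaf a))) = len K + q * Suc (len a)" by simp
      then show ?thesis unfolding a using qa W(3) by linarith
    qed
    moreover have "a \<in> set (spine (tupt n))" using a a1n by (auto simp: a_def)
    moreover have "y \<in> set (spine (tupt (Node Leaf n)))" unfolding spine_tupt set_map
      by (rule image_eqI[of _ _ "len y"]) (use yn in \<open>auto simp: y_def\<close>)
    moreover have "len n \<le> len (tmul p y) \<and> len (tmul p y) \<le> len (tapp n (enc_nat p))" using y by simp
    ultimately show ?thesis using Ktup Kt unfolding decide_def by blast
  qed
qed

lemma decide_iff_coverable:
  assumes "\<And>G T. (G, T) \<in> ktree_instances \<Longrightarrow> orc (enc_ktree (G, T)) = enc_bool (has_subgraph_isomorphic_to G T)"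
    and "0 < p" "0 < q" "p + q \<le> R" "len t \<le> len n"
  shows "decide orc R q p n Vs t \<longleftrightarrow> coverable (len n) (set (spine Vs)) (len t)"
  using decide_imp_coverable[OF assms(1)] coverable_imp_decide[OF assms] by blast

section \<open>Finding a smallest cover\<close>

lemma enc_bool_simps: "enc_bool True = tt" "enc_bool False = Leaf"
  by (simp_all add: enc_bool_def)

text \<open>The search for a cover uses the oracle only through \<open>decide\<close>.
  \<open>B\<close> is the cost factor of one decision; the exponents behind it are fixed only when
  the locale is interpreted.\<close>

locale set_cover_search =
  fixes orc :: "bintree \<Rightarrow> bintree" and R q p :: nat and B :: "nat \<Rightarrow> real"
  assumes orc: "\<And>G T. (G, T) \<in> ktree_instances \<Longrightarrow> orc (enc_ktree (G, T)) = enc_bool (has_subgraph_isomorphic_to G T)"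
    and pq: "0 < p" "0 < q" "p + q \<le> R" and B: "\<And>n. 1 \<le> B n"
    and decide_time: "computable B (\<lambda>n. {x. len (left x) = n \<and> len (right (right x)) \<le> n})
       (\<lambda>x. enc_bool (decide orc R q p (left x) (left (right x)) (right (right x))))"
begin

text \<open>The sizes are tried in increasing order, so the head of this list is the optimum.
  \<open>Node Leaf\<close> extends the range to include \<open>len (left x)\<close> itself.\<close>

definition cands :: "bintree \<Rightarrow> bintree" where
  "cands x = tfilter (\<lambda>t. decide orc R q p (left x) (right x) t) (tupt (Node Leaf (left x)))"

text \<open>The accumulator holds the kept sets, the sets not yet examined and the output bits so
  far in reverse order. A decision involves the whole rest of the list, which a fold does not pass
  on; hence the copy of it in the accumulator.\<close>

definition drop_step :: "bintree \<Rightarrow> bintree \<Rightarrow> bintree" where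
  "drop_step y acc = (if decide orc R q p (left (left y)) (tapp (left acc) (right (left (right acc)))) (right y)
     then Node (left acc) (Node (right (left (right acc))) (Node Leaf (right (right acc))))
     else Node (Node (left (left (right acc))) (left acc)) (Node (right (left (right acc))) (Node tt (right (right acc)))))"

definition reduce :: "bintree \<Rightarrow> bintree" where
  "reduce y = foldl (\<lambda>acc v. drop_step y acc) (Node Leaf (Node (right (left y)) Leaf)) (spine (right (left y)))"

definition search :: "bintree \<Rightarrow> bintree" where
  "search x = (if cands x \<noteq> Leaf then Node Leaf (trev (right (right (reduce (Node x (left (cands x))))))) else Leaf)"

lemma size_drop_step: "size (drop_step y acc) \<le> size acc + 7"
  by (cases acc; cases "right acc"; cases "left (right acc)") (auto simp: drop_step_def)

lemma size_foldl_drop_step: "size (foldl (\<lambda>acc v. drop_step y acc) acc vs) \<le> size acc + 7 * length vs"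
proof (induction vs arbitrary: acc)
  case (Cons v vs)
  show ?case using Cons[of "drop_step y acc"] size_drop_step[of y acc] by simp
qed simp

lemma lift: "poly f \<Longrightarrow> computable B D f"
  by (rule computable_poly_lift[OF _ B])

lemma computable_search: "computable B (\<lambda>n. {x. len (left x) = n}) search"
proof -
  let ?D = "\<lambda>n. {x. len (left x) = n}"
  have call: "computable B D (\<lambda>z. enc_bool (decide orc R q p (f z) (g z) (h z)))"
    if "poly f" "poly g" "poly h" "\<And>n z. z \<in> D n \<Longrightarrow> len (f z) = n \<and> len (h z) \<le> n" for D f g h
  proof -
    have "computable B D (\<lambda>z. (\<lambda>x. enc_bool (decide orc R q p (left x) (left (right x)) (right (right x)))) (Node (f z) (Node (g z) (h z))))"
      by (rule computable_comp[OF _ decide_time _ B], rule lift) (intro poly_basic that, use that(4) in auto)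
    then show ?thesis by simp
  qed
  have cands: "computable B ?D cands"
    unfolding cands_def
  proof (rule computable_tfilter[where D' = "\<lambda>n. {z. len (left (left z)) = n \<and> len (right z) \<le> n}"])
    show "computable B (\<lambda>n. {z. len (left (left z)) = n \<and> len (right z) \<le> n})
        (\<lambda>z. enc_bool (decide orc R q p (left (left z)) (right (left z)) (right z)))"
      by (rule call) (intro poly_basic | simp)+
    show "computable B ?D (\<lambda>x. tupt (Node Leaf (left x)))" by (rule lift) (intro poly_rules)
  qed (auto intro: B)
  define E where "E n = {y. len (left (left y)) = n \<and> len (right y) \<le> n}" for n
  have "computable B E reduce"
    unfolding reduce_def
  proof (rule computable_fold[where D' = "\<lambda>n. {z. len (left (left (left (left z)))) = n \<and> len (right (left (left z))) \<le> n}"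
        and h = "\<lambda>y acc v. drop_step y acc" and e = "\<lambda>y. size y + 2 + 7 * size y"])
    show "computable B (\<lambda>n. {z. len (left (left (left (left z)))) = n \<and> len (right (left (left z))) \<le> n})
        (\<lambda>z. drop_step (left (left z)) (right (left z)))"
      unfolding drop_step_def
      by (rule computable_ite, rule call) (intro poly_rules lift B | simp)+
    show "computable B E (\<lambda>y. Node Leaf (Node (right (left y)) Leaf))" "computable B E (\<lambda>y. right (left y))"
      by (rule lift, intro poly_rules)+
    show "poly_bounded E (\<lambda>y. size y + 2 + 7 * size y)" by (intro poly_bounded_intros)
    fix n y vs zs assume "spine (right (left y)) = vs @ zs"
    moreover have "size (right (left y)) \<le> size y" using size_left[of y] size_right[of "left y"] by linarith
    ultimately show "size (foldl (\<lambda>acc v. drop_step y acc) (Node Leaf (Node (right (left y)) Leaf)) vs) \<le> size y + 2 + 7 * size y"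
      using size_foldl_drop_step[of y "Node Leaf (Node (right (left y)) Leaf)" vs] len_le_size[of "right (left y)"] by simp
  qed (auto simp: E_def B)
  have "computable B (\<lambda>n. {x \<in> ?D n. cands x \<noteq> Leaf}) (\<lambda>x. reduce (Node x (left (cands x))))"
  proof (rule computable_comp[OF _ \<open>computable B E reduce\<close> _ B])
    have "computable B (\<lambda>n. {x \<in> ?D n. cands x \<noteq> Leaf}) cands" by (rule computable_mono[OF cands]) auto
    then show "computable B (\<lambda>n. {x \<in> ?D n. cands x \<noteq> Leaf}) (\<lambda>x. Node x (left (cands x)))"
      by (intro computable_Node computable_id computable_left B)
    fix n x assume x: "x \<in> {x \<in> ?D n. cands x \<noteq> Leaf}"
    then have "left (cands x) \<in> set (spine (cands x))" by (simp add: left_hd)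
    then have "left (cands x) \<in> enc_nat ` {..len (left x)}" by (auto simp: cands_def simp del: upt_Suc)
    then have "len (left (cands x)) \<le> len (left x)" by auto
    then show "Node x (left (cands x)) \<in> E n" using x by (simp add: E_def)
  qed
  then show ?thesis
    unfolding search_def by (intro computable_if cands computable_Node computable_trev computable_right computable_const B)
qed

definition covering :: "nat \<Rightarrow> nat \<Rightarrow> bintree set \<Rightarrow> bool" where
  "covering n t W \<longleftrightarrow> finite W \<and> card W \<le> t \<and> (\<forall>i<n. \<exists>S\<in>W. tbit S i)"

lemma coverable_covering: "coverable n V t \<longleftrightarrow> (\<exists>W\<subseteq>V. covering n t W)"
  by (auto simp: coverable_def covering_def)

text \<open>Once every set has been dropped if possible, each remaining one belongs to every solution.\<close>

lemma reduce_invariant: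
  assumes t: "len t \<le> len (left x)"
    and "coverable (len (left x)) (set (spine kept) \<union> set zs) (len t)"
    and "distinct (spine kept)" "\<forall>W. W \<subseteq> set (spine kept) \<union> set zs \<longrightarrow> covering (len (left x)) (len t) W \<longrightarrow> set (spine kept) \<subseteq> W"
  shows "\<exists>kept' bl. foldl (\<lambda>acc v. drop_step (Node x t) acc) (Node kept (Node (enc_list zs) bits0)) zs
      = Node kept' (Node Leaf (enc_list (rev (map enc_bool bl) @ spine bits0))) \<and> length bl = length zs \<and>
    spine kept' = rev (map snd (filter fst (zip bl zs))) @ spine kept \<and>
    coverable (len (left x)) (set (spine kept')) (len t) \<and> distinct (spine kept') \<and>
    (\<forall>W. W \<subseteq> set (spine kept') \<longrightarrow> covering (len (left x)) (len t) W \<longrightarrow> set (spine kept') \<subseteq> W)"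
  using assms(2-)
proof (induction zs arbitrary: kept bits0)
  case Nil
  then show ?case by auto
next
  case (Cons z zs)
  let ?n = "len (left x)" and ?t = "len t"
  have decide: "decide orc R q p (left x) (tapp kept (enc_list zs)) t \<longleftrightarrow> coverable ?n (set (spine kept) \<union> set zs) ?t"
    using decide_iff_coverable[where orc = orc, OF orc pq t] by simp
  show ?case
  proof (cases "coverable ?n (set (spine kept) \<union> set zs) ?t")
    case True
    have step: "drop_step (Node x t) (Node kept (Node (enc_list (z # zs)) bits0)) = Node kept (Node (enc_list zs) (Node Leaf bits0))"
      using decide True by (simp add: drop_step_def)
    have n: "\<forall>W. W \<subseteq> set (spine kept) \<union> set zs \<longrightarrow> covering ?n ?t W \<longrightarrow> set (spine kept) \<subseteq> W"
      using Cons.prems(3) by auto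
    from Cons.IH[OF True Cons.prems(2) n, of "Node Leaf bits0"] obtain kept' bl where
      *: "foldl (\<lambda>acc v. drop_step (Node x t) acc) (Node kept (Node (enc_list zs) (Node Leaf bits0))) zs
          = Node kept' (Node Leaf (enc_list (rev (map enc_bool bl) @ spine (Node Leaf bits0))))"
        "length bl = length zs" "spine kept' = rev (map snd (filter fst (zip bl zs))) @ spine kept"
        "coverable ?n (set (spine kept')) ?t" "distinct (spine kept')"
        "\<forall>W. W \<subseteq> set (spine kept') \<longrightarrow> covering ?n ?t W \<longrightarrow> set (spine kept') \<subseteq> W"
      by (elim exE conjE) (rule that)
    show ?thesis
      by (rule exI[of _ kept'], rule exI[of _ "False # bl"]) (use * step in \<open>simp add: enc_bool_simps\<close>)
  next
    case False
    have step: "drop_step (Node x t) (Node kept (Node (enc_list (z # zs)) bits0)) = Node (Node z kept) (Node (enc_list zs) (Node tt bits0))"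
      using decide False by (simp add: drop_step_def)
    have eq: "set (spine (Node z kept)) \<union> set zs = set (spine kept) \<union> set (z # zs)" by auto
    \<comment> \<open>A repetition of a kept vector could have been dropped. Hence the kept vectors
      are distinct, and counting positions amounts to counting vectors.\<close>
    have "z \<notin> set (spine kept)"
    proof
      assume "z \<in> set (spine kept)"
      then have "set (spine kept) \<union> set (z # zs) = set (spine kept) \<union> set zs" by auto
      then show False using False Cons.prems(1) by metis
    qed
    then have d: "distinct (spine (Node z kept))" using Cons.prems(2) by simp
    have n: "\<forall>W. W \<subseteq> set (spine (Node z kept)) \<union> set zs \<longrightarrow> covering ?n ?t W \<longrightarrow> set (spine (Node z kept)) \<subseteq> W"
    proof (intro allI impI)
      fix W assume W: "W \<subseteq> set (spine (Node z kept)) \<union> set zs" "covering ?n ?t W"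
      have "set (spine kept) \<subseteq> W" using Cons.prems(3) W(1)[unfolded eq] W(2) by blast
      moreover have "z \<in> W"
      proof (rule ccontr)
        assume "z \<notin> W"
        then have "W \<subseteq> set (spine kept) \<union> set zs" using W(1) by auto
        then show False using False W(2) unfolding coverable_covering by blast
      qed
      ultimately show "set (spine (Node z kept)) \<subseteq> W" by simp
    qed
    from Cons.IH[OF Cons.prems(1)[folded eq] d n, of "Node tt bits0"] obtain kept' bl where
      *: "foldl (\<lambda>acc v. drop_step (Node x t) acc) (Node (Node z kept) (Node (enc_list zs) (Node tt bits0))) zs
          = Node kept' (Node Leaf (enc_list (rev (map enc_bool bl) @ spine (Node tt bits0))))"
        "length bl = length zs" "spine kept' = rev (map snd (filter fst (zip bl zs))) @ spine (Node z kept)"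
        "coverable ?n (set (spine kept')) ?t" "distinct (spine kept')"
        "\<forall>W. W \<subseteq> set (spine kept') \<longrightarrow> covering ?n ?t W \<longrightarrow> set (spine kept') \<subseteq> W"
      by (elim exE conjE) (rule that)
    show ?thesis
      by (rule exI[of _ kept'], rule exI[of _ "True # bl"]) (use * step in \<open>simp add: enc_bool_simps\<close>)
  qed
qed

text \<open>Some solution lies within the kept sets and, by the invariant, contains them all. The
  kept sets are thus a solution themselves, and as they are distinct, \<open>J\<close> has at most
  \<open>len t\<close> positions.\<close>

lemma reduce_correct:
  assumes t: "len t \<le> len (left x)" and coverable: "coverable (len (left x)) (set (spine (right x))) (len t)"
  shows "\<exists>J\<subseteq>{..<len (right x)}. trev (right (right (reduce (Node x t)))) = enc_bits (map (\<lambda>j. j \<in> J) [0..<len (right x)]) \<and>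
    card J \<le> len t \<and> (\<forall>i<len (left x). \<exists>j\<in>J. tbit (spine (right x) ! j) i)"
proof -
  let ?zs = "spine (right x)"
  have 1: "coverable (len (left x)) (set (spine Leaf) \<union> set ?zs) (len t)" using coverable by simp
  have 2: "distinct (spine Leaf)"
    and 3: "\<forall>W. W \<subseteq> set (spine Leaf) \<union> set ?zs \<longrightarrow> covering (len (left x)) (len t) W \<longrightarrow> set (spine Leaf) \<subseteq> W"
    by simp_all
  from reduce_invariant[OF t 1 2 3, of Leaf]
  obtain kept' bl where *: "foldl (\<lambda>acc v. drop_step (Node x t) acc) (Node Leaf (Node (enc_list ?zs) Leaf)) ?zs
      = Node kept' (Node Leaf (enc_list (rev (map enc_bool bl) @ spine Leaf)))" "length bl = length ?zs"
    "spine kept' = rev (map snd (filter fst (zip bl ?zs))) @ spine Leaf"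
    "coverable (len (left x)) (set (spine kept')) (len t)" "distinct (spine kept')"
    "\<forall>W. W \<subseteq> set (spine kept') \<longrightarrow> covering (len (left x)) (len t) W \<longrightarrow> set (spine kept') \<subseteq> W"
    by (elim exE conjE) (rule that)
  define J where "J = {j. j < length ?zs \<and> bl ! j}"
  have bl: "map (\<lambda>j. j \<in> J) [0..<length ?zs] = bl"
    by (rule nth_equalityI) (auto simp: J_def *(2))
  have "trev (right (right (reduce (Node x t)))) = enc_list (map enc_bool bl)"
  proof -
    have "reduce (Node x t) = foldl (\<lambda>acc v. drop_step (Node x t) acc) (Node Leaf (Node (enc_list ?zs) Leaf)) ?zs"
      by (simp only: reduce_def left.simps right.simps enc_list_spine)
    then show ?thesis unfolding *(1) by (simp add: trev_def)
  qed
  then have out: "trev (right (right (reduce (Node x t)))) = enc_bits (map (\<lambda>j. j \<in> J) [0..<length ?zs])"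
    unfolding bl by (simp add: enc_bits_def)
  have "len kept' = length (filter fst (zip bl ?zs))" using *(3) by simp
  also have "\<dots> = card {i. i < length (zip bl ?zs) \<and> fst (zip bl ?zs ! i)}" by (rule length_filter_conv_card)
  also have "{i. i < length (zip bl ?zs) \<and> fst (zip bl ?zs ! i)} = J" using *(2) by (auto simp: J_def)
  finally have cJ: "card J = len kept'" by simp
  obtain W where W: "W \<subseteq> set (spine kept')" "covering (len (left x)) (len t) W" using *(4) unfolding coverable_covering by blast
  then have "W = set (spine kept')" using *(6) by blast
  then have cW: "covering (len (left x)) (len t) (set (spine kept'))" using W(2) by simp
  then have "card J \<le> len t" using cJ distinct_card[OF *(5)] by (simp add: covering_def)
  moreover have "\<exists>j\<in>J. tbit (?zs ! j) i" if i: "i < len (left x)" for i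
  proof -
    obtain S where S: "S \<in> set (spine kept')" "tbit S i" using cW i unfolding covering_def by blast
    then obtain b where "(b, S) \<in> set (filter fst (zip bl ?zs))" using *(3) by auto
    then obtain j where "j < length ?zs" "bl ! j" "?zs ! j = S" using *(2) by (auto simp: set_zip)
    then show ?thesis using S(2) by (auto simp: J_def)
  qed
  ultimately show ?thesis using out by (intro exI[of _ J]) (auto simp: J_def)
qed

lemma search_correct:
  assumes "(n, Ss) \<in> set_cover_instances"
  shows "set_cover_correct (n, Ss) (search (enc_set_cover (n, Ss)))"
proof -
  define vs where "vs = map (\<lambda>S. enc_bits (map (\<lambda>i. i \<in> S) [1..<n + 1])) Ss"
  define x where "x = Node (enc_nat n) (enc_list vs)"
  have x: "enc_set_cover (n, Ss) = x" by (simp add: enc_set_cover_def x_def vs_def)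
  have tbit: "tbit (vs ! j) i \<longleftrightarrow> Suc i \<in> Ss ! j" if "j < length Ss" "i < n" for i j
    using that by (auto simp: vs_def tbit_def enc_bits_def simp del: upt_Suc)
  have cover: "is_cover n Ss J \<longleftrightarrow> J \<subseteq> {..<length Ss} \<and> (\<forall>i<n. \<exists>j\<in>J. tbit (vs ! j) i)" for J
  proof (cases "J \<subseteq> {..<length Ss}")
    case True
    have sub: "(\<Union>j\<in>J. Ss ! j) \<subseteq> {1..n}" using True assms nth_mem by (fastforce simp: set_cover_instances_def)
    have "{1..n} \<subseteq> (\<Union>j\<in>J. Ss ! j) \<longleftrightarrow> (\<forall>i<n. \<exists>j\<in>J. Suc i \<in> Ss ! j)"
    proof
      assume r: "\<forall>i<n. \<exists>j\<in>J. Suc i \<in> Ss ! j"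
      show "{1..n} \<subseteq> (\<Union>j\<in>J. Ss ! j)"
      proof
        fix i assume "i \<in> {1..n}"
        then have "i - 1 < n" "i = Suc (i - 1)" by auto
        then show "i \<in> (\<Union>j\<in>J. Ss ! j)" using r by (metis UN_I)
      qed
    next
      assume r: "{1..n} \<subseteq> (\<Union>j\<in>J. Ss ! j)"
      show "\<forall>i<n. \<exists>j\<in>J. Suc i \<in> Ss ! j"
      proof (intro allI impI)
        fix i assume "i < n"
        then have "Suc i \<in> {1..n}" by simp
        then show "\<exists>j\<in>J. Suc i \<in> Ss ! j" using r by blast
      qed
    qed
    also have "\<dots> \<longleftrightarrow> (\<forall>i<n. \<exists>j\<in>J. tbit (vs ! j) i)"
    proof -
      have "(\<exists>j\<in>J. Suc i \<in> Ss ! j) \<longleftrightarrow> (\<exists>j\<in>J. tbit (vs ! j) i)" if "i < n" for i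
        by (rule bex_cong[OF refl]) (use True tbit[OF _ that] in auto)
      then show ?thesis by simp
    qed
    finally show ?thesis unfolding is_cover_def using True sub by (simp add: set_eq_subset)
  qed (simp add: is_cover_def)
  have finJ: "finite J" if "is_cover n Ss J" for J using that finite_subset by (auto simp: is_cover_def)
  have lv: "length vs = length Ss" by (simp add: vs_def)
  have coverable_card: "coverable n (set vs) (card K)" if K: "is_cover n Ss K" for K
    unfolding coverable_def
  proof (intro exI conjI allI impI)
    show "(\<lambda>j. vs ! j) ` K \<subseteq> set vs" using K lv by (auto simp: is_cover_def)
    show "card ((\<lambda>j. vs ! j) ` K) \<le> card K" using card_image_le[OF finJ[OF K]] .
    show "\<exists>S\<in>(\<lambda>j. vs ! j) ` K. tbit S i" if "i < n" for i using K that unfolding cover by blast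
  qed (use finJ[OF K] in auto)
  \<comment> \<open>One set for each element suffices, so if there is a cover at all, the candidate
    sizes up to \<open>n\<close> include a feasible one.\<close>
  have coverable_n: "coverable n (set vs) n" if K: "is_cover n Ss K" for K
  proof -
    obtain f where f: "\<And>i. i < n \<Longrightarrow> f i \<in> K \<and> tbit (vs ! f i) i" using K unfolding cover by metis
    show ?thesis
      unfolding coverable_def
    proof (intro exI conjI allI impI)
      show "(\<lambda>i. vs ! f i) ` {..<n} \<subseteq> set vs"
      proof (rule image_subsetI)
        fix i assume "i \<in> {..<n}"
        then have "f i \<in> K" using f by simp
        moreover have "K \<subseteq> {..<length vs}" using K lv by (simp add: is_cover_def)
        ultimately have "f i < length vs" by auto
        then show "vs ! f i \<in> set vs" by (rule nth_mem)
      qed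
      show "card ((\<lambda>i. vs ! f i) ` {..<n}) \<le> n" using card_image_le[of "{..<n}"] by auto
      show "\<exists>S\<in>(\<lambda>i. vs ! f i) ` {..<n}. tbit S i" if "i < n" for i using f[OF that] that by blast
    qed simp
  qed
  have decide: "decide orc R q p (left x) (right x) (enc_nat t) \<longleftrightarrow> coverable n (set vs) t" if "t \<le> n" for t
    using decide_iff_coverable[where orc = orc, OF orc pq, of "enc_nat t" "left x"] that by (simp add: x_def)
  have dlc: "spine (cands x) = filter (\<lambda>t. decide orc R q p (left x) (right x) t) (map enc_nat [0..<n + 1])"
    by (simp add: cands_def x_def)
  show ?thesis
  proof (cases "\<exists>K. is_cover n Ss K")
    case False
    have "\<not> coverable n (set vs) t" for t
    proof
      assume "coverable n (set vs) t"
      then obtain W where W: "W \<subseteq> set vs" "\<forall>i<n. \<exists>S\<in>W. tbit S i" by (auto simp: coverable_def)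
      have "is_cover n Ss {..<length Ss}"
        unfolding cover using W lv by (metis in_set_conv_nth lessThan_iff order_refl subsetD)
      then show False using False by blast
    qed
    then have "spine (cands x) = []" unfolding dlc using decide by (auto simp: filter_empty_conv simp del: upt_Suc)
    then show ?thesis using False by (simp add: set_cover_correct_def x search_def)
  next
    case True
    then obtain K where K: "is_cover n Ss K" by blast
    have "enc_nat n \<in> set (spine (cands x))" unfolding dlc using decide[of n] coverable_n[OF K] by simp
    then obtain y ys where ys: "spine (cands x) = y # ys" by (cases "spine (cands x)") auto
    have left: "left (cands x) = y" "cands x \<noteq> Leaf" using ys by (cases "cands x"; simp)+
    \<comment> \<open>\<open>y\<close> is the first hit of the filter, so all smaller sizes
      fail.\<close>
    from ys[unfolded dlc filter_eq_Cons_iff] obtain us ws where us: "map enc_nat [0..<n + 1] = us @ y # ws"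
      "\<forall>u\<in>set us. \<not> decide orc R q p (left x) (right x) u" "decide orc R q p (left x) (right x) y"
      by blast
    define t where "t = length us"
    have tn: "t \<le> n" using arg_cong[OF us(1), of length] by (simp add: t_def)
    have nth: "map enc_nat [0..<n + 1] ! i = enc_nat i" if "i \<le> n" for i using that by (simp del: upt_Suc)
    have y: "y = enc_nat t" using nth[OF tn] unfolding us(1) t_def nth_append_length .
    have min: "\<not> coverable n (set vs) i" if i: "i < t" for i
    proof -
      have "(us @ y # ws) ! i = enc_nat i" using nth[of i] i tn unfolding us(1) by simp
      then have "enc_nat i = us ! i" using i by (simp add: nth_append t_def)
      then have "enc_nat i \<in> set us" using i t_def by simp
      then show ?thesis using us(2) decide[of i] i tn by auto
    qed
    have "coverable n (set vs) t" using us(3) decide[OF tn] y by simp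
    with reduce_correct[of "enc_nat t" x] tn obtain J where J: "J \<subseteq> {..<length Ss}"
      "trev (right (right (reduce (Node x (enc_nat t))))) = enc_bits (map (\<lambda>j. j \<in> J) [0..<length Ss])"
      "card J \<le> t" "\<forall>i<n. \<exists>j\<in>J. tbit (vs ! j) i" by (auto simp: x_def lv)
    have "is_cover n Ss J" unfolding cover using J by blast
    moreover have "card J \<le> card L" if "is_cover n Ss L" for L
      using min[of "card L"] coverable_card[OF that] J(3) by (meson le_trans not_le)
    ultimately have "is_smallest_cover n Ss J" by (simp add: is_smallest_cover_def)
    then show ?thesis using True J(2) left y by (auto simp: set_cover_correct_def x search_def)
  qed
qed

end

section \<open>Choice of the constants\<close>

lemma exec_pos: "exec p s t s' \<Longrightarrow> 0 < t"
  by (induction rule: exec.induct) auto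

theorem theorem1:
  fixes \<epsilon> :: real
  assumes "0 < \<epsilon>"
    and "ktree_solvable_in_Ostar (\<lambda>k. (2 - \<epsilon>) ^ k)"
  shows "\<exists>\<delta>>0. set_cover_solvable_in_Ostar (\<lambda>n. (2 - \<delta>) ^ n)"
proof -
  obtain pr and c d :: nat where pr: "\<And>i. i \<in> ktree_instances \<Longrightarrow> \<exists>t y. runs pr (enc_ktree i) t y \<and> ktree_correct i y \<and>
      real t \<le> real c * real (size (enc_ktree i) + 1) ^ d * (2 - \<epsilon>) ^ card (pverts (snd i))"
    using assms(2) unfolding ktree_solvable_in_Ostar_def solvable_in_Ostar_def by (force simp: case_prod_beta)
  \<comment> \<open>Otherwise the time bound for the tree with a single vertex would be at most 0,
    but every run takes at least one step.\<close>
  have \<epsilon>2: "\<epsilon> < 2"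
  proof (rule ccontr)
    assume "\<not> \<epsilon> < 2"
    let ?i = "(host 0 [] 0, pattern 0 id 0 0)"
    have i: "?i \<in> ktree_instances" by (rule instance_host_pattern) simp
    have "card (pverts (snd ?i)) = 1" by (simp add: pattern_def)
    then obtain t y where t: "runs pr (enc_ktree ?i) t y" "real t \<le> real c * real (size (enc_ktree ?i) + 1) ^ d * (2 - \<epsilon>)"
      using pr[OF i] by auto
    have "real c * real (size (enc_ktree ?i) + 1) ^ d * (2 - \<epsilon>) \<le> 0"
      using \<open>\<not> \<epsilon> < 2\<close> by (intro mult_nonneg_nonpos) auto
    then show False using t exec_pos unfolding runs_def by fastforce
  qed
  \<comment> \<open>The lower bound \<open>3 / 2\<close> keeps the base above 1, so that its powers
    grow with the size of the pattern.\<close>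
  define b where "b = max (2 - \<epsilon>) (3 / 2)"
  have b: "1 < b" "b < 2" "3 / 2 \<le> b" "2 - \<epsilon> \<le> b" using assms(1) by (auto simp: b_def)
  \<comment> \<open>Four factors of about \<open>\<gamma> ^ n\<close> will arise: one from the hubs,
    one from the pendants and two from the bound on the number of assignments. With the fifth root,
    \<open>b * \<gamma> ^ 4\<close> stays below 2.\<close>
  define \<gamma> where "\<gamma> = root 5 (2 / b)"
  have "1 < 2 / b" using b by simp
  then have \<gamma>1: "1 < \<gamma>" unfolding \<gamma>_def by simp
  have \<gamma>5: "\<gamma> ^ 5 = 2 / b" unfolding \<gamma>_def using b by (intro real_root_pow_pos2) auto
  have "\<gamma> ^ 1 \<le> \<gamma> ^ 5" using \<gamma>1 by (intro power_increasing) auto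
  moreover have "2 / b \<le> 2" using b by (simp add: divide_simps)
  ultimately have \<gamma>2: "\<gamma> \<le> 2" unfolding \<gamma>5 by simp
  have "\<gamma> ^ 4 < \<gamma> ^ 5" using \<gamma>1 by (intro power_strict_increasing) auto
  then have b\<gamma>: "b * \<gamma> ^ 4 < 2" using \<gamma>5 b by (simp add: field_simps)
  define \<xi> where "\<xi> = \<gamma> - 1"
  have \<xi>: "0 < \<xi>" "\<xi> \<le> 1" using \<gamma>1 \<gamma>2 by (auto simp: \<xi>_def)
  \<comment> \<open>Both \<open>b\<close> and \<open>1 / \<xi>\<close> are then at most
    \<open>\<gamma> ^ q\<close>, so their powers with exponent \<open>n div q\<close> are at most
    \<open>\<gamma> ^ n\<close>.\<close>
  obtain q where q: "max 2 (1 / \<xi>) < \<gamma> ^ q" using real_arch_pow[OF \<gamma>1] by blast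
  have q0: "0 < q" using q by (cases q) auto
  \<comment> \<open>There are about \<open>q * n / p\<close> pendants, which this choice brings down
    to about \<open>n / q\<close>.\<close>
  define p where "p = q * q"
  have p0: "0 < p" using q0 by (simp add: p_def)
  define Bo where "Bo n = b ^ pattern_size_bound q p n" for n
  have Bo1: "1 \<le> Bo n" for n using b by (simp add: Bo_def one_le_power)
  obtain orc where orc: "\<forall>i\<in>ktree_instances. orc (enc_ktree i) = enc_bool (has_subgraph_isomorphic_to (fst i) (snd i))"
    and computable: "computable Bo (\<lambda>n. enc_ktree ` {i \<in> ktree_instances. card (pverts (snd i)) \<le> pattern_size_bound q p n}) orc"
  proof -
    have "\<exists>h. (\<forall>i\<in>ktree_instances. h (enc_ktree i) = enc_bool (has_subgraph_isomorphic_to (fst i) (snd i))) \<and>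
       computable Bo (\<lambda>n. enc_ktree ` {i \<in> ktree_instances. card (pverts (snd i)) \<le> pattern_size_bound q p n}) h"
    proof (rule computable_oracle[where F = "\<lambda>i. b ^ card (pverts (snd i))"])
      fix i :: "nat pair_pre_digraph \<times> nat pair_pre_digraph" assume "i \<in> ktree_instances"
      then obtain t y where t: "runs pr (enc_ktree i) t y" "ktree_correct i y"
        "real t \<le> real c * real (size (enc_ktree i) + 1) ^ d * (2 - \<epsilon>) ^ card (pverts (snd i))" using pr by blast
      have "real c * real (size (enc_ktree i) + 1) ^ d * (2 - \<epsilon>) ^ card (pverts (snd i))
        \<le> real c * real (size (enc_ktree i) + 1) ^ d * b ^ card (pverts (snd i))"
        using b(4) \<epsilon>2 by (intro mult_left_mono power_mono) auto
      with t show "\<exists>t. runs pr (enc_ktree i) t (enc_bool (has_subgraph_isomorphic_to (fst i) (snd i))) \<and>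
        real t \<le> real c * real (size (enc_ktree i) + 1) ^ d * b ^ card (pverts (snd i))"
        by (auto simp: ktree_correct_def case_prod_beta intro!: exI[of _ t])
    next
      fix n i assume "i \<in> {i \<in> ktree_instances. card (pverts (snd i)) \<le> pattern_size_bound q p n}"
      then show "i \<in> ktree_instances \<and> b ^ card (pverts (snd i)) \<le> Bo n"
        using b by (auto simp: Bo_def intro!: power_increasing)
    qed (auto simp: enc_bool_def Bo1)
    then show ?thesis using that by blast
  qed
  define BN where "BN n = Bo n * ((1 + \<xi>) ^ n * (1 / \<xi>) ^ (n div q))" for n
  have N1: "1 \<le> (1 + \<xi>) ^ n * (1 / \<xi>) ^ (n div q)" for n
    using mult_mono[of 1 "(1 + \<xi>) ^ n" 1 "(1 / \<xi>) ^ (n div q)"] \<xi> by (simp add: one_le_power)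
  \<comment> \<open>\<open>p + q\<close> leaves room for the fewer than \<open>p\<close> greedily
    chosen sets and the fewer than \<open>q\<close> sets left over by the grouping.\<close>
  interpret set_cover_search orc "p + q" q p BN
  proof
    show "1 \<le> BN n" for n unfolding BN_def using mult_mono[OF Bo1[of n] N1[of n]] Bo1[of n] by simp
    show "computable BN (\<lambda>n. {x. len (left x) = n \<and> len (right (right x)) \<le> n})
       (\<lambda>x. enc_bool (decide orc (p + q) q p (left x) (left (right x)) (right (right x))))"
      unfolding BN_def by (rule computable_decide[OF computable Bo1 \<xi> p0 q0])
  qed (use orc p0 q0 in auto)
  \<comment> \<open>\<open>b ^ 2\<close> stems from the two additional vertices of the pattern,
    \<open>\<gamma> ^ p\<close> from rounding up \<open>n / p\<close>.\<close>
  define C where "C = b ^ 2 * \<gamma> ^ p"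
  have bound: "BN n \<le> C * (b * \<gamma> ^ 4) ^ n" for n
  proof -
    have g1: "1 \<le> \<gamma>" using \<gamma>1 by simp
    have bq: "b \<le> \<gamma> ^ q" "1 / \<xi> \<le> \<gamma> ^ q" using q b by auto
    have 1: "b ^ (n div q) \<le> \<gamma> ^ n"
    proof -
      have "b ^ (n div q) \<le> (\<gamma> ^ q) ^ (n div q)" using bq b by (intro power_mono) auto
      also have "\<dots> = \<gamma> ^ (q * (n div q))" by (simp add: power_mult)
      also have "\<dots> \<le> \<gamma> ^ n" using g1 by (intro power_increasing) auto
      finally show ?thesis .
    qed
    have 2: "(1 / \<xi>) ^ (n div q) \<le> \<gamma> ^ n"
    proof -
      have "(1 / \<xi>) ^ (n div q) \<le> (\<gamma> ^ q) ^ (n div q)" using bq \<xi> by (intro power_mono) auto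
      also have "\<dots> = \<gamma> ^ (q * (n div q))" by (simp add: power_mult)
      also have "\<dots> \<le> \<gamma> ^ n" using g1 by (intro power_increasing) auto
      finally show ?thesis .
    qed
    have 3: "b ^ (q * ((n + p) div p)) \<le> \<gamma> ^ (n + p)"
    proof -
      have "b ^ (q * ((n + p) div p)) \<le> (\<gamma> ^ q) ^ (q * ((n + p) div p))" using bq b by (intro power_mono) auto
      also have "\<dots> = \<gamma> ^ (p * ((n + p) div p))" by (simp add: power_mult[symmetric] p_def mult.assoc)
      also have "\<dots> \<le> \<gamma> ^ (n + p)" using g1 by (intro power_increasing times_div_less_eq_dividend) auto
      finally show ?thesis .
    qed
    have pos: "0 \<le> b" "0 \<le> \<gamma>" using b g1 by auto
    have "Bo n = b ^ n * b ^ (n div q) * b ^ (q * ((n + p) div p)) * b ^ 2"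
      unfolding Bo_def pattern_size_bound_def power_add by (simp only: ac_simps)
    also have "\<dots> \<le> b ^ n * \<gamma> ^ n * \<gamma> ^ (n + p) * b ^ 2"
      using 1 3 pos by (intro mult_mono mult_nonneg_nonneg) auto
    finally have B1: "Bo n \<le> b ^ n * \<gamma> ^ n * \<gamma> ^ (n + p) * b ^ 2" .
    have N2: "(1 + \<xi>) ^ n * (1 / \<xi>) ^ (n div q) \<le> \<gamma> ^ n * \<gamma> ^ n"
      using 2 pos \<xi> by (intro mult_mono) (auto simp: \<xi>_def)
    have "BN n \<le> (b ^ n * \<gamma> ^ n * \<gamma> ^ (n + p) * b ^ 2) * (\<gamma> ^ n * \<gamma> ^ n)"
      unfolding BN_def by (rule mult_mono[OF B1 N2]) (use pos \<xi> in auto)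
    also have "\<dots> = C * (b * \<gamma> ^ 4) ^ n"
    proof -
      have "(b * \<gamma> ^ 4) ^ n = b ^ n * (\<gamma> ^ n * \<gamma> ^ n * \<gamma> ^ n * \<gamma> ^ n)"
        by (simp add: power_mult_distrib power4_eq_xxxx)
      then show ?thesis unfolding C_def power_add by (simp only: ac_simps)
    qed
    finally show ?thesis .
  qed
  define \<delta> where "\<delta> = 2 - b * \<gamma> ^ 4"
  have "0 < \<delta>" using b\<gamma> by (simp add: \<delta>_def)
  moreover have "set_cover_solvable_in_Ostar (\<lambda>n. (2 - \<delta>) ^ n)"
  proof -
    obtain pm k where pm: "computes_at 0 k BN (\<lambda>n. {x. len (left x) = n}) pm search"
      using computable_search by (rule computableE)
    define m where "m = nat \<lceil>C\<rceil>"
    have m: "C \<le> real m" by (simp add: m_def real_nat_ceiling_ge)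
    show ?thesis
      unfolding set_cover_solvable_in_Ostar_def solvable_in_Ostar_def
    \<comment> \<open>The factor \<open>2 ^ k\<close> accounts for the passage from
      \<open>size + 2\<close> to \<open>size + 1\<close>, and \<open>m\<close> for the constant
      \<open>C\<close>.\<close>
    proof (rule exI[of _ pm], rule exI[of _ "2 ^ k * m"], rule exI[of _ k], rule ballI)
      fix i assume i: "i \<in> set_cover_instances"
      obtain n Ss where nS: "i = (n, Ss)" by (cases i)
      let ?x = "enc_set_cover i" and ?s = "(\<lambda>_. Leaf)(0 := enc_set_cover i)"
      have s0: "?s 0 = ?x" by simp
      have "?s 0 \<in> {x. len (left x) = n}" by (simp add: nS enc_set_cover_def)
      from pm[unfolded computes_at_def, THEN spec[of _ n], THEN spec[of _ ?s], THEN mp, OF this]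
      obtain t s' where t: "exec pm ?s t s'" "s' 0 = search ?x" "real t \<le> real ((size ?x + 2) ^ k) * BN n"
        unfolding s0 by (elim exE conjE) (rule that)
      have "(size ?x + 2) ^ k \<le> (2 * (size ?x + 1)) ^ k" by (rule power_mono) auto
      then have sz: "real ((size ?x + 2) ^ k) \<le> 2 ^ k * real (size ?x + 1) ^ k"
        by (metis (mono_tags, lifting) of_nat_le_iff of_nat_mult of_nat_numeral of_nat_power power_mult_distrib)
      have pos: "0 \<le> (b * \<gamma> ^ 4) ^ n" using b \<gamma>1 by simp
      have "C * (b * \<gamma> ^ 4) ^ n \<le> real m * (b * \<gamma> ^ 4) ^ n" by (rule mult_right_mono[OF m pos])
      then have "BN n \<le> real m * (b * \<gamma> ^ 4) ^ n" using bound[of n] by linarith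
      then have "real ((size ?x + 2) ^ k) * BN n \<le> (2 ^ k * real (size ?x + 1) ^ k) * (real m * (b * \<gamma> ^ 4) ^ n)"
        using sz pos B[of n] by (intro mult_mono) auto
      also have "\<dots> = real (2 ^ k * m) * real (size ?x + 1) ^ k * (2 - \<delta>) ^ n" by (simp add: \<delta>_def)
      finally have "real t \<le> real (2 ^ k * m) * real (size ?x + 1) ^ k * (2 - \<delta>) ^ n" using t(3) by linarith
      moreover have "runs pm ?x t (search ?x)" unfolding runs_def using t(1,2) by blast
      moreover have "set_cover_correct i (search ?x)" using search_correct i nS by simp
      ultimately show "\<exists>t y. runs pm ?x t y \<and> set_cover_correct i y \<and>
          real t \<le> real (2 ^ k * m) * real (size ?x + 1) ^ k * (case i of (n, Ss) \<Rightarrow> (2 - \<delta>) ^ n)"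
        by (auto simp: nS)
    qed
  qed
  ultimately show ?thesis by blast
qed

end
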